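(* Let $\Gamma$ be a compact metric graph, let $\frac12<\beta\le1$, $f\in\widetilde H^\beta(\Gamma)$ and $g\in\widetilde H^2(\Gamma)$. Then $$\sum_{e\in\mathcal E}\int_ef_e(x)\,g_e''(x)\,dx=-\sum_{v\in\mathcal V}\sum_{e\in\mathcal E_v}f|_e(v)\,\partial_eg(v)-\sum_{e\in\mathcal E}\langle g_e',f_e'\rangle_{H^{1-\beta}(e)\times H^{\beta-1}(e)}.$$ In particular, if moreover $g$ satisfies the Kirchhoff vertex conditions $\sum_{e\in\mathcal E_v}\partial_eg(v)=0$ for all $v\in\mathcal V$ and $f$ is continuous at each vertex $v\in\mathcal V$, then $$\sum_{e\in\mathcal E}\int_ef_e(x)\,g_e''(x)\,dx=-\sum_{e\in\mathcal E}\langle g_e',f_e'\rangle_{H^{1-\beta}(e)\times H^{\beta-1}(e)}.$$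
   Context: A compact metric graph $\Gamma$ consists of a finite vertex set $\mathcal V$ and a finite edge set $\mathcal E$ (loops and multiple edges allowed); each edge $e$ is identified with $[0,l_e]$, $0<l_e<\infty$. $\mathcal E_v$ is the set of edges incident to $v$ (a loop at $v$ counted twice, once per end). $u_e=u|_e$ is the restriction of $u$ to $e$, and $f|_e(v)$ is the (trace) value of $f_e$ at the end of $e$ located at $v$. $\partial_eg(v)$ is the derivative of $g$ along $e$ at $v$ in the direction away from $v$ ($g_e'(0)$ if $v$ sits at $0$, $-g_e'(l_e)$ if $v$ sits at $l_e$). $L_2(\Gamma)=\bigoplus_eL_2(e)$, $\widetilde H^r(\Gamma)=\bigoplus_eH^r(e)$ for $r\in\mathbb N$, and $\widetilde H^s(\Gamma)=(L_2(\Gamma),\widetilde H^1(\Gamma))_s$ (real interpolation, exponent 2) for $0<s<1$. On an edge, $H^s(e)$, $s>0$, is the usual fractional Sobolev space, $H^s_0(e)$ the closure of $C_c^\infty(e)$ in $H^s(e)$, and $H^{-s}(e)$ the dual of $H^s_0(e)$; for $0<s<\frac12$, $H^s_0(e)=H^s(e)$, so the pairing $\langle\cdot,\cdot\rangle_{H^s(e)\times H^{-s}(e)}$ makes sense, and it coincides with the $L_2(e)$ inner product on $H^s(e)\times L_2(e)$ (for $s=0$ it is the $L_2(e)$ inner product). The weak derivative maps $H^\beta(e)$ boundedly into $H^{\beta-1}(e)$. *)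

theory Defs
  imports "HOL-Analysis.Analysis"
begin

section \<open>Function spaces on an interval\<close>

text \<open>
  An edge of length \<open>l\<close> is the interval \<open>[0,l]\<close>. Elements of \<open>L\<^sub>2(0,l)\<close> and of the Sobolev spaces
  are represented by real-valued Borel functions; all notions below depend only on the
  class of a function modulo equality almost everywhere on \<open>[0,l]\<close>, and values outside \<open>[0,l]\<close>
  are irrelevant.
\<close>

definition edge_measure :: "real \<Rightarrow> real measure" where
  "edge_measure l = restrict_space lborel {0..l}"

definition L2_edge :: "real \<Rightarrow> (real \<Rightarrow> real) set" where
  "L2_edge l = {u. u \<in> borel_measurable (edge_measure l) \<and>
     integrable (edge_measure l) (\<lambda>x. (u x)\<^sup>2)}"

definition L2_inner :: "real \<Rightarrow> (real \<Rightarrow> real) \<Rightarrow> (real \<Rightarrow> real) \<Rightarrow> real" where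
  "L2_inner l u v = (\<integral>x. u x * v x \<partial>edge_measure l)"

definition L2_norm :: "real \<Rightarrow> (real \<Rightarrow> real) \<Rightarrow> real" where
  "L2_norm l u = sqrt (L2_inner l u u)"

text \<open>The space \<open>C\<^sub>c\<^sup>\<infinity>(0,l)\<close>, its elements being extended by zero to the whole line.\<close>

definition test_functions :: "real \<Rightarrow> (real \<Rightarrow> real) set" where
  "test_functions l = {\<phi>. (\<forall>k x. (deriv ^^ k) \<phi> differentiable (at x)) \<and>
     (\<exists>a b. 0 < a \<and> b < l \<and> (\<forall>x. x \<notin> {a..b} \<longrightarrow> \<phi> x = 0))}"

definition is_weak_deriv :: "real \<Rightarrow> (real \<Rightarrow> real) \<Rightarrow> (real \<Rightarrow> real) \<Rightarrow> bool" where
  "is_weak_deriv l u v \<longleftrightarrow> (\<forall>\<phi>\<in>test_functions l. L2_inner l u (deriv \<phi>) = - L2_inner l v \<phi>)"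

definition weak_deriv :: "real \<Rightarrow> (real \<Rightarrow> real) \<Rightarrow> (real \<Rightarrow> real)" where
  "weak_deriv l u = (SOME v. v \<in> L2_edge l \<and> is_weak_deriv l u v)"

primrec H_edge :: "real \<Rightarrow> nat \<Rightarrow> (real \<Rightarrow> real) set" where
  "H_edge l 0 = L2_edge l"
| "H_edge l (Suc r) = {u \<in> L2_edge l. \<exists>v \<in> H_edge l r. is_weak_deriv l u v}"

definition H1_norm :: "real \<Rightarrow> (real \<Rightarrow> real) \<Rightarrow> real" where
  "H1_norm l u = sqrt ((L2_norm l u)\<^sup>2 + (L2_norm l (weak_deriv l u))\<^sup>2)"

text \<open>Fractional Sobolev spaces \<open>H\<^sup>s(0,l)\<close> for \<open>0 < s < 1\<close>, with the Sobolev-Slobodeckij norm.\<close>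

definition gagliardo :: "real \<Rightarrow> real \<Rightarrow> (real \<Rightarrow> real) \<Rightarrow> ennreal" where
  "gagliardo l s u =
     (\<integral>\<^sup>+x. (\<integral>\<^sup>+y. ennreal ((u x - u y)\<^sup>2 / \<bar>x - y\<bar> powr (1 + 2 * s)) \<partial>edge_measure l)
        \<partial>edge_measure l)"

definition Hs_edge :: "real \<Rightarrow> real \<Rightarrow> (real \<Rightarrow> real) set" where
  "Hs_edge l s = {u \<in> L2_edge l. gagliardo l s u < \<infinity>}"

definition Hs_norm :: "real \<Rightarrow> real \<Rightarrow> (real \<Rightarrow> real) \<Rightarrow> real" where
  "Hs_norm l s u = sqrt ((L2_norm l u)\<^sup>2 + enn2real (gagliardo l s u))"

definition Hs0_edge :: "real \<Rightarrow> real \<Rightarrow> (real \<Rightarrow> real) set" where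
  "Hs0_edge l s = {u \<in> Hs_edge l s.
     \<forall>\<epsilon>>0. \<exists>\<phi>\<in>test_functions l. Hs_norm l s (\<lambda>x. u x - \<phi> x) < \<epsilon>}"

text \<open>
  The dual \<open>H\<^sup>-\<^sup>s(0,l)\<close> of \<open>H\<^sub>0\<^sup>s(0,l)\<close>; the pairing of \<open>u\<close> with \<open>F\<close> is \<open>F u\<close>. Functionals are made
  extensional so that equal elements of the dual are equal as HOL functions.
\<close>

definition Hneg_edge :: "real \<Rightarrow> real \<Rightarrow> ((real \<Rightarrow> real) \<Rightarrow> real) set" where
  "Hneg_edge l s = {F \<in> extensional (Hs0_edge l s).
     (\<forall>u\<in>Hs0_edge l s. \<forall>v\<in>Hs0_edge l s. \<forall>a b. F (\<lambda>x. a * u x + b * v x) = a * F u + b * F v) \<and>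
     (\<exists>C. \<forall>u\<in>Hs0_edge l s. \<bar>F u\<bar> \<le> C * Hs_norm l s u)}"

text \<open>
  The weak derivative of \<open>u \<in> H\<^sup>\<beta>(0,l)\<close>, \<open>1/2 < \<beta> \<le> 1\<close>, as an element of \<open>H\<^sup>\<beta>\<^sup>-\<^sup>1(0,l)\<close>, that is, as a
  functional on \<open>H\<^sub>0\<^sup>1\<^sup>-\<^sup>\<beta>(0,l) = H\<^sup>1\<^sup>-\<^sup>\<beta>(0,l)\<close>. For \<open>\<beta> = 1\<close> it lies in \<open>L\<^sub>2\<close> and acts by the inner product;
  for \<open>\<beta> < 1\<close> it is the continuous extension of the distributional derivative, which is unique
  because test functions are dense in \<open>H\<^sub>0\<^sup>1\<^sup>-\<^sup>\<beta>(0,l)\<close>.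
\<close>

definition weak_deriv_dual :: "real \<Rightarrow> real \<Rightarrow> (real \<Rightarrow> real) \<Rightarrow> ((real \<Rightarrow> real) \<Rightarrow> real)" where
  "weak_deriv_dual l \<beta> u =
     (if \<beta> = 1 then (\<lambda>h\<in>L2_edge l. L2_inner l h (weak_deriv l u))
      else (THE F. F \<in> Hneg_edge l (1 - \<beta>) \<and>
              (\<forall>\<phi>\<in>test_functions l. F \<phi> = - L2_inner l u (deriv \<phi>))))"

text \<open>The value at \<open>a \<in> {0,l}\<close> of the continuous representative.\<close>

definition edge_trace :: "real \<Rightarrow> (real \<Rightarrow> real) \<Rightarrow> real \<Rightarrow> real" where
  "edge_trace l u a = (THE c. \<exists>w. continuous_on {0..l} w \<and>
     (AE x in edge_measure l. u x = w x) \<and> w a = c)"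


section \<open>Compact metric graphs\<close>

text \<open>
  Edge \<open>e\<close> is identified with \<open>[0, len \<Gamma> e]\<close> such that its end \<open>0\<close> is located at \<open>src \<Gamma> e\<close> and its
  other end at \<open>tgt \<Gamma> e\<close>. This merely parametrises the edge.
\<close>

record ('v, 'e) metric_graph =
  verts :: "'v set"
  edges :: "'e set"
  src :: "'e \<Rightarrow> 'v"
  tgt :: "'e \<Rightarrow> 'v"
  len :: "'e \<Rightarrow> real"

definition compact_metric_graph :: "('v, 'e) metric_graph \<Rightarrow> bool" where
  "compact_metric_graph \<Gamma> \<longleftrightarrow> finite (verts \<Gamma>) \<and> finite (edges \<Gamma>) \<and>
     (\<forall>e\<in>edges \<Gamma>. src \<Gamma> e \<in> verts \<Gamma> \<and> tgt \<Gamma> e \<in> verts \<Gamma> \<and> 0 < len \<Gamma> e)"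

text \<open>Edge ends are used instead of edges so that a loop is counted twice at its vertex.\<close>

datatype 'e edge_end = Src 'e | Tgt 'e

definition incident :: "('v, 'e) metric_graph \<Rightarrow> 'v \<Rightarrow> 'e edge_end set" where
  "incident \<Gamma> v = {Src e | e. e \<in> edges \<Gamma> \<and> src \<Gamma> e = v} \<union> {Tgt e | e. e \<in> edges \<Gamma> \<and> tgt \<Gamma> e = v}"

fun end_value :: "('v, 'e) metric_graph \<Rightarrow> ('e \<Rightarrow> real \<Rightarrow> real) \<Rightarrow> 'e edge_end \<Rightarrow> real" where
  "end_value \<Gamma> f (Src e) = edge_trace (len \<Gamma> e) (f e) 0"
| "end_value \<Gamma> f (Tgt e) = edge_trace (len \<Gamma> e) (f e) (len \<Gamma> e)"

text \<open>The derivative along an edge at one of its ends, in the direction away from the vertex.\<close>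

fun end_deriv :: "('v, 'e) metric_graph \<Rightarrow> ('e \<Rightarrow> real \<Rightarrow> real) \<Rightarrow> 'e edge_end \<Rightarrow> real" where
  "end_deriv \<Gamma> g (Src e) = edge_trace (len \<Gamma> e) (weak_deriv (len \<Gamma> e) (g e)) 0"
| "end_deriv \<Gamma> g (Tgt e) = - edge_trace (len \<Gamma> e) (weak_deriv (len \<Gamma> e) (g e)) (len \<Gamma> e)"

definition continuous_at_vertex ::
  "('v, 'e) metric_graph \<Rightarrow> ('e \<Rightarrow> real \<Rightarrow> real) \<Rightarrow> 'v \<Rightarrow> bool" where
  "continuous_at_vertex \<Gamma> f v \<longleftrightarrow>
     (\<forall>a\<in>incident \<Gamma> v. \<forall>b\<in>incident \<Gamma> v. end_value \<Gamma> f a = end_value \<Gamma> f b)"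

definition kirchhoff_at_vertex ::
  "('v, 'e) metric_graph \<Rightarrow> ('e \<Rightarrow> real \<Rightarrow> real) \<Rightarrow> 'v \<Rightarrow> bool" where
  "kirchhoff_at_vertex \<Gamma> g v \<longleftrightarrow> (\<Sum>a\<in>incident \<Gamma> v. end_deriv \<Gamma> g a) = 0"


section \<open>Function spaces on a metric graph\<close>

definition H_graph :: "('v, 'e) metric_graph \<Rightarrow> nat \<Rightarrow> ('e \<Rightarrow> real \<Rightarrow> real) set" where
  "H_graph \<Gamma> r = {u. \<forall>e\<in>edges \<Gamma>. u e \<in> H_edge (len \<Gamma> e) r}"

definition L2_graph_norm :: "('v, 'e) metric_graph \<Rightarrow> ('e \<Rightarrow> real \<Rightarrow> real) \<Rightarrow> real" where
  "L2_graph_norm \<Gamma> u = L2_set (\<lambda>e. L2_norm (len \<Gamma> e) (u e)) (edges \<Gamma>)"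

definition H1_graph_norm :: "('v, 'e) metric_graph \<Rightarrow> ('e \<Rightarrow> real \<Rightarrow> real) \<Rightarrow> real" where
  "H1_graph_norm \<Gamma> u = L2_set (\<lambda>e. H1_norm (len \<Gamma> e) (u e)) (edges \<Gamma>)"

text \<open>Peetre's K-functional of the couple \<open>(L\<^sub>2(\<Gamma>), H\<^sup>1(\<Gamma>))\<close>, the latter being the decoupled space.\<close>

definition K_functional ::
  "('v, 'e) metric_graph \<Rightarrow> real \<Rightarrow> ('e \<Rightarrow> real \<Rightarrow> real) \<Rightarrow> real" where
  "K_functional \<Gamma> t u = Inf {L2_graph_norm \<Gamma> v + t * H1_graph_norm \<Gamma> w | v w.
     v \<in> H_graph \<Gamma> 0 \<and> w \<in> H_graph \<Gamma> 1 \<and>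
     (\<forall>e\<in>edges \<Gamma>. AE x in edge_measure (len \<Gamma> e). u e x = v e x + w e x)}"

text \<open>The real interpolation space \<open>(L\<^sub>2(\<Gamma>), H\<^sup>1(\<Gamma>))\<^sub>s\<close> with exponent 2, for \<open>0 < s < 1\<close>.\<close>

definition interpolation_graph ::
  "('v, 'e) metric_graph \<Rightarrow> real \<Rightarrow> ('e \<Rightarrow> real \<Rightarrow> real) set" where
  "interpolation_graph \<Gamma> s = {u \<in> H_graph \<Gamma> 0.
     (\<integral>\<^sup>+t\<in>{0<..}. ennreal ((t powr (- s) * K_functional \<Gamma> t u)\<^sup>2 / t) \<partial>lborel) < \<infinity>}"

text \<open>The decoupled Sobolev space of order \<open>s\<close>, meaningful for \<open>0 < s < 1\<close> and for \<open>s \<in> \<nat>\<close>.\<close>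

definition Hs_graph :: "('v, 'e) metric_graph \<Rightarrow> real \<Rightarrow> ('e \<Rightarrow> real \<Rightarrow> real) set" where
  "Hs_graph \<Gamma> s = (if s \<in> \<nat> then H_graph \<Gamma> (nat \<lfloor>s\<rfloor>) else interpolation_graph \<Gamma> s)"

end

theory Submission
  imports Defs
begin

text \<open>
  Everything is reduced to one edge \<open>[0,l]\<close>. For \<open>\<beta> = 1\<close> both functions are absolutely continuous
  and the claim is classical. For \<open>\<beta> < 1\<close> put \<open>s = 1 - \<beta> < 1/2\<close>. Splitting \<open>f = v\<^sub>n + w\<^sub>n\<close> almost
  optimally for the K-functional at \<open>t = 2\<^sup>-\<^sup>n\<close>, the \<open>w\<^sub>n\<close> converge uniformly because \<open>\<beta> > 1/2\<close>, so \<open>f\<close> has a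
  continuous representative, and a discrete Hardy inequality shows that its dyadic second differences
  are square summable with weight \<open>2\<^bsup>n(2\<beta>-1)\<^esup>\<close>. The dual derivative of \<open>f\<close> is the limit of the forms
  \<open>\<Sum>\<^sub>j (f(x\<^sub>j\<^sub>+\<^sub>1) - f(x\<^sub>j)) avg\<^sub>j h\<close> over dyadic partitions: by summation by parts, consecutive forms differ by
  second differences of \<open>f\<close> paired with jumps between the averages of \<open>h\<close> on adjacent cells, and the latter are
  controlled by the Gagliardo seminorm of \<open>h\<close>. For absolutely continuous \<open>h\<close> these forms are
  Riemann-Stieltjes sums and converge to the boundary term minus \<open>\<integral> f h'\<close>. Finally \<open>g'\<close> lies in
  \<open>H\<^sub>0\<^sup>s\<close>, since for \<open>s < 1/2\<close> its boundary values can be cut off at small cost.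
\<close>


text \<open>The two fractional spaces are given by different means: the regularity of f through the
  K-functional, the dual norm through the Gagliardo seminorm. Dyadic coefficients are the common
  ground. The second differences of f are twice its Faber-Schauder coefficients, the jumps between
  averages of h are Haar coefficients up to scaling, and the derivative of a Faber-Schauder function
  is a Haar function; this is why only these two families meet. Their weights 2^(n(2\<beta>-1)) and
  2^(-n(1-2s)) are reciprocal because s = 1 - \<beta>, so Cauchy-Schwarz matches them exactly. A
  second obstacle is that the dual derivative is a \<open>THE\<close> and the weak derivative a
  \<open>SOME\<close>. The first asks for existence (a bounded limit on all of
  \<open>Hs0_edge\<close>) and for uniqueness (density of test functions). The second asks that
  every statement about g' survive a change on a null set; the predicate \<open>primitive\<close>
  supplies the pointwise representatives with which one can compute.\<close>

section \<open>The measure of an edge\<close>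

lemma space_edge [simp]: "space (edge_measure l) = {0..l}"
  by (simp add: edge_measure_def space_restrict_space)

lemma sets_edge: "A \<in> sets (edge_measure l) \<longleftrightarrow> A \<in> sets borel \<and> A \<subseteq> {0..l}"
  by (auto simp: edge_measure_def sets_restrict_space_iff)

lemma emeasure_edge: "A \<in> sets borel \<Longrightarrow> A \<subseteq> {0..l} \<Longrightarrow> emeasure (edge_measure l) A = emeasure lborel A"
  by (simp add: edge_measure_def emeasure_restrict_space)

lemma finite_measure_edge: "finite_measure (edge_measure l)"
proof
  show "emeasure (edge_measure l) (space (edge_measure l)) \<noteq> \<infinity>"
    by (simp only: space_edge, subst emeasure_edge) (auto simp: emeasure_lborel_Icc_eq)
qed

lemma sigma_finite_edge: "sigma_finite_measure (edge_measure l)"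
  using finite_measure_edge by (rule finite_measure.axioms)

lemma borel_measurable_edge: "u \<in> borel_measurable borel \<Longrightarrow> u \<in> borel_measurable (edge_measure l)"
  by (simp add: edge_measure_def measurable_restrict_space1)

lemma borel_measurable_edge_continuous_on:
  fixes u :: "real \<Rightarrow> real"
  assumes "continuous_on {0..l} u"
  shows "u \<in> borel_measurable (edge_measure l)"
  using borel_measurable_continuous_on_restrict[OF assms]
  by (simp add: edge_measure_def cong: measurable_cong_sets sets_restrict_space_cong)

lemma nn_integral_edge:
  "(\<integral>\<^sup>+x. u x \<partial>edge_measure l) = (\<integral>\<^sup>+x. u x * indicator {0..l} x \<partial>lborel)"
  by (simp add: edge_measure_def nn_integral_restrict_space)

lemma set_integral_edge:
  fixes u :: "real \<Rightarrow> real"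
  assumes "A \<subseteq> {0..l}"
  shows "(LINT x:A|edge_measure l. u x) = (LINT x:A|lborel. u x)"
proof -
  have "(\<lambda>x. indicator {0..l} x *\<^sub>R indicator A x *\<^sub>R u x) = (\<lambda>x. indicator A x *\<^sub>R u x)"
    using assms by (auto simp: indicator_def fun_eq_iff)
  then show ?thesis
    unfolding edge_measure_def set_lebesgue_integral_def
    by (subst integral_restrict_space) (simp_all only:, auto)
qed

section \<open>Square integrable functions\<close>

lemma integrable_mult_of_squares:
  fixes u v :: "'a \<Rightarrow> real"
  assumes [measurable]: "u \<in> borel_measurable M" "v \<in> borel_measurable M"
    and "integrable M (\<lambda>x. (u x)\<^sup>2)" "integrable M (\<lambda>x. (v x)\<^sup>2)"
  shows "integrable M (\<lambda>x. u x * v x)"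
proof (rule Bochner_Integration.integrable_bound)
  show "integrable M (\<lambda>x. (u x)\<^sup>2 + (v x)\<^sup>2)"
    using assms by auto
  have "\<bar>a * b\<bar> \<le> a\<^sup>2 + b\<^sup>2" for a b :: real
  proof -
    have "0 \<le> (a - b)\<^sup>2" "0 \<le> (a + b)\<^sup>2" by auto
    then show ?thesis
      by (simp add: power2_eq_square algebra_simps abs_if)
  qed
  then show "AE x in M. norm (u x * v x) \<le> norm ((u x)\<^sup>2 + (v x)\<^sup>2)"
    by auto
qed auto

text \<open>The quadratic form s^2 A - 2 s t B + t^2 C is nonnegative for all s and t; the choice s
  = C, t = B gives the claim when C is not 0.\<close>

lemma integral_Cauchy_Schwarz:
  fixes u v :: "'a \<Rightarrow> real"
  assumes [measurable]: "u \<in> borel_measurable M" "v \<in> borel_measurable M"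
    and i: "integrable M (\<lambda>x. (u x)\<^sup>2)" "integrable M (\<lambda>x. (v x)\<^sup>2)"
  shows "(\<integral>x. u x * v x \<partial>M)\<^sup>2 \<le> (\<integral>x. (u x)\<^sup>2 \<partial>M) * (\<integral>x. (v x)\<^sup>2 \<partial>M)"
proof -
  define A where "A = (\<integral>x. (u x)\<^sup>2 \<partial>M)"
  define B where "B = (\<integral>x. u x * v x \<partial>M)"
  define C where "C = (\<integral>x. (v x)\<^sup>2 \<partial>M)"
  have iuv: "integrable M (\<lambda>x. u x * v x)"
    by (intro integrable_mult_of_squares assms)
  have quad: "0 \<le> s\<^sup>2 * A - 2 * s * t * B + t\<^sup>2 * C" for s t
  proof -
    have "0 \<le> (\<integral>x. (s * u x - t * v x)\<^sup>2 \<partial>M)" by simp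
    also have "(\<lambda>x. (s * u x - t * v x)\<^sup>2) = (\<lambda>x. s\<^sup>2 * (u x)\<^sup>2 - 2 * s * t * (u x * v x) + t\<^sup>2 * (v x)\<^sup>2)"
      by (auto simp: power2_eq_square algebra_simps)
    also have "(\<integral>x. s\<^sup>2 * (u x)\<^sup>2 - 2 * s * t * (u x * v x) + t\<^sup>2 * (v x)\<^sup>2 \<partial>M)
        = s\<^sup>2 * A - 2 * s * t * B + t\<^sup>2 * C"
      using i iuv by (simp add: A_def B_def C_def)
    finally show ?thesis .
  qed
  have nn: "0 \<le> A" "0 \<le> C" by (simp_all add: A_def C_def)
  have "B\<^sup>2 \<le> A * C"
  proof (cases "C = 0")
    case False
    have "0 \<le> C\<^sup>2 * A - 2 * C * B * B + B\<^sup>2 * C" by (rule quad)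
    also have "\<dots> = C * (A * C - B\<^sup>2)" by (simp add: power2_eq_square algebra_simps)
    finally show ?thesis using False nn by (simp add: zero_le_mult_iff)
  next
    case True
    \<comment> \<open>Here s = B and t = A + 1. With C = 0 the coefficient of B^2 is A - 2 (A + 1) =
      - (A + 2), which is strictly negative even if A = 0.\<close>
    have "0 \<le> B\<^sup>2 * A - 2 * B * (A + 1) * B + (A+1)\<^sup>2 * C" by (rule quad)
    also have "\<dots> = - (B\<^sup>2 * (A + 2))" using True by (simp add: power2_eq_square algebra_simps)
    finally have "B\<^sup>2 * (A + 2) \<le> 0" by simp
    then have "B\<^sup>2 \<le> 0" using nn by (simp add: mult_le_0_iff)
    then show ?thesis using True by simp
  qed
  then show ?thesis by (simp add: A_def B_def C_def)
qed

lemma L2_edge_measurable [measurable_dest]: "u \<in> L2_edge l \<Longrightarrow> u \<in> borel_measurable (edge_measure l)"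
  by (simp add: L2_edge_def)

lemma L2_edge_square: "u \<in> L2_edge l \<Longrightarrow> integrable (edge_measure l) (\<lambda>x. (u x)\<^sup>2)"
  by (simp add: L2_edge_def)

lemma L2_edge_mult: "u \<in> L2_edge l \<Longrightarrow> v \<in> L2_edge l \<Longrightarrow> integrable (edge_measure l) (\<lambda>x. u x * v x)"
  by (rule integrable_mult_of_squares) (auto simp: L2_edge_def)

lemma L2_edge_const [simp]: "(\<lambda>x. c) \<in> L2_edge l"
  using finite_measure.integrable_const[OF finite_measure_edge] by (simp add: L2_edge_def)

lemma L2_edge_integrable: "u \<in> L2_edge l \<Longrightarrow> integrable (edge_measure l) u"
  using L2_edge_mult[of u l "\<lambda>x. 1"] by simp

lemma L2_edge_cmult: "u \<in> L2_edge l \<Longrightarrow> (\<lambda>x. c * u x) \<in> L2_edge l"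
  unfolding L2_edge_def mem_Collect_eq by (intro conjI borel_measurable_times) (auto simp: power_mult_distrib)

lemma L2_edge_add: "u \<in> L2_edge l \<Longrightarrow> v \<in> L2_edge l \<Longrightarrow> (\<lambda>x. u x + v x) \<in> L2_edge l"
  using L2_edge_mult[of u l v] by (auto simp: L2_edge_def power2_sum mult.assoc)

lemma L2_edge_diff: "u \<in> L2_edge l \<Longrightarrow> v \<in> L2_edge l \<Longrightarrow> (\<lambda>x. u x - v x) \<in> L2_edge l"
  using L2_edge_add[of u l "\<lambda>x. - 1 * v x"] L2_edge_cmult[of v l "-1"] by simp

lemma L2_edge_bounded:
  assumes "u \<in> borel_measurable (edge_measure l)" "\<And>x. x \<in> {0..l} \<Longrightarrow> \<bar>u x\<bar> \<le> B"
  shows "u \<in> L2_edge l"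
proof -
  have "integrable (edge_measure l) (\<lambda>x. (u x)\<^sup>2)"
  proof (rule finite_measure.integrable_const_bound[OF finite_measure_edge])
    show "AE x in edge_measure l. norm ((u x)\<^sup>2) \<le> B\<^sup>2"
      using assms(2) by (intro AE_I2) (force simp: abs_le_square_iff[symmetric])
  qed (use assms in auto)
  then show ?thesis using assms by (simp add: L2_edge_def)
qed

lemma L2_edge_continuous_on:
  assumes "continuous_on {0..l} u"
  shows "u \<in> L2_edge l"
proof -
  have "bounded (u ` {0..l})"
    by (intro compact_imp_bounded compact_continuous_image assms) auto
  then obtain B where "\<forall>x\<in>{0..l}. \<bar>u x\<bar> \<le> B"
    by (auto simp: bounded_iff simp del: atLeastAtMost_iff)
  then show ?thesis
    by (intro L2_edge_bounded[of _ _ B] borel_measurable_edge_continuous_on assms) auto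
qed

lemma L2_edge_cong_AE:
  assumes "u \<in> borel_measurable (edge_measure l)" "v \<in> L2_edge l" "AE x in edge_measure l. u x = v x"
  shows "u \<in> L2_edge l"
proof -
  have "integrable (edge_measure l) (\<lambda>x. (u x)\<^sup>2) \<longleftrightarrow> integrable (edge_measure l) (\<lambda>x. (v x)\<^sup>2)"
    using assms by (intro integrable_cong_AE) (auto simp: L2_edge_def)
  then show ?thesis using assms by (simp add: L2_edge_def)
qed

lemma L2_inner_add_left:
  "u \<in> L2_edge l \<Longrightarrow> v \<in> L2_edge l \<Longrightarrow> w \<in> L2_edge l \<Longrightarrow>
    L2_inner l (\<lambda>x. u x + v x) w = L2_inner l u w + L2_inner l v w"
  by (simp add: L2_inner_def distrib_right L2_edge_mult)

lemma L2_inner_diff_left: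
  "u \<in> L2_edge l \<Longrightarrow> v \<in> L2_edge l \<Longrightarrow> w \<in> L2_edge l \<Longrightarrow>
    L2_inner l (\<lambda>x. u x - v x) w = L2_inner l u w - L2_inner l v w"
  by (simp add: L2_inner_def left_diff_distrib L2_edge_mult)

lemma L2_inner_cmult_left: "L2_inner l (\<lambda>x. c * u x) w = c * L2_inner l u w"
  by (simp add: L2_inner_def mult.assoc)

lemma L2_inner_commute: "L2_inner l u v = L2_inner l v u"
  by (simp add: L2_inner_def mult.commute)

lemma L2_inner_cong_AE:
  assumes "u \<in> L2_edge l" "u' \<in> L2_edge l" "v \<in> L2_edge l" "AE x in edge_measure l. u x = u' x"
  shows "L2_inner l u v = L2_inner l u' v"
  unfolding L2_inner_def using assms by (intro integral_cong_AE) (auto simp: L2_edge_def)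

lemma L2_inner_self: "L2_inner l u u = (\<integral>x. (u x)\<^sup>2 \<partial>edge_measure l)"
  by (simp add: L2_inner_def power2_eq_square)

lemma L2_norm_nonneg [simp]: "0 \<le> L2_norm l u"
  by (simp add: L2_norm_def L2_inner_self)

lemma L2_norm_square: "(L2_norm l u)\<^sup>2 = (\<integral>x. (u x)\<^sup>2 \<partial>edge_measure l)"
  by (simp add: L2_norm_def L2_inner_self)

lemma L2_inner_le: "u \<in> L2_edge l \<Longrightarrow> v \<in> L2_edge l \<Longrightarrow> \<bar>L2_inner l u v\<bar> \<le> L2_norm l u * L2_norm l v"
proof -
  assume "u \<in> L2_edge l" "v \<in> L2_edge l"
  then have "(L2_inner l u v)\<^sup>2 \<le> (L2_norm l u)\<^sup>2 * (L2_norm l v)\<^sup>2"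
    unfolding L2_norm_square L2_inner_def by (intro integral_Cauchy_Schwarz) (auto simp: L2_edge_def)
  then show ?thesis
    by (simp add: power_mult_distrib[symmetric] abs_le_square_iff[symmetric])
qed

lemma L2_norm_triangle:
  assumes "u \<in> L2_edge l" "v \<in> L2_edge l"
  shows "L2_norm l (\<lambda>x. u x + v x) \<le> L2_norm l u + L2_norm l v"
proof (rule power2_le_imp_le)
  have "(L2_norm l (\<lambda>x. u x + v x))\<^sup>2 = (L2_norm l u)\<^sup>2 + 2 * L2_inner l u v + (L2_norm l v)\<^sup>2"
    using assms by (simp add: L2_norm_square L2_inner_def power2_sum L2_edge_mult L2_edge_square mult.assoc)
  also have "\<dots> \<le> (L2_norm l u + L2_norm l v)\<^sup>2"
    using L2_inner_le[OF assms] by (simp add: power2_sum)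
  finally show "(L2_norm l (\<lambda>x. u x + v x))\<^sup>2 \<le> (L2_norm l u + L2_norm l v)\<^sup>2" .
qed simp

lemma L2_norm_cmult: "L2_norm l (\<lambda>x. c * u x) = \<bar>c\<bar> * L2_norm l u"
  by (simp add: L2_norm_def L2_inner_self power_mult_distrib real_sqrt_mult)

lemma L2_norm_triangle_diff:
  assumes "u \<in> L2_edge l" "v \<in> L2_edge l"
  shows "L2_norm l (\<lambda>x. u x - v x) \<le> L2_norm l u + L2_norm l v"
  using L2_norm_triangle[OF assms(1) L2_edge_cmult[OF assms(2), of "-1"]] L2_norm_cmult[of l "-1" v]
  by simp

lemma L2_norm_cong_AE:
  assumes "u \<in> L2_edge l" "v \<in> L2_edge l" "AE x in edge_measure l. u x = v x"
  shows "L2_norm l u = L2_norm l v"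
proof -
  have "(L2_norm l u)\<^sup>2 = (L2_norm l v)\<^sup>2"
    unfolding L2_norm_square using assms by (intro integral_cong_AE) (auto simp: L2_edge_def)
  then show ?thesis by simp
qed

lemma L2_norm_eq_0_AE:
  assumes "u \<in> L2_edge l" "L2_norm l u = 0"
  shows "AE x in edge_measure l. u x = 0"
proof -
  have "(\<integral>x. (u x)\<^sup>2 \<partial>edge_measure l) = 0" using assms(2) L2_norm_square[of l u] by simp
  then have "AE x in edge_measure l. (u x)\<^sup>2 = 0"
    using assms by (subst (asm) integral_nonneg_eq_0_iff_AE) (auto simp: L2_edge_def)
  then show ?thesis by simp
qed

lemma L2_norm_bounded:
  assumes "l \<ge> 0" "u \<in> L2_edge l" "B \<ge> 0" "\<And>x. x \<in> {0..l} \<Longrightarrow> \<bar>u x\<bar> \<le> B"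
  shows "(L2_norm l u)\<^sup>2 \<le> B\<^sup>2 * l"
proof -
  have "(L2_norm l u)\<^sup>2 \<le> (\<integral>x. B\<^sup>2 \<partial>edge_measure l)"
    unfolding L2_norm_square
  proof (rule integral_mono)
    show "integrable (edge_measure l) (\<lambda>x. B\<^sup>2)"
      using L2_edge_const L2_edge_integrable by blast
  qed (use assms in \<open>auto simp: L2_edge_square abs_le_square_iff[symmetric]\<close>)
  also have "\<dots> = B\<^sup>2 * l"
    using assms(1) by (simp add: measure_def emeasure_edge)
  finally show ?thesis .
qed

section \<open>Integrals over subintervals\<close>

lemma set_integrable_edge:
  fixes v :: "real \<Rightarrow> real"
  assumes "integrable (edge_measure l) v" "0 \<le> x" "y \<le> l"
  shows "set_integrable (edge_measure l) {x..y} v"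
  unfolding set_integrable_def using assms
  by (intro integrable_mult_indicator) (auto simp: sets_edge)

lemma set_integral_edge_combine:
  fixes v :: "real \<Rightarrow> real"
  assumes "integrable (edge_measure l) v" "0 \<le> x" "x \<le> y" "y \<le> z" "z \<le> l"
  shows "(LINT t:{x..z}|edge_measure l. v t) = (LINT t:{x..y}|edge_measure l. v t) + (LINT t:{y..z}|edge_measure l. v t)"
proof -
  have "(LINT t:{x..y} \<union> {y..z}|edge_measure l. v t) = (LINT t:{x..y}|edge_measure l. v t) + (LINT t:{y..z}|edge_measure l. v t)"
  proof (rule set_integral_Un_AE)
    have "emeasure (edge_measure l) {y} = 0"
      using assms by (subst emeasure_edge) auto
    then have "AE t in edge_measure l. t \<notin> {y}"
      using assms by (intro AE_not_in) (auto simp: null_sets_def sets_edge)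
    then show "AE t in edge_measure l. \<not> (t \<in> {x..y} \<and> t \<in> {y..z})"
      by eventually_elim auto
  qed (use assms in \<open>auto simp: sets_edge intro!: set_integrable_edge\<close>)
  moreover have "{x..y} \<union> {y..z} = {x..z}" using assms by auto
  ultimately show ?thesis by simp
qed

lemma set_integral_edge_whole: "(LINT t:{0..l}|edge_measure l. v t) = (\<integral>t. (v t :: real) \<partial>edge_measure l)"
  using set_integral_space[of "edge_measure l" v] L2_edge_integrable
  unfolding set_lebesgue_integral_def
  by (intro Bochner_Integration.integral_cong) (auto simp: indicator_def)

lemma set_integral_edge_const:
  assumes "0 \<le> x" "x \<le> y" "y \<le> l"
  shows "(LINT t:{x..y}|edge_measure l. c) = c * (y - x :: real)"
  using assms by (simp add: set_lebesgue_integral_def measure_def emeasure_edge)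

lemma set_integral_edge_bound:
  fixes v :: "real \<Rightarrow> real"
  assumes "integrable (edge_measure l) v" "0 \<le> x" "x \<le> y" "y \<le> l" "\<And>t. t \<in> {x..y} \<Longrightarrow> \<bar>w t\<bar> \<le> B"
    "w \<in> borel_measurable (edge_measure l)"
  shows "set_integrable (edge_measure l) {x..y} (\<lambda>t. w t * v t)" (is ?I)
    and "\<bar>LINT t:{x..y}|edge_measure l. w t * v t\<bar> \<le> B * (LINT t:{x..y}|edge_measure l. \<bar>v t\<bar>)" (is ?B)
proof -
  have m: "{x..y} \<in> sets (edge_measure l)" using assms by (auto simp: sets_edge)
  have vm [measurable]: "v \<in> borel_measurable (edge_measure l)" "w \<in> borel_measurable (edge_measure l)"
    using assms by auto
  have int: "integrable (edge_measure l) (\<lambda>t. B * (indicator {x..y} t *\<^sub>R \<bar>v t\<bar>))"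
    using set_integrable_edge[OF integrable_abs[OF assms(1)] assms(2,4)] by (simp add: set_integrable_def)
  have le: "norm (indicator {x..y} t *\<^sub>R (w t * v t)) \<le> B * (indicator {x..y} t *\<^sub>R \<bar>v t\<bar>)" for t
    using assms(5)[of t] by (auto simp: indicator_def abs_mult intro!: mult_right_mono)
  show ?I unfolding set_integrable_def
  proof (rule Bochner_Integration.integrable_bound[OF int])
    show "AE t in edge_measure l. norm (indicator {x..y} t *\<^sub>R (w t * v t)) \<le> norm (B * (indicator {x..y} t *\<^sub>R \<bar>v t\<bar>))"
      using le by (intro AE_I2) (smt (verit) real_norm_def)
  qed (use m in simp)
  then have i2: "integrable (edge_measure l) (\<lambda>t. indicator {x..y} t *\<^sub>R (w t * v t))" by (simp add: set_integrable_def)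
  have "\<bar>LINT t:{x..y}|edge_measure l. w t * v t\<bar> \<le> (LINT t|edge_measure l. norm (indicator {x..y} t *\<^sub>R (w t * v t)))"
    unfolding set_lebesgue_integral_def using integral_norm_bound by (metis real_norm_def)
  also have "\<dots> \<le> (LINT t|edge_measure l. B * (indicator {x..y} t *\<^sub>R \<bar>v t\<bar>))"
    by (intro integral_mono integrable_norm i2 int le)
  finally show ?B by (simp add: set_lebesgue_integral_def)
qed

text \<open>Cauchy-Schwarz with the indicator of the interval as one factor. The gain
  \<open>y - x\<close> is the source of the Hoelder bound and of the estimates on dyadic
  cells.\<close>

lemma set_integral_edge_Cauchy_Schwarz:
  assumes "v \<in> L2_edge l" "0 \<le> x" "x \<le> y" "y \<le> l"
  shows "(LINT t:{x..y}|edge_measure l. v t)\<^sup>2 \<le> (y - x) * (LINT t:{x..y}|edge_measure l. (v t)\<^sup>2)"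
proof -
  have m [measurable]: "{x..y} \<in> sets (edge_measure l)" using assms by (auto simp: sets_edge)
  have vm [measurable]: "v \<in> borel_measurable (edge_measure l)" using assms(1) by (rule L2_edge_measurable)
  have e: "(indicator {x..y} t * v t)\<^sup>2 = indicator {x..y} t * (v t)\<^sup>2"
     "(indicator {x..y} t)\<^sup>2 = (indicator {x..y} t :: real)" for t by (auto simp: indicator_def)
  have iv: "integrable (edge_measure l) (\<lambda>t. indicator {x..y} t * (v t)\<^sup>2)"
    using set_integrable_edge[OF L2_edge_square[OF assms(1)] assms(2,4)] by (simp add: set_integrable_def)
  have ii: "integrable (edge_measure l) (indicator {x..y} :: real \<Rightarrow> real)"
    using set_integrable_edge[OF L2_edge_integrable[OF L2_edge_const[of 1]] assms(2,4)]
    by (simp add: set_integrable_def)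
  have "(\<integral>t. indicator {x..y} t * (indicator {x..y} t * v t) \<partial>edge_measure l)\<^sup>2
     \<le> (\<integral>t. (indicator {x..y} t)\<^sup>2 \<partial>edge_measure l) * (\<integral>t. (indicator {x..y} t * v t)\<^sup>2 \<partial>edge_measure l)"
    by (rule integral_Cauchy_Schwarz) (simp_all add: e iv ii)
  moreover have "(\<integral>t. (indicator {x..y} t :: real) \<partial>edge_measure l) = y - x"
    using set_integral_edge_const[OF assms(2-4), of 1] by (simp add: set_lebesgue_integral_def)
  moreover have "indicator {x..y} t * (indicator {x..y} t * v t) = indicator {x..y} t * v t" for t
    by (auto simp: indicator_def)
  ultimately show ?thesis by (simp add: e set_lebesgue_integral_def)
qed

lemma set_integral_edge_mono_set:
  fixes v :: "real \<Rightarrow> real"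
  assumes "integrable (edge_measure l) v" "\<And>t. 0 \<le> v t" "0 \<le> x" "x \<le> x'" "y' \<le> y" "y \<le> l"
  shows "(LINT t:{x'..y'}|edge_measure l. v t) \<le> (LINT t:{x..y}|edge_measure l. v t)"
  unfolding set_lebesgue_integral_def
proof (rule integral_mono)
  show "integrable (edge_measure l) (\<lambda>t. indicat_real {x'..y'} t *\<^sub>R v t)"
    "integrable (edge_measure l) (\<lambda>t. indicat_real {x..y} t *\<^sub>R v t)"
    using set_integrable_edge[OF assms(1)] assms by (auto simp: set_integrable_def)
  show "indicat_real {x'..y'} t *\<^sub>R v t \<le> indicat_real {x..y} t *\<^sub>R v t" for t
    using assms by (auto simp: indicator_def)
qed

lemma set_integral_edge_abs:
  fixes v :: "real \<Rightarrow> real"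
  shows "\<bar>LINT t:{x..y}|edge_measure l. v t\<bar> \<le> (LINT t:{x..y}|edge_measure l. \<bar>v t\<bar>)"
  unfolding set_lebesgue_integral_def
  using integral_norm_bound[of "edge_measure l" "\<lambda>t. indicat_real {x..y} t *\<^sub>R v t"]
  by (simp add: abs_mult)


section \<open>Smooth functions\<close>

text \<open>The polynomial factor closes the family under differentiation, which exp(-1/x) alone is
  not; \<open>p = 1\<close> is the classical flat function.\<close>

definition exp_flat :: "real poly \<Rightarrow> real \<Rightarrow> real" where
  "exp_flat p x = (if x > 0 then poly p (1 / x) * exp (- (1 / x)) else 0)"

lemma poly_times_exp_tendsto_0: "((\<lambda>y::real. poly p y * exp (- y)) \<longlongrightarrow> 0) at_top"
proof -
  have "((\<lambda>y. \<Sum>i\<le>degree p. coeff p i * (y ^ i / exp y)) \<longlongrightarrow> (\<Sum>i\<le>degree p. coeff p i * 0)) at_top"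
    by (intro tendsto_sum tendsto_mult tendsto_const tendsto_power_div_exp_0)
  moreover have "(\<lambda>y. \<Sum>i\<le>degree p. coeff p i * (y ^ i / exp y)) = (\<lambda>y. poly p y * exp (- y))"
    by (simp add: poly_altdef sum_distrib_right exp_minus divide_inverse mult.assoc)
  ultimately show ?thesis by simp
qed

text \<open>For x > 0 this is the chain rule in y = 1/x: the outer factor 1/x^2 is the polynomial
  \<open>[:0, 0, 1:]\<close>, and p - p' comes from the product rule. At 0 the difference quotient
  from the right is the flat function of y p(y), which tends to 0.\<close>

lemma exp_flat_deriv:
  "(exp_flat p has_real_derivative exp_flat ([:0, 0, 1:] * (p - pderiv p)) x) (at x)"
proof -
  consider "x > 0" | "x < 0" | "x = 0" by linarith
  then show ?thesis
  proof cases
    case 1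
    have "((\<lambda>x. poly p (1 / x) * exp (- (1 / x))) has_real_derivative
        exp_flat ([:0, 0, 1:] * (p - pderiv p)) x) (at x)"
      using 1 by (auto intro!: derivative_eq_intros DERIV_chain2[OF poly_DERIV]
          simp: exp_flat_def field_simps power2_eq_square)
    then show ?thesis
      by (rule has_field_derivative_transform_within_open[where S = "{0<..}"])
        (use 1 in \<open>auto simp: exp_flat_def\<close>)
  next
    case 2
    have "((\<lambda>x. 0) has_real_derivative exp_flat ([:0, 0, 1:] * (p - pderiv p)) x) (at x)"
      using 2 by (auto simp: exp_flat_def)
    then show ?thesis
      by (rule has_field_derivative_transform_within_open[where S = "{..<0}"])
        (use 2 in \<open>auto simp: exp_flat_def\<close>)
  next
    case 3
    have r: "((\<lambda>y. exp_flat p y / y) \<longlongrightarrow> 0) (at_right 0)"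
    proof -
      have "((\<lambda>y. poly (pCons 0 p) (inverse y) * exp (- inverse y)) \<longlongrightarrow> 0) (at_right 0)"
        by (rule filterlim_compose[OF poly_times_exp_tendsto_0 filterlim_inverse_at_top_right])
      then show ?thesis
        by (rule Lim_transform_eventually)
          (auto simp: eventually_at_right_field exp_flat_def field_simps intro!: exI[of _ 1])
    qed
    have l: "((\<lambda>y. exp_flat p y / y) \<longlongrightarrow> 0) (at_left 0)"
      by (rule Lim_transform_eventually[OF tendsto_const])
        (auto simp: eventually_at_left_field exp_flat_def intro!: exI[of _ "-1"])
    have "((\<lambda>y. exp_flat p y / y) \<longlongrightarrow> 0) (at 0)"
      using l r by (simp add: filterlim_at_split)
    then show ?thesis
      using 3 by (simp add: has_field_derivative_iff exp_flat_def)
  qed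
qed

text \<open>
  This encoding of smoothness avoids Leibniz rules for higher derivatives: every rule preserves the
  existence of a derivative in the same set.
\<close>

inductive_set smooth :: "(real \<Rightarrow> real) set" where
  smooth_exp_flat: "exp_flat p \<in> smooth"
| smooth_const: "(\<lambda>x. c) \<in> smooth"
| smooth_add: "u \<in> smooth \<Longrightarrow> v \<in> smooth \<Longrightarrow> (\<lambda>x. u x + v x) \<in> smooth"
| smooth_mult: "u \<in> smooth \<Longrightarrow> v \<in> smooth \<Longrightarrow> (\<lambda>x. u x * v x) \<in> smooth"
| smooth_affine: "u \<in> smooth \<Longrightarrow> (\<lambda>x. u (a * x + b)) \<in> smooth"
| smooth_antideriv: "(\<And>x. (u has_real_derivative v x) (at x)) \<Longrightarrow> v \<in> smooth \<Longrightarrow> u \<in> smooth"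

lemma smooth_has_derivative:
  "u \<in> smooth \<Longrightarrow> \<exists>u'\<in>smooth. \<forall>x. (u has_real_derivative u' x) (at x)"
proof (induction rule: smooth.induct)
  case (smooth_exp_flat p)
  then show ?case using exp_flat_deriv smooth.smooth_exp_flat by blast
next
  case (smooth_const c)
  show ?case by (rule bexI[of _ "\<lambda>x. 0"]) (auto intro: smooth.smooth_const)
next
  case (smooth_add u v)
  then obtain u' v' where "u' \<in> smooth" "v' \<in> smooth"
    "\<And>x. (u has_real_derivative u' x) (at x)" "\<And>x. (v has_real_derivative v' x) (at x)" by blast
  then show ?case
    by (intro bexI[of _ "\<lambda>x. u' x + v' x"]) (auto intro!: smooth.smooth_add DERIV_add)
next
  case (smooth_mult u v)
  then obtain u' v' where "u' \<in> smooth" "v' \<in> smooth"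
    "\<And>x. (u has_real_derivative u' x) (at x)" "\<And>x. (v has_real_derivative v' x) (at x)" by blast
  then show ?case using smooth_mult
    by (intro bexI[of _ "\<lambda>x. u' x * v x + v' x * u x"]) (auto intro!: smooth.smooth_add smooth.smooth_mult DERIV_mult)
next
  case (smooth_affine u a b)
  then obtain u' where u': "u' \<in> smooth" "\<And>x. (u has_real_derivative u' x) (at x)" by blast
  have "((\<lambda>x. u (a * x + b)) has_real_derivative u' (a * x + b) * a) (at x)" for x
    by (rule DERIV_chain2[OF u'(2)]) (auto intro!: derivative_eq_intros)
  moreover have "(\<lambda>x. u' (a * x + b) * a) \<in> smooth"
    by (rule smooth.smooth_mult[OF smooth.smooth_affine[OF u'(1)] smooth.smooth_const])
  ultimately show ?case by (intro bexI[of _ "\<lambda>x. u' (a * x + b) * a"] allI)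
qed blast

lemma smooth_deriv: "u \<in> smooth \<Longrightarrow> deriv u \<in> smooth"
  using smooth_has_derivative[of u] by (metis DERIV_imp_deriv ext)

lemma smooth_DERIV: "u \<in> smooth \<Longrightarrow> (u has_real_derivative deriv u x) (at x)"
  using smooth_has_derivative[of u] by (metis DERIV_imp_deriv)

lemma smooth_higher_differentiable: "u \<in> smooth \<Longrightarrow> (deriv ^^ k) u differentiable (at x)"
proof -
  assume "u \<in> smooth"
  then have "(deriv ^^ k) u \<in> smooth"
    by (induction k) (auto intro: smooth_deriv)
  then show ?thesis
    using smooth_DERIV real_differentiable_def by blast
qed

lemma smooth_continuous_on: "u \<in> smooth \<Longrightarrow> continuous_on S u"
  using smooth_DERIV by (meson DERIV_continuous_on has_field_derivative_at_within)

lemma smooth_cmult: "u \<in> smooth \<Longrightarrow> (\<lambda>x. c * u x) \<in> smooth"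
  by (rule smooth_mult[OF smooth_const])

lemma smooth_diff: "u \<in> smooth \<Longrightarrow> v \<in> smooth \<Longrightarrow> (\<lambda>x. u x - v x) \<in> smooth"
  using smooth_add[OF _ smooth_cmult[of v "-1"], of u] by simp

lemma smooth_antiderivative:
  assumes "u \<in> smooth"
  obtains U where "U \<in> smooth" "\<And>x. (U has_real_derivative u x) (at x)"
proof -
  have "\<exists>F. \<forall>x :: real. - \<infinity> < x \<longrightarrow> x < \<infinity> \<longrightarrow> (F has_vector_derivative u x) (at x)"
    by (rule einterval_antiderivative)
      (use smooth_continuous_on[OF assms, of UNIV] in \<open>auto simp: continuous_on_eq_continuous_at\<close>)
  then obtain U where "\<And>x. (U has_real_derivative u x) (at x)"
    by (auto simp: has_real_derivative_iff_has_vector_derivative)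
  note U = this
  have "U \<in> smooth" by (rule smooth.smooth_antideriv[where v = u]) (fact U, fact assms)
  then show thesis using U by (rule that)
qed

text \<open>Take the normalised antiderivative of the bump exp(-1/x) exp(-1/(1-x)) on (0,1). The
  bump is at most 1, which gives the Lipschitz constant.\<close>

lemma smooth_step_exists:
  "\<exists>R. R \<in> smooth \<and> (\<exists>L. L \<ge> 0 \<and> (\<forall>x\<le>0. R x = 0) \<and> (\<forall>x\<ge>1. R x = 1) \<and> (\<forall>x. 0 \<le> R x \<and> R x \<le> 1) \<and>
     (\<forall>x y. \<bar>R x - R y\<bar> \<le> L * \<bar>x - y\<bar>))"
proof -
  define b where "b = (\<lambda>x. exp_flat 1 x * exp_flat 1 (- 1 * x + 1))"
  have b: "b \<in> smooth" unfolding b_def by (intro smooth_mult smooth_exp_flat smooth_affine)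
  have b0: "b x = 0" if "x \<notin> {0<..<1}" for x using that by (auto simp: b_def exp_flat_def)
  have bnn: "0 \<le> b x" for x by (auto simp: b_def exp_flat_def)
  obtain B where B: "B \<in> smooth" "\<And>x. (B has_real_derivative b x) (at x)"
    using smooth_antiderivative[OF b] by blast
  have mono: "B x \<le> B y" if "x \<le> y" for x y
    using DERIV_nonneg_imp_nondecreasing[OF that, of B] B(2) bnn by blast
  have c0: "B x = B 0" if "x \<le> 0" for x
  proof -
    have "\<exists>z. x < z \<and> z < 0 \<and> B 0 - B x = (0 - x) * b z" if "x < 0"
      using MVT2[OF that, of B b] B(2) by blast
    then show ?thesis using that b0 by (cases "x < 0") auto
  qed
  have c1: "B x = B 1" if "x \<ge> 1" for x
  proof -
    have "\<exists>z. 1 < z \<and> z < x \<and> B x - B 1 = (x - 1) * b z" if "1 < x"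
      using MVT2[OF that, of B b] B(2) by blast
    then show ?thesis using that b0 by (cases "1 < x") auto
  qed
  have pos: "B 0 < B 1"
  proof -
    obtain z where "0 < z" "z < 1" "B 1 - B 0 = (1 - 0) * b z"
      using MVT2[of 0 1 B b] B(2) by auto
    moreover have "b z > 0" using \<open>0 < z\<close> \<open>z < 1\<close> by (auto simp: b_def exp_flat_def)
    ultimately show ?thesis by simp
  qed
  define R where "R = (\<lambda>x. (1 / (B 1 - B 0)) * (B x - B 0))"
  have R: "R \<in> smooth" unfolding R_def by (intro smooth_cmult smooth_diff B smooth_const)
  have b1: "b x \<le> 1" for x
  proof (cases "x \<in> {0<..<1}")
    case True
    then have "exp (- (1 / x)) \<le> 1" "exp (- (1 / (1 - x))) \<le> 1" by auto
    then show ?thesis using True by (auto simp: b_def exp_flat_def intro!: mult_le_one)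
  next
    case False then show ?thesis using b0[of x] by simp
  qed
  have lip: "\<bar>B x - B y\<bar> \<le> \<bar>x - y\<bar>" for x y
  proof -
    have *: "B y - B x \<le> y - x" if xy: "x < y" for x y
    proof -
      obtain z where "B y - B x = (y - x) * b z"
        using MVT2[OF xy, of B b] B(2) by blast
      then show ?thesis using xy b1[of z] by (simp add: mult_left_le)
    qed
    show ?thesis
    proof (cases x y rule: linorder_cases)
      case less then show ?thesis using *[of x y] mono[of x y] by linarith
    next
      case greater then show ?thesis using *[of y x] mono[of y x] by linarith
    qed simp
  qed
  have "R x = 0" if "x \<le> 0" for x using c0[OF that] by (simp add: R_def)
  moreover have "R x = 1" if "x \<ge> 1" for x using c1[OF that] pos by (simp add: R_def)
  moreover have R01: "0 \<le> R x \<and> R x \<le> 1" for x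
    using mono[of 0 x] mono[of x 1] c0[of x] c1[of x] pos
    by (cases "x \<le> 0"; cases "x \<ge> 1") (auto simp: R_def field_simps)
  moreover have "\<bar>R x - R y\<bar> \<le> (1 / (B 1 - B 0)) * \<bar>x - y\<bar>" for x y
  proof -
    have "R x - R y = (1 / (B 1 - B 0)) * (B x - B y)" by (simp add: R_def algebra_simps diff_divide_distrib)
    then show ?thesis using lip[of x y] pos by (simp add: abs_mult divide_right_mono)
  qed
  moreover have "0 \<le> 1 / (B 1 - B 0)" using pos by simp
  ultimately show ?thesis using R
    by (intro exI[of _ R] exI[of _ "1 / (B 1 - B 0)"] conjI allI impI R01[THEN conjunct1] R01[THEN conjunct2])
qed

definition smooth_step :: "real \<Rightarrow> real" where
  "smooth_step = (SOME R. R \<in> smooth \<and> (\<exists>L. L \<ge> 0 \<and> (\<forall>x\<le>0. R x = 0) \<and> (\<forall>x\<ge>1. R x = 1) \<and>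
     (\<forall>x. 0 \<le> R x \<and> R x \<le> 1) \<and> (\<forall>x y. \<bar>R x - R y\<bar> \<le> L * \<bar>x - y\<bar>)))"

lemma smooth_step_props:
  "smooth_step \<in> smooth" "x \<le> 0 \<Longrightarrow> smooth_step x = 0" "x \<ge> 1 \<Longrightarrow> smooth_step x = 1"
  "0 \<le> smooth_step x" "smooth_step x \<le> 1" "\<exists>L\<ge>0. \<forall>x y. \<bar>smooth_step x - smooth_step y\<bar> \<le> L * \<bar>x - y\<bar>"
proof -
  have "smooth_step \<in> smooth \<and> (\<exists>L. L \<ge> 0 \<and> (\<forall>x\<le>0. smooth_step x = 0) \<and> (\<forall>x\<ge>1. smooth_step x = 1) \<and>
     (\<forall>x. 0 \<le> smooth_step x \<and> smooth_step x \<le> 1) \<and> (\<forall>x y. \<bar>smooth_step x - smooth_step y\<bar> \<le> L * \<bar>x - y\<bar>))"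
    unfolding smooth_step_def by (rule someI_ex[OF smooth_step_exists])
  then obtain L where "smooth_step \<in> smooth" "L \<ge> 0" "\<forall>x\<le>0. smooth_step x = 0" "\<forall>x\<ge>1. smooth_step x = 1"
     "\<forall>x. 0 \<le> smooth_step x \<and> smooth_step x \<le> 1" "\<forall>x y. \<bar>smooth_step x - smooth_step y\<bar> \<le> L * \<bar>x - y\<bar>"
    by (elim conjE exE)
  then show "smooth_step \<in> smooth" "x \<le> 0 \<Longrightarrow> smooth_step x = 0" "x \<ge> 1 \<Longrightarrow> smooth_step x = 1"
    "0 \<le> smooth_step x" "smooth_step x \<le> 1" "\<exists>L\<ge>0. \<forall>x y. \<bar>smooth_step x - smooth_step y\<bar> \<le> L * \<bar>x - y\<bar>"
    by simp_all (intro exI[of _ L], simp)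
qed

section \<open>Test functions\<close>

lemma test_functionI:
  assumes "\<phi> \<in> smooth" "0 < a" "b < l" "\<And>x. x < a \<or> x > b \<Longrightarrow> \<phi> x = 0"
  shows "\<phi> \<in> test_functions l"
proof -
  have "0 < a \<and> b < l \<and> (\<forall>x. x \<notin> {a..b} \<longrightarrow> \<phi> x = 0)"
    using assms by (auto simp: not_le)
  then show ?thesis
    using smooth_higher_differentiable[OF assms(1)] unfolding test_functions_def by blast
qed

lemma test_function_DERIV: "\<phi> \<in> test_functions l \<Longrightarrow> (\<phi> has_real_derivative deriv \<phi> x) (at x)"
  unfolding test_functions_def mem_Collect_eq
  by (metis DERIV_deriv_iff_real_differentiable funpow_0)

lemma test_function_continuous_on: "\<phi> \<in> test_functions l \<Longrightarrow> continuous_on S \<phi>"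
  using test_function_DERIV by (meson DERIV_continuous_on has_field_derivative_at_within)

lemma test_function_deriv_continuous_on:
  assumes "\<phi> \<in> test_functions l"
  shows "continuous_on S (deriv \<phi>)"
proof -
  have "(deriv ^^ 1) \<phi> differentiable (at x)" for x
    using assms unfolding test_functions_def by blast
  then show ?thesis
    by (auto intro!: continuous_at_imp_continuous_on differentiable_imp_continuous_within)
qed

lemma test_function_zero:
  assumes "\<phi> \<in> test_functions l"
  shows "x \<le> 0 \<Longrightarrow> \<phi> x = 0" "x \<ge> l \<Longrightarrow> \<phi> x = 0"
  using assms by (force simp: test_functions_def)+

lemma test_function_L2: "\<phi> \<in> test_functions l \<Longrightarrow> \<phi> \<in> L2_edge l"
  by (intro L2_edge_continuous_on test_function_continuous_on)

lemma test_function_deriv_L2: "\<phi> \<in> test_functions l \<Longrightarrow> deriv \<phi> \<in> L2_edge l"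
  by (intro L2_edge_continuous_on test_function_deriv_continuous_on)

text \<open>\<open>test_functions\<close> speaks of iterated derivatives and not of
  \<open>smooth\<close>, so its closure under linear combinations cannot be read off from the rules
  of \<open>smooth\<close> and is proved by induction on the order.\<close>

lemma higher_deriv_lin:
  assumes "\<And>k x. (deriv ^^ k) \<phi> differentiable (at x)" "\<And>k x. (deriv ^^ k) \<psi> differentiable (at (x::real))"
  shows "(deriv ^^ k) (\<lambda>x. a * \<phi> x + b * \<psi> x) = (\<lambda>x. a * (deriv ^^ k) \<phi> x + b * (deriv ^^ k) \<psi> x :: real)"
proof (induction k)
  case (Suc k)
  have *: "((deriv ^^ k) \<phi> has_real_derivative (deriv ^^ Suc k) \<phi> x) (at x)"
    "((deriv ^^ k) \<psi> has_real_derivative (deriv ^^ Suc k) \<psi> x) (at x)" for x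
    using assms by (simp_all add: DERIV_deriv_iff_real_differentiable)
  have "deriv (\<lambda>x. a * (deriv ^^ k) \<phi> x + b * (deriv ^^ k) \<psi> x) x = a * (deriv ^^ Suc k) \<phi> x + b * (deriv ^^ Suc k) \<psi> x" for x
    by (rule DERIV_imp_deriv) (auto intro!: derivative_eq_intros *)
  then show ?case using Suc by auto
qed simp

lemma test_function_lin:
  assumes \<phi>: "\<phi> \<in> test_functions l" and \<psi>: "\<psi> \<in> test_functions l"
  shows "(\<lambda>x. a * \<phi> x + b * \<psi> x) \<in> test_functions l"
proof -
  have d: "\<And>k x. (deriv ^^ k) \<phi> differentiable (at x)" "\<And>k x. (deriv ^^ k) \<psi> differentiable (at x)"
    using assms by (auto simp: test_functions_def)
  obtain a1 b1 where 1: "0 < a1" "b1 < l" "\<And>x. x \<notin> {a1..b1} \<Longrightarrow> \<phi> x = 0"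
    using \<phi> by (auto simp: test_functions_def)
  obtain a2 b2 where 2: "0 < a2" "b2 < l" "\<And>x. x \<notin> {a2..b2} \<Longrightarrow> \<psi> x = 0"
    using \<psi> by (auto simp: test_functions_def)
  have "a * \<phi> x + b * \<psi> x = 0" if "x \<notin> {min a1 a2..max b1 b2}" for x
    using 1(3)[of x] 2(3)[of x] that by (auto simp: not_le)
  moreover have "(deriv ^^ k) (\<lambda>x. a * \<phi> x + b * \<psi> x) differentiable (at x)" for k x
    unfolding higher_deriv_lin[OF d] using d by (intro derivative_intros) auto
  moreover have "0 < min a1 a2" "max b1 b2 < l" using 1 2 by auto
  ultimately show ?thesis unfolding test_functions_def by blast
qed

lemma test_function_0: "(\<lambda>x. 0) \<in> test_functions l" if "0 < l"
  by (rule test_functionI[of _ "l/2" "l/2"]) (use that in \<open>auto intro: smooth_const\<close>)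


section \<open>Density of test functions\<close>

text \<open>The approximants are taken in \<open>smooth\<close> as well because later arguments
  integrate them, and \<open>smooth\<close> contains antiderivatives of its members.\<close>

definition L2_test_closure :: "real \<Rightarrow> (real \<Rightarrow> real) set" where
  "L2_test_closure l = {u \<in> L2_edge l. \<forall>e>0. \<exists>\<phi>\<in>test_functions l \<inter> smooth. L2_norm l (\<lambda>x. u x - \<phi> x) < e}"

lemma L2_test_closure_limit:
  assumes u: "u \<in> L2_edge l" and "\<And>e. e > 0 \<Longrightarrow> \<exists>w\<in>L2_test_closure l. L2_norm l (\<lambda>x. u x - w x) < e"
  shows "u \<in> L2_test_closure l"
  unfolding L2_test_closure_def
proof (safe intro!: u)
  fix e :: real assume "e > 0"
  then obtain w where w: "w \<in> L2_test_closure l" "L2_norm l (\<lambda>x. u x - w x) < e / 2"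
    using assms(2)[of "e/2"] by auto
  then obtain \<phi> where \<phi>: "\<phi> \<in> test_functions l \<inter> smooth" "L2_norm l (\<lambda>x. w x - \<phi> x) < e / 2"
    using \<open>e > 0\<close> unfolding L2_test_closure_def by (auto dest!: spec[of _ "e/2"])
  have "L2_norm l (\<lambda>x. u x - \<phi> x) = L2_norm l (\<lambda>x. (u x - w x) + (w x - \<phi> x))" by simp
  also have "\<dots> \<le> L2_norm l (\<lambda>x. u x - w x) + L2_norm l (\<lambda>x. w x - \<phi> x)"
    using u w \<phi> by (intro L2_norm_triangle L2_edge_diff) (auto simp: L2_test_closure_def test_function_L2)
  also have "\<dots> < e" using w \<phi> by simp
  finally show "\<exists>\<phi>\<in>test_functions l \<inter> smooth. L2_norm l (\<lambda>x. u x - \<phi> x) < e" using \<phi> by blast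
qed

lemma L2_test_closure_lin:
  assumes "u \<in> L2_test_closure l" "v \<in> L2_test_closure l"
  shows "(\<lambda>x. a * u x + b * v x) \<in> L2_test_closure l"
  unfolding L2_test_closure_def
proof safe
  have L2: "u \<in> L2_edge l" "v \<in> L2_edge l" using assms by (auto simp: L2_test_closure_def)
  then show "(\<lambda>x. a * u x + b * v x) \<in> L2_edge l" by (intro L2_edge_add L2_edge_cmult)
  fix e :: real assume "e > 0"
  define d where "d = e / (\<bar>a\<bar> + \<bar>b\<bar> + 1)"
  have "\<bar>a\<bar> + \<bar>b\<bar> + 1 > 0" by (simp add: add_nonneg_pos)
  then have "d > 0" and "(\<bar>a\<bar> + \<bar>b\<bar> + 1) * d = e"
    using \<open>e > 0\<close> by (simp_all add: d_def)
  then have de: "\<bar>a\<bar> * d + \<bar>b\<bar> * d + d = e" by (simp add: algebra_simps)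
  obtain \<phi> \<psi> where \<phi>: "\<phi> \<in> test_functions l \<inter> smooth" "L2_norm l (\<lambda>x. u x - \<phi> x) < d"
    and \<psi>: "\<psi> \<in> test_functions l \<inter> smooth" "L2_norm l (\<lambda>x. v x - \<psi> x) < d"
    using assms \<open>d > 0\<close> unfolding L2_test_closure_def by blast
  have "L2_norm l (\<lambda>x. a * u x + b * v x - (a * \<phi> x + b * \<psi> x))
      = L2_norm l (\<lambda>x. a * (u x - \<phi> x) + b * (v x - \<psi> x))" by (simp add: algebra_simps)
  also have "\<dots> \<le> L2_norm l (\<lambda>x. a * (u x - \<phi> x)) + L2_norm l (\<lambda>x. b * (v x - \<psi> x))"
    using L2 \<phi> \<psi> by (intro L2_norm_triangle L2_edge_cmult L2_edge_diff) (auto simp: test_function_L2)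
  also have "\<dots> \<le> \<bar>a\<bar> * d + \<bar>b\<bar> * d"
    unfolding L2_norm_cmult using \<phi> \<psi> by (intro add_mono mult_left_mono) auto
  also have "\<dots> < e" using \<open>d > 0\<close> de by linarith
  finally have "L2_norm l (\<lambda>x. a * u x + b * v x - (a * \<phi> x + b * \<psi> x)) < e" .
  moreover have "(\<lambda>x. a * \<phi> x + b * \<psi> x) \<in> test_functions l \<inter> smooth"
    using \<phi> \<psi> by (auto intro: test_function_lin smooth_add smooth_cmult)
  ultimately show "\<exists>\<phi>\<in>test_functions l \<inter> smooth. L2_norm l (\<lambda>x. a * u x + b * v x - \<phi> x) < e"
    by (intro bexI[of _ "\<lambda>x. a * \<phi> x + b * \<psi> x"])
qed

text \<open>Besides the convergence it yields membership in L2 for everything dominated by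
  \<open>g\<close>; applied to a constant sequence it serves as a comparison criterion.\<close>

lemma L2_dominated_convergence:
  assumes u [measurable]: "u \<in> borel_measurable (edge_measure l)"
    and U: "\<And>n::nat. U n \<in> borel_measurable (edge_measure l)" and g: "g \<in> L2_edge l"
    and lim: "AE x in edge_measure l. (\<lambda>n. U n x) \<longlonglongrightarrow> u x"
    and dom: "\<And>n x. x \<in> {0..l} \<Longrightarrow> \<bar>U n x\<bar> \<le> g x"
  shows "u \<in> L2_edge l" "\<And>n. U n \<in> L2_edge l" "(\<lambda>n. L2_norm l (\<lambda>x. u x - U n x)) \<longlonglongrightarrow> 0"
proof -
  note [measurable] = U L2_edge_measurable[OF g]
  have dom_u: "AE x in edge_measure l. \<bar>u x\<bar> \<le> g x"
    using lim AE_space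
  proof eventually_elim
    case (elim x)
    then have "(\<lambda>n. \<bar>U n x\<bar>) \<longlonglongrightarrow> \<bar>u x\<bar>" by (intro tendsto_rabs) auto
    then show ?case by (rule LIMSEQ_le_const2) (use dom elim in auto)
  qed
  have bd: "w \<in> L2_edge l" if [measurable]: "w \<in> borel_measurable (edge_measure l)"
    and "AE x in edge_measure l. \<bar>w x\<bar> \<le> g x" for w
    unfolding L2_edge_def
  proof safe
    show "integrable (edge_measure l) (\<lambda>x. (w x)\<^sup>2)"
    proof (rule Bochner_Integration.integrable_bound[OF L2_edge_square[OF g]])
      show "AE x in edge_measure l. norm ((w x)\<^sup>2) \<le> norm ((g x)\<^sup>2)"
        using that(2)
      proof eventually_elim
        case (elim x) then show ?case using abs_le_square_iff[of "w x" "g x"] by simp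
      qed
    qed simp
  qed fact
  show u2: "u \<in> L2_edge l" by (rule bd[OF u dom_u])
  show "U n \<in> L2_edge l" for n by (rule bd[OF U]) (use dom in auto)
  have "(\<lambda>n. \<integral>x. (u x - U n x)\<^sup>2 \<partial>edge_measure l) \<longlonglongrightarrow> (\<integral>x. 0 \<partial>edge_measure l)"
  proof (rule integral_dominated_convergence[where w = "\<lambda>x. 4 * (g x)\<^sup>2"])
    show "AE x in edge_measure l. (\<lambda>n. (u x - U n x)\<^sup>2) \<longlonglongrightarrow> 0"
      using lim
    proof eventually_elim
      case (elim x)
      then have "(\<lambda>n. (u x - U n x)\<^sup>2) \<longlonglongrightarrow> (u x - u x)\<^sup>2" by (intro tendsto_intros)
      then show ?case by simp
    qed
    fix n
    show "AE x in edge_measure l. norm ((u x - U n x)\<^sup>2) \<le> 4 * (g x)\<^sup>2"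
      using dom_u AE_space
    proof eventually_elim
      case (elim x)
      then have "\<bar>u x - U n x\<bar> \<le> \<bar>2 * g x\<bar>" using dom[of x n] by simp
      then show ?case using abs_le_square_iff[of "u x - U n x" "2 * g x"] by (simp add: power_mult_distrib)
    qed
  qed (use g in \<open>auto simp: L2_edge_square\<close>)
  then have "(\<lambda>n. sqrt (\<integral>x. (u x - U n x)\<^sup>2 \<partial>edge_measure l)) \<longlonglongrightarrow> sqrt 0"
    by (intro tendsto_real_sqrt) simp
  then show "(\<lambda>n. L2_norm l (\<lambda>x. u x - U n x)) \<longlonglongrightarrow> 0"
    by (simp add: L2_norm_def L2_inner_self)
qed

lemma L2_test_closure_dominated:
  assumes "u \<in> borel_measurable (edge_measure l)"
    and U: "\<And>n::nat. U n \<in> L2_test_closure l" and "g \<in> L2_edge l"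
    and "AE x in edge_measure l. (\<lambda>n. U n x) \<longlonglongrightarrow> u x"
    and "\<And>n x. x \<in> {0..l} \<Longrightarrow> \<bar>U n x\<bar> \<le> g x"
  shows "u \<in> L2_test_closure l"
proof (rule L2_test_closure_limit)
  have m: "U n \<in> borel_measurable (edge_measure l)" for n
    using U[of n] by (auto simp: L2_test_closure_def L2_edge_def)
  note dc = L2_dominated_convergence[OF assms(1) m assms(3-5)]
  show "u \<in> L2_edge l" by (rule dc(1))
  fix e :: real assume "e > 0"
  then have "eventually (\<lambda>n. L2_norm l (\<lambda>x. u x - U n x) < e) sequentially"
    using order_tendstoD(2)[OF dc(3)] by blast
  then obtain n where "L2_norm l (\<lambda>x. u x - U n x) < e" by (auto simp: eventually_sequentially)
  then show "\<exists>w\<in>L2_test_closure l. L2_norm l (\<lambda>x. u x - w x) < e" using U by blast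
qed

lemma AE_edge_not_in_finite: "finite F \<Longrightarrow> AE x in edge_measure l. x \<notin> F"
  using AE_not_in[of F lborel] finite_imp_null_set_lborel[of F]
  unfolding edge_measure_def by (subst AE_restrict_space_iff) auto

lemma L2_test_closure_test: "\<phi> \<in> test_functions l \<Longrightarrow> \<phi> \<in> smooth \<Longrightarrow> \<phi> \<in> L2_test_closure l"
  unfolding L2_test_closure_def
  by (auto simp: test_function_L2 L2_norm_def L2_inner_def intro!: bexI[of _ \<phi>])

lemma L2_test_closure_interval:
  assumes "0 < l"
  shows "indicator {a<..<b} \<in> L2_test_closure l"
proof -
  \<comment> \<open>The interval is clipped to the edge. With m = n + 1, \<open>U n\<close> rises
    between a' + 1/m and a' + 2/m and falls between b' - 2/m and b' - 1/m, so its support stays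
    inside the open edge even if a' = 0 or b' = l.\<close>
  define a' b' where "a' = max 0 a" and "b' = min l b"
  define U where "U n x = (if a' < b' then smooth_step (real (Suc n) * (x - a') - 1)
      - smooth_step (real (Suc n) * (x - b') + 2) else 0)" for n x
  have U1: "\<bar>U n x\<bar> \<le> 1" for n x
    using smooth_step_props(4,5)[of "real (Suc n) * (x - a') - 1"] smooth_step_props(4,5)[of "real (Suc n) * (x - b') + 2"]
    unfolding U_def by (smt (verit))
  \<comment> \<open>From this index on the rise starts before the fall starts and ends before the
    fall ends, so the two steps cancel outside the intended support.\<close>
  have "\<exists>N. a' < b' \<longrightarrow> 3 < real (Suc N) * (b' - a')"
  proof (cases "a' < b'")
    case True
    obtain N where "3 / (b' - a') < real N" using reals_Archimedean2 by blast
    then have "3 < real (Suc N) * (b' - a')" using True by (simp add: field_simps)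
    then show ?thesis by blast
  qed auto
  then obtain N where N: "a' < b' \<Longrightarrow> 3 < real (Suc N) * (b' - a')" by blast
  have three: "3 < real (Suc (n + N)) * (b' - a')" if "a' < b'" for n
  proof -
    have "3 < real (Suc N) * (b' - a')" using N that by simp
    also have "\<dots> \<le> real (Suc (n + N)) * (b' - a')" using that by (intro mult_right_mono) auto
    finally show ?thesis .
  qed
  show ?thesis
  proof (rule L2_test_closure_dominated)
    show "indicat_real {a<..<b} \<in> borel_measurable (edge_measure l)"
      by (intro borel_measurable_edge) auto
    show "(\<lambda>x. 1) \<in> L2_edge l" by simp
    show "\<bar>U (n + N) x\<bar> \<le> 1" for n x by (rule U1)
    show "U (n + N) \<in> L2_test_closure l" for n
    proof (rule L2_test_closure_test)
      have s: "(\<lambda>x. smooth_step (real (Suc (n+N)) * (x - c) + d)) \<in> smooth" for c d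
        using smooth_affine[OF smooth_step_props(1), of "real (Suc (n+N))" "d - real (Suc (n+N)) * c"]
        by (simp add: algebra_simps)
      show "U (n + N) \<in> smooth"
        unfolding U_def using s[of a' "-1"] s[of b' 2]
        by (cases "a' < b'") (auto intro: smooth_diff smooth_const)
      show "U (n + N) \<in> test_functions l"
      proof (cases "a' < b'")
        case False
        then show ?thesis unfolding U_def using test_function_0[OF assms] by simp
      next
        case True
        let ?m = "real (Suc (n + N))"
        have m: "?m > 0" by simp
        then have m': "1 / ?m > 0" by (rule divide_pos_pos[OF zero_less_one])
        note 3 = three[OF True, of n]
        show ?thesis
        proof (rule test_functionI[of _ "a' + 1 / ?m" "b' - 1 / ?m"])
          show "0 < a' + 1 / ?m" using m' max.cobounded1[of 0 a] unfolding a'_def by linarith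
          show "b' - 1 / ?m < l" using m' min.cobounded1[of l b] unfolding b'_def by linarith
          fix x assume "x < a' + 1 / ?m \<or> x > b' - 1 / ?m"
          then show "U (n + N) x = 0"
          proof
            assume "x < a' + 1 / ?m"
            then have 1: "?m * (x - a') < 1" using m by (simp add: field_simps)
            moreover have "?m * (x - b') + 2 < 0"
              using 1 3 by (simp add: algebra_simps)
            ultimately show ?thesis unfolding U_def by (simp add: smooth_step_props(2))
          next
            assume "x > b' - 1 / ?m"
            then have 1: "?m * (x - b') > - 1" using m by (simp add: field_simps)
            moreover have "?m * (x - a') - 1 > 1"
              using 1 3 by (simp add: algebra_simps)
            ultimately show ?thesis unfolding U_def by (simp add: smooth_step_props(3))
          qed
        qed (fact \<open>U (n + N) \<in> smooth\<close>)
      qed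
    qed
    show "AE x in edge_measure l. (\<lambda>n. U (n + N) x) \<longlonglongrightarrow> indicat_real {a<..<b} x"
      using AE_edge_not_in_finite[OF finite.insertI[OF finite.insertI[OF finite.emptyI]], of 0 l l] AE_space
    proof eventually_elim
      case (elim x)
      then have ind: "indicat_real {a<..<b} x = indicator {a'<..<b'} x"
        by (auto simp: indicator_def a'_def b'_def)
      show ?case
      proof (cases "a' < x \<and> x < b'")
        case True
        obtain k where k: "2 / (x - a') < real k" using reals_Archimedean2 by blast
        obtain k' where k': "2 / (b' - x) < real k'" using reals_Archimedean2 by blast
        have "U (n + N) x = 1" if "n \<ge> max k k'" for n
        proof -
          have "2 / (x - a') < real (Suc (n + N))" "2 / (b' - x) < real (Suc (n + N))"
            using that k k' by auto
          then have "2 < real (Suc (n + N)) * (x - a')" "2 < real (Suc (n + N)) * (b' - x)"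
            using True by (simp_all only: pos_divide_less_eq diff_gt_0_iff_gt)
          then have "1 \<le> real (Suc (n + N)) * (x - a') - 1" "real (Suc (n + N)) * (x - b') + 2 \<le> 0"
            by (simp_all add: algebra_simps)
          then show ?thesis using True unfolding U_def by (simp only: smooth_step_props) auto
        qed
        then have "eventually (\<lambda>n. U (n + N) x = indicat_real {a<..<b} x) sequentially"
          using True ind unfolding eventually_sequentially by (intro exI[of _ "max k k'"]) auto
        then show ?thesis by (rule tendsto_eventually)
      next
        case False
        have "U (n + N) x = 0" for n
        proof (cases "a' < b'")
          case ab: True
          consider "x \<le> a'" | "x \<ge> b'" using False by linarith
          then show ?thesis
          proof cases
            case 1
            then have 0: "real (Suc (n + N)) * (x - a') \<le> 0" by (simp add: mult_nonneg_nonpos)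
            moreover have "real (Suc (n + N)) * (x - b') + 2 \<le> 0"
              using 0 three[OF ab, of n] by (simp add: algebra_simps)
            ultimately show ?thesis unfolding U_def by (simp add: smooth_step_props(2))
          next
            case 2
            then have 0: "real (Suc (n + N)) * (x - b') \<ge> 0" by simp
            moreover have "real (Suc (n + N)) * (x - a') - 1 \<ge> 1"
              using 0 three[OF ab, of n] by (simp add: algebra_simps)
            ultimately show ?thesis unfolding U_def by (simp add: smooth_step_props(3))
          qed
        qed (simp add: U_def)
        then show ?thesis using False ind by (auto simp: indicator_def)
      qed
    qed
  qed
qed

lemma L2_test_closure_cong_AE:
  assumes "v \<in> L2_test_closure l" "u \<in> borel_measurable (edge_measure l)" "AE x in edge_measure l. u x = v x"
  shows "u \<in> L2_test_closure l"
proof (rule L2_test_closure_limit)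
  have v: "v \<in> L2_edge l" using assms by (auto simp: L2_test_closure_def)
  show u: "u \<in> L2_edge l" using L2_edge_cong_AE[OF assms(2) v assms(3)] .
  fix e :: real assume "e > 0"
  have "L2_norm l (\<lambda>x. u x - v x) = L2_norm l (\<lambda>x. 0)"
    using assms(3) by (intro L2_norm_cong_AE L2_edge_diff u v) auto
  then show "\<exists>w\<in>L2_test_closure l. L2_norm l (\<lambda>x. u x - w x) < e"
    using assms(1) \<open>e > 0\<close> by (intro bexI[of _ v]) (auto simp: L2_norm_def L2_inner_def)
qed

lemma L2_test_closure_1:
  assumes "0 < l"
  shows "(\<lambda>x. 1) \<in> L2_test_closure l"
  by (rule L2_test_closure_cong_AE[OF L2_test_closure_interval[OF assms, of "-1" "l + 1"]]) auto

lemma borel_eq_open_intervals: "borel = sigma UNIV (range (\<lambda>(a, b). {a<..<b::real}))"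
  using borel_eq_box[where 'a = real] by (simp add: box_real)

text \<open>Dynkin's argument over the intersection-stable family of open intervals: the sets whose
  indicator can be approximated are closed under complements, as the constant 1 can be approximated,
  and under countable disjoint unions by dominated convergence.\<close>

lemma L2_test_closure_borel:
  assumes "0 < l" "A \<in> sets borel"
  shows "indicator A \<in> L2_test_closure l"
proof -
  have A: "A \<in> sigma_sets UNIV (range (\<lambda>(a, b). {a<..<b::real}))"
    using assms(2) unfolding borel_eq_open_intervals by (simp add: sets_measure_of)
  have "Int_stable (range (\<lambda>(a, b). {a<..<b::real}))"
    by (auto simp: Int_stable_def image_iff Int_greaterThanLessThan)
  moreover have "range (\<lambda>(a, b). {a<..<b::real}) \<subseteq> Pow UNIV" by simp
  ultimately show ?thesis using A
  proof (induction rule: sigma_sets_induct_disjoint)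
    case (basic A)
    then show ?case using L2_test_closure_interval[OF assms(1)] by auto
  next
    case empty
    show ?case using L2_test_closure_test[OF test_function_0[OF assms(1)] smooth_const]
      by (simp add: indicator_def)
  next
    case (compl A)
    have "indicator (UNIV - A) = (\<lambda>x. 1 * 1 + (-1) * indicator A x :: real)"
      by (auto simp: indicator_def fun_eq_iff)
    then show ?case using L2_test_closure_lin[OF L2_test_closure_1[OF assms(1)] compl(2), of 1 "-1"] by simp
  next
    case (union A)
    have A: "A i \<in> sets borel" for i
      using union(2) unfolding borel_eq_open_intervals by (auto simp: sets_measure_of)
    have sum: "indicator (\<Union>i<n. A i) \<in> L2_test_closure l" for n
    proof (induction n)
      case 0
      show ?case using L2_test_closure_test[OF test_function_0[OF assms(1)] smooth_const]
        by (simp add: indicator_def)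
    next
      case (Suc n)
      have "A n \<inter> (\<Union>i<n. A i) = {}"
      proof -
        have "A n \<inter> A i = {}" if "i < n" for i
          using union(1) that unfolding disjoint_family_on_def by auto
        then show ?thesis by blast
      qed
      then have "indicator (\<Union>i<Suc n. A i) = (\<lambda>x. 1 * indicator (A n) x + 1 * indicator (\<Union>i<n. A i) x :: real)"
        by (auto simp: indicator_def fun_eq_iff lessThan_Suc)
      then show ?case using L2_test_closure_lin[OF union(3)[of n] Suc, of 1 1] by simp
    qed
    show ?case
    proof (rule L2_test_closure_dominated[OF _ sum])
      show "indicat_real (\<Union> (range A)) \<in> borel_measurable (edge_measure l)"
        using A by (intro borel_measurable_edge borel_measurable_indicator sets.countable_UN) auto
      show "AE x in edge_measure l. (\<lambda>n. indicat_real (\<Union>i<n. A i) x) \<longlonglongrightarrow> indicat_real (\<Union> (range A)) x"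
        by (intro AE_I2 LIMSEQ_indicator_UN)
    qed (auto simp: indicator_def)
  qed
qed

text \<open>Nonnegative functions are built up from indicators by multiples, sums and monotone
  limits. The induction claim is an implication from \<open>L2_edge\<close>, since the pieces of an
  L2 function must first be seen to lie in L2; for sums and limits domination gives this.\<close>

lemma L2_test_closure_eq:
  assumes "0 < l"
  shows "L2_test_closure l = L2_edge l"
proof
  show "L2_test_closure l \<subseteq> L2_edge l" by (auto simp: L2_test_closure_def)
  have nn: "u \<in> L2_edge l \<longrightarrow> u \<in> L2_test_closure l"
    if "u \<in> borel_measurable (edge_measure l)" "\<And>x. 0 \<le> u x" for u
    using that
  proof (induction rule: borel_measurable_induct_real)
    case (set A)
    then show ?case using L2_test_closure_borel[OF assms, of A] by (simp add: sets_edge)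
  next
    case (mult u c)
    show ?case
    proof (cases "c = 0")
      case True
      then show ?thesis using L2_test_closure_test[OF test_function_0[OF assms] smooth_const] by simp
    next
      case False
      show ?thesis
      proof
        assume "(\<lambda>x. c * u x) \<in> L2_edge l"
        from L2_edge_cmult[OF this, of "1 / c"] have "u \<in> L2_test_closure l" using mult False by simp
        from L2_test_closure_lin[OF this this, of c 0] show "(\<lambda>x. c * u x) \<in> L2_test_closure l" by simp
      qed
    qed
  next
    case (add u v)
    show ?case
    proof
      assume L2: "(\<lambda>x. v x + u x) \<in> L2_edge l"
      have "u \<in> L2_edge l" "v \<in> L2_edge l"
        using L2_dominated_convergence(1)[of u l "\<lambda>n. u", OF _ _ L2] L2_dominated_convergence(1)[of v l "\<lambda>n. v", OF _ _ L2] add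
        by auto
      then have "u \<in> L2_test_closure l" "v \<in> L2_test_closure l" using add by auto
      from L2_test_closure_lin[OF this(2,1), of 1 1] show "(\<lambda>x. v x + u x) \<in> L2_test_closure l" by simp
    qed
  next
    case (seq U)
    have sm: "U i \<in> borel_measurable (edge_measure l)" and sn: "0 \<le> U i x"
      and sl: "x \<in> {0..l} \<Longrightarrow> (\<lambda>i. U i x) \<longlonglongrightarrow> u x"
      and sp: "U i \<in> L2_edge l \<longrightarrow> U i \<in> L2_test_closure l" for i x
      using seq by auto
    show ?case
    proof
      assume L2: "u \<in> L2_edge l"
      have le: "\<bar>U i x\<bar> \<le> u x" if "x \<in> {0..l}" for i x
      proof -
        have "incseq (\<lambda>i. U i x)" using \<open>incseq U\<close> by (auto simp: incseq_def le_fun_def)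
        then have "U i x \<le> u x" using sl[of x] that by (intro incseq_le) auto
        then show ?thesis using sn[of i x] by simp
      qed
      have lim: "AE x in edge_measure l. (\<lambda>i. U i x) \<longlonglongrightarrow> u x" using sl by auto
      note dc = L2_dominated_convergence[OF that(1) sm L2 lim le]
      show "u \<in> L2_test_closure l"
        by (rule L2_test_closure_dominated[OF that(1) _ L2 lim le]) (use sp dc(2) in auto)
    qed
  qed
  show "L2_edge l \<subseteq> L2_test_closure l"
  proof
    fix u assume u: "u \<in> L2_edge l"
    note [measurable] = L2_edge_measurable[OF u]
    have L2: "(\<lambda>x. max 0 (c * u x)) \<in> L2_edge l" if "\<bar>c\<bar> = 1" for c
    proof -
      have "(\<lambda>x. \<bar>u x\<bar>) \<in> L2_edge l" using u by (auto simp: L2_edge_def)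
      moreover have "\<bar>max 0 (c * u x)\<bar> \<le> \<bar>u x\<bar>" for x
        using abs_mult[of c "u x"] that by (auto simp: max_def)
      ultimately show ?thesis
        using L2_dominated_convergence(1)[of "\<lambda>x. max 0 (c * u x)" l "\<lambda>n x. max 0 (c * u x)"] by auto
    qed
    have "(\<lambda>x. max 0 (1 * u x)) \<in> L2_test_closure l" "(\<lambda>x. max 0 (-1 * u x)) \<in> L2_test_closure l"
      using nn L2[of 1] L2[of "-1"] by auto
    note lin = L2_test_closure_lin[OF this, of 1 "-1"]
    have "(\<lambda>x. 1 * max 0 (1 * u x) + - 1 * max 0 (- 1 * u x)) = u"
      by (rule ext) (simp add: max_def)
    then show "u \<in> L2_test_closure l" using lin by argo
  qed
qed

lemma test_functions_dense_L2:
  assumes "0 < l" "u \<in> L2_edge l" "e > 0"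
  obtains \<phi> where "\<phi> \<in> test_functions l" "\<phi> \<in> smooth" "L2_norm l (\<lambda>x. u x - \<phi> x) < e"
  using assms L2_test_closure_eq[OF assms(1)] unfolding L2_test_closure_def by blast

text \<open>By density z is close to a test function orthogonal to it, so its squared norm is at
  most e times its norm for every e > 0.\<close>

lemma L2_fundamental_lemma:
  assumes "0 < l" "z \<in> L2_edge l" "\<And>\<phi>. \<phi> \<in> test_functions l \<Longrightarrow> \<phi> \<in> smooth \<Longrightarrow> L2_inner l z \<phi> = 0"
  shows "AE x in edge_measure l. z x = 0"
proof -
  have *: "(L2_norm l z)\<^sup>2 \<le> L2_norm l z * e" if e: "e > 0" for e
  proof -
    obtain \<phi> where \<phi>: "\<phi> \<in> test_functions l" "\<phi> \<in> smooth" "L2_norm l (\<lambda>x. z x - \<phi> x) < e"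
      using test_functions_dense_L2[OF assms(1,2) e] by blast
    have "(L2_norm l z)\<^sup>2 = L2_inner l (\<lambda>x. z x - \<phi> x) z"
      using assms(3)[OF \<phi>(1,2)] assms(2) \<phi>
      by (simp add: L2_norm_square L2_inner_self[symmetric] L2_inner_diff_left test_function_L2 L2_inner_commute[of l \<phi> z])
    also have "\<dots> \<le> L2_norm l (\<lambda>x. z x - \<phi> x) * L2_norm l z"
      using L2_inner_le[OF L2_edge_diff[OF assms(2) test_function_L2[OF \<phi>(1)]] assms(2)] by linarith
    also have "\<dots> \<le> e * L2_norm l z" using \<phi>(3) by (intro mult_right_mono) auto
    finally show ?thesis by (simp add: mult.commute)
  qed
  have "L2_norm l z = 0"
  proof (rule ccontr)
    assume "L2_norm l z \<noteq> 0"
    then have pos: "L2_norm l z > 0" using L2_norm_nonneg[of l z] by linarith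
    have "(L2_norm l z)\<^sup>2 \<le> L2_norm l z * (L2_norm l z / 2)" by (rule *) (use pos in simp)
    then show False using pos by (simp add: power2_eq_square)
  qed
  then show ?thesis by (rule L2_norm_eq_0_AE[OF assms(2)])
qed


section \<open>Absolutely continuous functions\<close>

text \<open>The pointwise form of u' = v with v in L2: u is a genuine absolutely continuous function
  on the edge, so its end values make sense, whereas v matters only up to null sets.\<close>

definition primitive :: "real \<Rightarrow> (real \<Rightarrow> real) \<Rightarrow> (real \<Rightarrow> real) \<Rightarrow> bool" where
  "primitive l u v \<longleftrightarrow> v \<in> L2_edge l \<and>
     (\<forall>x y. 0 \<le> x \<longrightarrow> x \<le> y \<longrightarrow> y \<le> l \<longrightarrow> u y - u x = (LINT t:{x..y}|edge_measure l. v t))"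

lemma primitiveD:
  assumes "primitive l u v"
  shows "v \<in> L2_edge l" "integrable (edge_measure l) v"
    "0 \<le> x \<Longrightarrow> x \<le> y \<Longrightarrow> y \<le> l \<Longrightarrow> u y - u x = (LINT t:{x..y}|edge_measure l. v t)"
  using assms L2_edge_integrable[of v l] unfolding primitive_def by simp_all

lemma primitive_const: "primitive l (\<lambda>x. c) (\<lambda>x. 0)"
  by (simp add: primitive_def)

lemma primitive_lin:
  assumes "primitive l u v" "primitive l u' v'"
  shows "primitive l (\<lambda>x. a * u x + b * u' x) (\<lambda>x. a * v x + b * v' x)"
  unfolding primitive_def
proof (intro conjI allI impI)
  show "(\<lambda>x. a * v x + b * v' x) \<in> L2_edge l"
    using primitiveD(1)[OF assms(1)] primitiveD(1)[OF assms(2)] by (intro L2_edge_add L2_edge_cmult)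
  fix x y :: real assume xy: "0 \<le> x" "x \<le> y" "y \<le> l"
  note i = set_integrable_edge[OF primitiveD(2)[OF assms(1)] xy(1,3)] set_integrable_edge[OF primitiveD(2)[OF assms(2)] xy(1,3)]
  have "(LINT t:{x..y}|edge_measure l. a * v t + b * v' t) = a * (u y - u x) + b * (u' y - u' x)"
    using i by (simp add: set_integral_add primitiveD(3)[OF assms(1) xy] primitiveD(3)[OF assms(2) xy])
  then show "a * u y + b * u' y - (a * u x + b * u' x) = (LINT t:{x..y}|edge_measure l. a * v t + b * v' t)"
    by (simp add: algebra_simps)
qed

lemma primitive_diff: "primitive l u v \<Longrightarrow> primitive l u' v' \<Longrightarrow> primitive l (\<lambda>x. u x - u' x) (\<lambda>x. v x - v' x)"
  using primitive_lin[of l u v u' v' 1 "-1"] by simp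

lemma primitive_exists:
  assumes "v \<in> L2_edge l"
  shows "primitive l (\<lambda>x. c + (LINT t:{0..x}|edge_measure l. v t)) v"
  unfolding primitive_def
proof (intro conjI allI impI assms)
  fix x y :: real assume xy: "0 \<le> x" "x \<le> y" "y \<le> l"
  have "(LINT t:{0..y}|edge_measure l. v t) = (LINT t:{0..x}|edge_measure l. v t) + (LINT t:{x..y}|edge_measure l. v t)"
    by (rule set_integral_edge_combine[OF L2_edge_integrable[OF assms] _ xy]) simp
  then show "c + (LINT t:{0..y}|edge_measure l. v t) - (c + (LINT t:{0..x}|edge_measure l. v t))
      = (LINT t:{x..y}|edge_measure l. v t)" by simp
qed

lemma primitive_FTC:
  assumes "\<And>x. (u has_real_derivative v x) (at x)" "\<And>x. isCont v x"
  shows "primitive l u v"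
  unfolding primitive_def
proof (intro conjI allI impI)
  show "v \<in> L2_edge l"
    using assms(2) by (intro L2_edge_continuous_on) (simp add: continuous_at_imp_continuous_on)
  fix x y :: real assume xy: "0 \<le> x" "x \<le> y" "y \<le> l"
  have "(\<integral>t. v t * indicator {x..y} t \<partial>lborel) = u y - u x"
    by (rule integral_FTC_Icc_real[OF xy(2)]) (use assms in auto)
  moreover have "{x..y} \<subseteq> {0..l}" using xy by auto
  ultimately show "u y - u x = (LINT t:{x..y}|edge_measure l. v t)"
    by (simp only: set_integral_edge) (simp add: set_lebesgue_integral_def mult.commute)
qed

text \<open>Hoelder continuity of order 1/2, left in squared form because the square is the
  numerator of the Gagliardo quotient.\<close>

lemma primitive_Holder:
  assumes "primitive l u v" "x \<in> {0..l}" "y \<in> {0..l}"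
  shows "(u x - u y)\<^sup>2 \<le> \<bar>x - y\<bar> * (L2_norm l v)\<^sup>2"
proof -
  have *: "(u y - u x)\<^sup>2 \<le> (y - x) * (L2_norm l v)\<^sup>2" if "0 \<le> x" "x \<le> y" "y \<le> l" for x y
  proof -
    have "(u y - u x)\<^sup>2 \<le> (y - x) * (LINT t:{x..y}|edge_measure l. (v t)\<^sup>2)"
      unfolding primitiveD(3)[OF assms(1) that]
      by (rule set_integral_edge_Cauchy_Schwarz[OF primitiveD(1)[OF assms(1)] that])
    also have "(LINT t:{x..y}|edge_measure l. (v t)\<^sup>2) \<le> (LINT t:{0..l}|edge_measure l. (v t)\<^sup>2)"
      using that L2_edge_square[OF primitiveD(1)[OF assms(1)]] by (intro set_integral_edge_mono_set) auto
    also have "\<dots> = (L2_norm l v)\<^sup>2" by (simp add: set_integral_edge_whole L2_norm_square)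
    finally show ?thesis using that by (simp add: mult_left_mono)
  qed
  show ?thesis
    using *[of x y] *[of y x] assms(2,3) by (cases "x \<le> y") (auto simp: power2_commute)
qed

lemma primitive_continuous_on:
  assumes "primitive l u v"
  shows "continuous_on {0..l} u"
  unfolding continuous_on_iff
proof (intro ballI allI impI)
  fix x e :: real assume x: "x \<in> {0..l}" and e: "e > 0"
  define d where "d = e\<^sup>2 / ((L2_norm l v)\<^sup>2 + 1)"
  have p: "(L2_norm l v)\<^sup>2 + 1 > 0" by (simp add: add_nonneg_pos)
  then have d: "d > 0" using e by (simp add: d_def)
  have "dist (u y) (u x) < e" if y: "y \<in> {0..l}" "dist y x < d" for y
  proof -
    have "(u y - u x)\<^sup>2 \<le> \<bar>y - x\<bar> * (L2_norm l v)\<^sup>2" by (rule primitive_Holder[OF assms y(1) x])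
    also have "\<dots> \<le> d * (L2_norm l v)\<^sup>2" using y(2) by (intro mult_right_mono) (auto simp: dist_real_def)
    also have "\<dots> < d * ((L2_norm l v)\<^sup>2 + 1)" using d by simp
    also have "\<dots> = e\<^sup>2" using p by (simp add: d_def)
    finally have "\<bar>u y - u x\<bar>\<^sup>2 < e\<^sup>2" by simp
    then have "\<bar>u y - u x\<bar> < e" using e by (intro power2_less_imp_less[of _ e]) auto
    then show ?thesis by (simp add: dist_real_def)
  qed
  then show "\<exists>d>0. \<forall>x'\<in>{0..l}. dist x' x < d \<longrightarrow> dist (u x') (u x) < e" using d by blast
qed

lemma primitive_L2: "primitive l u v \<Longrightarrow> u \<in> L2_edge l"
  by (intro L2_edge_continuous_on primitive_continuous_on)

section \<open>Dyadic partitions and integration by parts\<close>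

definition node :: "real \<Rightarrow> nat \<Rightarrow> nat \<Rightarrow> real" where
  "node l n j = l * real j / 2 ^ n"

lemma node_0 [simp]: "node l n 0 = 0" and node_last [simp]: "node l n (2 ^ n) = l"
  by (simp_all add: node_def)

lemma node_mono: "0 \<le> l \<Longrightarrow> i \<le> j \<Longrightarrow> node l n i \<le> node l n j"
  by (simp add: node_def divide_right_mono mult_left_mono)

lemma node_bounds:
  assumes "0 \<le> l" "j \<le> 2 ^ n"
  shows "0 \<le> node l n j" "node l n j \<le> l" "node l n j \<in> {0..l}"
  using node_mono[OF assms(1), of 0 j n] node_mono[OF assms, of n] by simp_all

lemma node_Suc_diff: "node l n (Suc j) - node l n j = l / 2 ^ n"
  by (simp add: node_def field_simps)

lemma node_refine: "node l (Suc n) (2 * j) = node l n j"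
  by (simp add: node_def)

lemma sum_set_integral_nodes:
  fixes v :: "real \<Rightarrow> real"
  assumes "0 \<le> l" "integrable (edge_measure l) v" "m \<le> 2 ^ n"
  shows "(\<Sum>j<m. LINT t:{node l n j..node l n (Suc j)}|edge_measure l. v t)
    = (LINT t:{0..node l n m}|edge_measure l. v t)"
  using assms(3)
proof (induction m)
  case 0
  have "AE t in edge_measure l. indicat_real {0..node l n 0} t *\<^sub>R v t = 0"
    using AE_edge_not_in_finite[OF finite.insertI[OF finite.emptyI], of 0 l]
    by eventually_elim simp
  then have "(LINT t:{0..node l n 0}|edge_measure l. v t) = 0"
    unfolding set_lebesgue_integral_def by (rule integral_eq_zero_AE)
  then show ?case by simp
next
  case (Suc m)
  then show ?case
    using set_integral_edge_combine[OF assms(2), of 0 "node l n m" "node l n (Suc m)"]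
      node_bounds[OF assms(1), of m n] node_bounds[OF assms(1), of "Suc m" n] node_mono[OF assms(1), of m "Suc m" n]
    by simp
qed

lemma sum_set_integral_nodes_all:
  fixes v :: "real \<Rightarrow> real"
  assumes "0 \<le> l" "integrable (edge_measure l) v"
  shows "(\<Sum>j<2 ^ n. LINT t:{node l n j..node l n (Suc j)}|edge_measure l. v t) = (\<integral>t. v t \<partial>edge_measure l)"
  using sum_set_integral_nodes[OF assms, of "2 ^ n" n] by (simp add: set_integral_edge_whole)

lemma uniform_oscillation:
  fixes f :: "real \<Rightarrow> real"
  assumes "0 \<le> l" "continuous_on {0..l} f" "e > 0"
  shows "\<exists>N. \<forall>n\<ge>N. \<forall>j<2 ^ n. \<forall>x\<in>{node l n j..node l n (Suc j)}. \<forall>y\<in>{node l n j..node l n (Suc j)}. \<bar>f x - f y\<bar> \<le> e"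
proof -
  have "uniformly_continuous_on {0..l} f"
    by (rule compact_uniformly_continuous[OF assms(2)]) simp
  then obtain d where d: "d > 0" "\<And>x y. x \<in> {0..l} \<Longrightarrow> y \<in> {0..l} \<Longrightarrow> dist y x < d \<Longrightarrow> dist (f y) (f x) < e"
    unfolding uniformly_continuous_on_def using assms(3) by metis
  have "(\<lambda>n. l * (1 / 2) ^ n) \<longlonglongrightarrow> l * 0" by (intro tendsto_intros) simp
  then have "eventually (\<lambda>n. l * (1 / 2) ^ n < d) sequentially"
    using d(1) order_tendstoD(2) by fastforce
  then obtain N where N: "\<And>n. n \<ge> N \<Longrightarrow> l / 2 ^ n < d"
    unfolding eventually_sequentially by (auto simp: power_one_over)
  have "\<bar>f x - f y\<bar> \<le> e" if n: "n \<ge> N" "j < 2 ^ n" and xy: "x \<in> {node l n j..node l n (Suc j)}" "y \<in> {node l n j..node l n (Suc j)}" for n j x y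
  proof -
    have j: "0 \<le> node l n j" "node l n (Suc j) \<le> l" using node_bounds[OF assms(1)] n(2) by auto
    have "dist x y < d"
      using xy N[OF n(1)] node_Suc_diff[of l n j] unfolding dist_real_def atLeastAtMost_iff by linarith
    moreover have "x \<in> {0..l}" "y \<in> {0..l}" using xy j by auto
    ultimately have "dist (f x) (f y) < e" using d(2)[of y x] by simp
    then show ?thesis by (simp add: dist_real_def)
  qed
  then show ?thesis by blast
qed

text \<open>On each cell the error is at most the oscillation of f times the integral of |k|, and
  these integrals add up to a fixed number. The tags are left free because left and right end points
  both occur in applications.\<close>

lemma Riemann_Stieltjes_tendsto:
  assumes "0 \<le> l" "primitive l h k" "continuous_on {0..l} f"
    and tag: "\<And>n j. j < 2 ^ n \<Longrightarrow> \<xi> n j \<in> {node l n j..node l n (Suc j)}"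
  shows "(\<lambda>n. \<Sum>j<2 ^ n. f (\<xi> n j) * (h (node l n (Suc j)) - h (node l n j))) \<longlonglongrightarrow> L2_inner l f k"
proof (rule LIMSEQ_I)
  fix r :: real assume "r > 0"
  define C where "C = (\<integral>t. \<bar>k t\<bar> \<partial>edge_measure l)"
  have C: "C \<ge> 0" by (simp add: C_def)
  define e where "e = r / (C + 1)"
  have e: "e > 0" "e * (C + 1) = r" using C \<open>r > 0\<close> by (simp_all add: e_def)
  obtain N where N: "\<And>n j x y. n \<ge> N \<Longrightarrow> j < 2 ^ n \<Longrightarrow> x \<in> {node l n j..node l n (Suc j)} \<Longrightarrow>
      y \<in> {node l n j..node l n (Suc j)} \<Longrightarrow> \<bar>f x - f y\<bar> \<le> e"
    using uniform_oscillation[OF assms(1,3) e(1)] by blast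
  note ik = primitiveD(2)[OF assms(2)]
  have f: "f \<in> L2_edge l" by (rule L2_edge_continuous_on[OF assms(3)])
  have ifk: "integrable (edge_measure l) (\<lambda>t. f t * k t)" by (rule L2_edge_mult[OF f primitiveD(1)[OF assms(2)]])
  show "\<exists>N. \<forall>n\<ge>N. norm ((\<Sum>j<2 ^ n. f (\<xi> n j) * (h (node l n (Suc j)) - h (node l n j))) - L2_inner l f k) < r"
  proof (intro exI allI impI)
    fix n assume n: "n \<ge> N"
    let ?I = "\<lambda>j. {node l n j..node l n (Suc j)}"
    have "\<bar>(\<Sum>j<2 ^ n. f (\<xi> n j) * (h (node l n (Suc j)) - h (node l n j))) - L2_inner l f k\<bar>
       = \<bar>\<Sum>j<2 ^ n. f (\<xi> n j) * (h (node l n (Suc j)) - h (node l n j)) - (LINT t:?I j|edge_measure l. f t * k t)\<bar>"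
      unfolding L2_inner_def sum_set_integral_nodes_all[OF assms(1) ifk, of n, symmetric] by (simp add: sum_subtractf)
    also have "\<dots> \<le> (\<Sum>j<2 ^ n. \<bar>f (\<xi> n j) * (h (node l n (Suc j)) - h (node l n j)) - (LINT t:?I j|edge_measure l. f t * k t)\<bar>)"
      by (rule sum_abs)
    also have "\<dots> \<le> (\<Sum>j<2 ^ n. e * (LINT t:?I j|edge_measure l. \<bar>k t\<bar>))"
    proof (rule sum_mono)
      fix j assume "j \<in> {..<2 ^ n :: nat}"
      then have j: "j < 2 ^ n" by simp
      have b: "0 \<le> node l n j" "node l n j \<le> node l n (Suc j)" "node l n (Suc j) \<le> l"
        using node_bounds[OF assms(1)] node_mono[OF assms(1)] j by auto
      have "f (\<xi> n j) * (h (node l n (Suc j)) - h (node l n j)) - (LINT t:?I j|edge_measure l. f t * k t)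
        = (LINT t:?I j|edge_measure l. f (\<xi> n j) * k t) - (LINT t:?I j|edge_measure l. f t * k t)"
        using primitiveD(3)[OF assms(2) b] by simp
      also have "\<dots> = (LINT t:?I j|edge_measure l. f (\<xi> n j) * k t - f t * k t)"
        by (subst set_integral_diff(2)) (use set_integrable_edge[OF ik b(1,3)] set_integrable_edge[OF ifk b(1,3)] in auto)
      also have "\<dots> = (LINT t:?I j|edge_measure l. (f (\<xi> n j) - f t) * k t)" by (simp add: left_diff_distrib)
      finally have eq: "f (\<xi> n j) * (h (node l n (Suc j)) - h (node l n j)) - (LINT t:?I j|edge_measure l. f t * k t)
        = (LINT t:?I j|edge_measure l. (f (\<xi> n j) - f t) * k t)" .
      have "\<bar>f (\<xi> n j) - f t\<bar> \<le> e" if "t \<in> ?I j" for t by (rule N[OF n j tag[OF j] that])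
      moreover have "(\<lambda>t. f (\<xi> n j) - f t) \<in> borel_measurable (edge_measure l)"
        using L2_edge_measurable[OF f] by simp
      ultimately show "\<bar>f (\<xi> n j) * (h (node l n (Suc j)) - h (node l n j)) - (LINT t:?I j|edge_measure l. f t * k t)\<bar>
         \<le> e * (LINT t:?I j|edge_measure l. \<bar>k t\<bar>)"
        unfolding eq by (intro set_integral_edge_bound(2)[OF ik b])
    qed
    also have "\<dots> = e * C"
      unfolding sum_distrib_left[symmetric] sum_set_integral_nodes_all[OF assms(1) integrable_abs[OF ik]] C_def ..
    also have "\<dots> < r" using e by (simp add: distrib_left)
    finally show "norm ((\<Sum>j<2 ^ n. f (\<xi> n j) * (h (node l n (Suc j)) - h (node l n j))) - L2_inner l f k) < r" by simp
  qed
qed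

text \<open>With left tags in one sum and right tags in the other the discrete product rule is an
  identity: at every level the two Riemann-Stieltjes sums add up to the boundary term exactly, so it
  remains to name their limits.\<close>

lemma primitive_integration_by_parts:
  assumes "0 \<le> l" "primitive l u v" "primitive l h k"
  shows "L2_inner l u k + L2_inner l v h = u l * h l - u 0 * h 0"
proof -
  have u: "continuous_on {0..l} u" and h: "continuous_on {0..l} h"
    using assms primitive_continuous_on by auto
  have tag: "node l n j \<in> {node l n j..node l n (Suc j)}" "node l n (Suc j) \<in> {node l n j..node l n (Suc j)}" for n j
    using node_mono[OF assms(1), of j "Suc j" n] by auto
  have "(\<lambda>n. (\<Sum>j<2 ^ n. u (node l n j) * (h (node l n (Suc j)) - h (node l n j)))
      + (\<Sum>j<2 ^ n. h (node l n (Suc j)) * (u (node l n (Suc j)) - u (node l n j))))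
     \<longlonglongrightarrow> L2_inner l u k + L2_inner l h v"
    by (intro tendsto_add Riemann_Stieltjes_tendsto assms u h tag)
  moreover have "(\<Sum>j<2 ^ n. u (node l n j) * (h (node l n (Suc j)) - h (node l n j)))
      + (\<Sum>j<2 ^ n. h (node l n (Suc j)) * (u (node l n (Suc j)) - u (node l n j))) = u l * h l - u 0 * h 0" for n
  proof -
    have "(\<Sum>j<2 ^ n. u (node l n j) * (h (node l n (Suc j)) - h (node l n j)))
      + (\<Sum>j<2 ^ n. h (node l n (Suc j)) * (u (node l n (Suc j)) - u (node l n j)))
      = (\<Sum>j<2 ^ n. u (node l n (Suc j)) * h (node l n (Suc j)) - u (node l n j) * h (node l n j))"
      unfolding sum.distrib[symmetric] by (simp add: algebra_simps)
    also have "\<dots> = u l * h l - u 0 * h 0"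
      using sum_lessThan_telescope[of "\<lambda>j. u (node l n j) * h (node l n j)" "2 ^ n"] by simp
    finally show ?thesis .
  qed
  ultimately have "(\<lambda>n. u l * h l - u 0 * h 0) \<longlonglongrightarrow> L2_inner l u k + L2_inner l h v" by simp
  then show ?thesis using LIMSEQ_unique[OF _ tendsto_const] by (metis L2_inner_commute)
qed

section \<open>Weak derivatives\<close>

lemma test_function_primitive:
  assumes "\<phi> \<in> test_functions l"
  shows "primitive l \<phi> (deriv \<phi>)"
  using test_function_DERIV[OF assms] test_function_deriv_continuous_on[OF assms, of UNIV]
  by (intro primitive_FTC) (auto simp: continuous_on_eq_continuous_at)

lemma primitive_imp_weak_deriv:
  assumes "0 \<le> l" "primitive l u v"
  shows "is_weak_deriv l u v"
  unfolding is_weak_deriv_def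
proof
  fix \<phi> assume \<phi>: "\<phi> \<in> test_functions l"
  have "\<phi> 0 = 0" "\<phi> l = 0" using test_function_zero[OF \<phi>] by auto
  then show "L2_inner l u (deriv \<phi>) = - L2_inner l v \<phi>"
    using primitive_integration_by_parts[OF assms test_function_primitive[OF \<phi>]] by simp
qed

lemma is_weak_deriv_cong_AE:
  assumes "u \<in> L2_edge l" "u' \<in> L2_edge l" "AE x in edge_measure l. u x = u' x" "is_weak_deriv l u' v"
  shows "is_weak_deriv l u v"
  using assms L2_inner_cong_AE[OF assms(1,2) test_function_deriv_L2 assms(3)] by (simp add: is_weak_deriv_def)

lemma weak_deriv_unique:
  assumes "0 < l" "v \<in> L2_edge l" "v' \<in> L2_edge l" "is_weak_deriv l u v" "is_weak_deriv l u v'"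
  shows "AE x in edge_measure l. v x = v' x"
proof -
  have "AE x in edge_measure l. v x - v' x = 0"
  proof (rule L2_fundamental_lemma[OF assms(1)])
    fix \<phi> assume "\<phi> \<in> test_functions l" "\<phi> \<in> smooth"
    then show "L2_inner l (\<lambda>x. v x - v' x) \<phi> = 0"
      using assms by (simp add: is_weak_deriv_def L2_inner_diff_left test_function_L2)
  qed (intro L2_edge_diff assms)
  then show ?thesis by simp
qed

text \<open>Mean value zero makes the antiderivative return to its starting value, so that after
  subtracting this value it vanishes near both ends.\<close>

lemma test_function_antiderivative:
  assumes \<eta>: "\<eta> \<in> test_functions l" "\<eta> \<in> smooth" and 0: "L2_inner l \<eta> (\<lambda>x. 1) = 0"
  obtains \<Phi> where "\<Phi> \<in> test_functions l" "\<Phi> \<in> smooth" "deriv \<Phi> = \<eta>"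
proof -
  obtain U where U: "U \<in> smooth" "\<And>x. (U has_real_derivative \<eta> x) (at x)"
    using smooth_antiderivative[OF \<eta>(2)] by blast
  obtain a b where ab: "0 < a" "b < l" "\<And>x. x \<notin> {a..b} \<Longrightarrow> \<eta> x = 0"
    using \<eta> by (auto simp: test_functions_def)
  \<comment> \<open>The bounds from \<open>test_functions\<close> satisfy only 0 < a and b < l; a
    may exceed l and b may be negative. The new bounds lie strictly inside (0,l) and still enclose
    the support.\<close>
  define a' b' where "a' = min a l / 2" and "b' = (max b 0 + l) / 2"
  show thesis
  proof (cases "0 < l")
    case False
    have "\<eta> x = 0" for x
      using test_function_zero[OF \<eta>(1), of x] False by (cases "x \<le> 0") auto
    then have "\<eta> = (\<lambda>x. 0)" by auto
    moreover have "deriv (\<lambda>x. 0::real) = (\<lambda>x. 0)" by auto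
    ultimately show thesis using that[of "\<lambda>x. 0"] \<eta> by simp
  next
    case l: True
    have a': "0 < a'" "a' < a" "a' < l" and b': "b < b'" "0 < b'" "b' < l"
      using l ab by (auto simp: a'_def b'_def min_def max_def)
    have left: "U x = U 0" if "x \<le> a'" for x
    proof -
      have *: "U y = U x" if "x < y" "y \<le> a'" for x y
      proof -
        have "\<exists>z. x < z \<and> z < y \<and> U y - U x = (y - x) * \<eta> z"
          using MVT2[OF that(1), of U \<eta>] U(2) by blast
        then show ?thesis using ab(3) a' that(2) by auto
      qed
      show ?thesis using *[of x 0] *[of 0 x] that a'(1) by (cases x "0::real" rule: linorder_cases) auto
    qed
    have right: "U x = U l" if "x \<ge> b'" for x
    proof -
      have *: "U y = U x" if "x < y" "x \<ge> b'" for x y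
      proof -
        have "\<exists>z. x < z \<and> z < y \<and> U y - U x = (y - x) * \<eta> z"
          using MVT2[OF that(1), of U \<eta>] U(2) by blast
        then show ?thesis using ab(3) b' that(2) by auto
      qed
      show ?thesis using *[of x l] *[of l x] that b'(3) by (cases x l rule: linorder_cases) auto
    qed
    have "primitive l U \<eta>"
      using U(2) smooth_continuous_on[OF \<eta>(2), of UNIV]
      by (intro primitive_FTC) (auto simp: continuous_on_eq_continuous_at)
    then have "U l - U 0 = (LINT t:{0..l}|edge_measure l. \<eta> t)"
      by (rule primitiveD(3)) (use l in auto)
    then have Ul: "U l = U 0" using 0 by (simp add: set_integral_edge_whole L2_inner_def)
    define \<Phi> where "\<Phi> = (\<lambda>x. U x - U 0)"
    have s: "\<Phi> \<in> smooth" unfolding \<Phi>_def by (intro smooth_diff U smooth_const)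
    have "\<Phi> \<in> test_functions l"
    proof (rule test_functionI[OF s a'(1) b'(3)])
      fix x assume "x < a' \<or> x > b'"
      then show "\<Phi> x = 0" unfolding \<Phi>_def using left[of x] right[of x] Ul by auto
    qed
    moreover have "(\<Phi> has_real_derivative \<eta> x) (at x)" for x
      unfolding \<Phi>_def by (auto intro!: derivative_eq_intros U(2))
    then have "deriv \<Phi> = \<eta>" by (intro ext DERIV_imp_deriv)
    ultimately show thesis using that s by blast
  qed
qed

text \<open>If every test function had integral 0, the constant 1 would be orthogonal to all of them
  and vanish almost everywhere, which positive length excludes. Multiples of this function are used
  to remove the mean of other test functions.\<close>

lemma test_function_integral_1:
  assumes l: "0 < l"
  shows "\<exists>\<theta>. \<theta> \<in> test_functions l \<and> \<theta> \<in> smooth \<and> L2_inner l \<theta> (\<lambda>x. 1) = 1"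
proof -
  obtain \<theta>0 where \<theta>0: "\<theta>0 \<in> test_functions l" "\<theta>0 \<in> smooth" "L2_inner l \<theta>0 (\<lambda>x. 1) \<noteq> 0"
  proof (rule ccontr)
    assume "\<not> thesis"
    then have *: "\<And>\<phi>. \<phi> \<in> test_functions l \<Longrightarrow> \<phi> \<in> smooth \<Longrightarrow> L2_inner l (\<lambda>x. 1) \<phi> = 0"
      using that L2_inner_commute by metis
    have "AE x in edge_measure l. (1::real) = 0"
      by (rule L2_fundamental_lemma[OF l _ *]) auto
    then have "emeasure (edge_measure l) (space (edge_measure l)) = 0"
    proof -
      assume "AE x in edge_measure l. (1::real) = 0"
      then have "emeasure (edge_measure l) {x \<in> space (edge_measure l). True} = 0"
        by (intro emeasure_eq_0_AE) simp
      then show ?thesis by (simp only: simp_thms Collect_mem_eq)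
    qed
    then show False using l by (simp add: emeasure_edge)
  qed
  define \<theta> where "\<theta> = (\<lambda>x. (1 / L2_inner l \<theta>0 (\<lambda>x. 1)) * \<theta>0 x)"
  have \<theta>: "\<theta> \<in> test_functions l" "\<theta> \<in> smooth" "L2_inner l \<theta> (\<lambda>x. 1) = 1"
    using test_function_lin[OF \<theta>0(1) \<theta>0(1), of "1 / L2_inner l \<theta>0 (\<lambda>x. 1)" 0]
      smooth_cmult[OF \<theta>0(2), of "1 / L2_inner l \<theta>0 (\<lambda>x. 1)"] \<theta>0(3)
      L2_inner_cmult_left[of l "1 / L2_inner l \<theta>0 (\<lambda>x. 1)" \<theta>0 "\<lambda>x. 1"]
    unfolding \<theta>_def by simp_all
  then show ?thesis by blast
qed

text \<open>The lemma of du Bois-Reymond: subtracting m times \<theta> from \<psi> leaves mean zero,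
  hence the derivative of a test function, which z annihilates. So z pairs with \<psi> exactly as
  the constant c does.\<close>

lemma weak_deriv_zero_imp_const:
  assumes l: "0 < l" and z: "z \<in> L2_edge l" and "\<And>\<phi>. \<phi> \<in> test_functions l \<Longrightarrow> L2_inner l z (deriv \<phi>) = 0"
  shows "\<exists>c. AE x in edge_measure l. z x = c"
proof -
  obtain \<theta> where \<theta>: "\<theta> \<in> test_functions l" "\<theta> \<in> smooth" "L2_inner l \<theta> (\<lambda>x. 1) = 1"
    using test_function_integral_1[OF l] by blast
  define c where "c = L2_inner l z \<theta>"
  have "AE x in edge_measure l. z x - c = 0"
  proof (rule L2_fundamental_lemma[OF l])
    show "(\<lambda>x. z x - c) \<in> L2_edge l" by (intro L2_edge_diff z L2_edge_const)
    fix \<psi> assume \<psi>: "\<psi> \<in> test_functions l" "\<psi> \<in> smooth"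
    define m where "m = L2_inner l \<psi> (\<lambda>x. 1)"
    define \<eta> where "\<eta> = (\<lambda>x. 1 * \<psi> x + (- m) * \<theta> x)"
    have L2: "\<psi> \<in> L2_edge l" "\<theta> \<in> L2_edge l" using \<psi> \<theta> test_function_L2 by auto
    have inner: "L2_inner l \<eta> w = L2_inner l \<psi> w - m * L2_inner l \<theta> w" if "w \<in> L2_edge l" for w
      unfolding \<eta>_def using L2_inner_add_left[OF L2_edge_cmult[OF L2(1), of 1] L2_edge_cmult[OF L2(2), of "-m"] that]
      by (simp add: L2_inner_cmult_left[where c = 1, simplified] L2_inner_cmult_left[where c = "-m", simplified])
    have "\<eta> \<in> test_functions l" unfolding \<eta>_def by (rule test_function_lin[OF \<psi>(1) \<theta>(1)])
    moreover have "\<eta> \<in> smooth"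
      unfolding \<eta>_def by (rule smooth_add[OF smooth_cmult[OF \<psi>(2)] smooth_cmult[OF \<theta>(2)]])
    moreover have "L2_inner l \<eta> (\<lambda>x. 1) = 0" using inner[of "\<lambda>x. 1"] \<theta>(3) by (simp add: m_def)
    ultimately obtain \<Phi> where \<Phi>: "\<Phi> \<in> test_functions l" "deriv \<Phi> = \<eta>"
      using test_function_antiderivative[of \<eta> l] by metis
    have "L2_inner l z \<eta> = 0" using assms(3)[OF \<Phi>(1)] \<Phi>(2) by simp
    then have "L2_inner l \<psi> z = m * c" using inner[OF z] by (simp add: c_def L2_inner_commute)
    moreover have "L2_inner l (\<lambda>x. c) \<psi> = c * m"
      using L2_inner_cmult_left[of l c "\<lambda>x. 1" \<psi>] by (simp add: m_def L2_inner_commute)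
    ultimately show "L2_inner l (\<lambda>x. z x - c) \<psi> = 0"
      using L2_inner_diff_left[OF z L2_edge_const L2(1), of c] by (simp add: L2_inner_commute[of l z \<psi>])
  qed
  then show ?thesis by (intro exI[of _ c]) simp
qed

text \<open>The integral of v has the same weak derivative as u, so the two differ by a constant,
  which is absorbed into the primitive.\<close>

lemma weak_deriv_imp_primitive:
  assumes l: "0 < l" and u: "u \<in> L2_edge l" and v: "v \<in> L2_edge l" and "is_weak_deriv l u v"
  shows "\<exists>w. primitive l w v \<and> (AE x in edge_measure l. u x = w x)"
proof -
  define w where "w = (\<lambda>x. 0 + (LINT t:{0..x}|edge_measure l. v t))"
  have w: "primitive l w v" unfolding w_def by (rule primitive_exists[OF v])
  have wL: "w \<in> L2_edge l" using primitive_L2[OF w] .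
  have "\<exists>c. AE x in edge_measure l. u x - w x = c"
  proof (rule weak_deriv_zero_imp_const[OF l])
    fix \<phi> assume \<phi>: "\<phi> \<in> test_functions l"
    have "is_weak_deriv l w v" using primitive_imp_weak_deriv[OF _ w] l by simp
    then show "L2_inner l (\<lambda>x. u x - w x) (deriv \<phi>) = 0"
      using assms(4) \<phi> by (simp add: is_weak_deriv_def L2_inner_diff_left[OF u wL test_function_deriv_L2[OF \<phi>]])
  qed (intro L2_edge_diff u wL)
  then obtain c where "AE x in edge_measure l. u x - w x = c" ..
  then have "AE x in edge_measure l. u x = 1 * w x + 1 * c" by eventually_elim simp
  then show ?thesis
    using primitive_lin[OF w primitive_const[of l c], of 1 1] by (intro exI[of _ "\<lambda>x. 1 * w x + 1 * c"]) simp
qed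

lemma weak_deriv_H1:
  assumes "u \<in> H_edge l (Suc 0)"
  shows "weak_deriv l u \<in> L2_edge l" "is_weak_deriv l u (weak_deriv l u)"
  using someI_ex[of "\<lambda>v. v \<in> L2_edge l \<and> is_weak_deriv l u v"] assms unfolding weak_deriv_def by auto

lemma H1_primitive:
  assumes "0 < l" "u \<in> H_edge l (Suc 0)"
  obtains w where "primitive l w (weak_deriv l u)" "AE x in edge_measure l. u x = w x"
  using weak_deriv_imp_primitive[OF assms(1) _ weak_deriv_H1[OF assms(2)]] assms(2) by auto

text \<open>\<open>weak_deriv\<close> picks some weak derivative, not necessarily the witness inside
  \<open>H_edge\<close>; uniqueness up to null sets carries the second derivative over.\<close>

lemma weak_deriv_H2:
  assumes "0 < l" "u \<in> H_edge l (Suc (Suc 0))"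
  shows "weak_deriv l u \<in> H_edge l (Suc 0)"
proof -
  obtain v where v: "v \<in> H_edge l (Suc 0)" "is_weak_deriv l u v" and u: "u \<in> L2_edge l" using assms(2) by auto
  have u1: "u \<in> H_edge l (Suc 0)" using u v by auto
  have "AE x in edge_measure l. weak_deriv l u x = v x"
    using v weak_deriv_H1[OF u1] by (intro weak_deriv_unique[OF assms(1)]) auto
  moreover obtain v' where "v' \<in> L2_edge l" "is_weak_deriv l v v'" using v by auto
  ultimately have "is_weak_deriv l (weak_deriv l u) v'"
    using is_weak_deriv_cong_AE[of "weak_deriv l u" l v v'] weak_deriv_H1[OF u1] v by simp
  then show ?thesis using \<open>v' \<in> L2_edge l\<close> weak_deriv_H1[OF u1] by auto
qed

section \<open>Traces\<close>

text \<open>If they differed at a, continuity would make them differ on a nondegenerate subinterval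
  of the edge, one-sided when a is an end point.\<close>

lemma continuous_AE_eq:
  fixes w w' :: "real \<Rightarrow> real"
  assumes l: "0 < l" and "continuous_on {0..l} w" "continuous_on {0..l} w'"
    and ae: "AE x in edge_measure l. w x = w' x" and a: "a \<in> {0..l}"
  shows "w a = w' a"
proof (rule ccontr)
  assume "w a \<noteq> w' a"
  define d where "d = (\<lambda>x. \<bar>w x - w' x\<bar>)"
  have "continuous_on {0..l} d" unfolding d_def by (intro continuous_intros assms)
  moreover have "d a > 0" using \<open>w a \<noteq> w' a\<close> by (simp add: d_def)
  ultimately obtain r where r: "r > 0" "\<And>x. x \<in> {0..l} \<Longrightarrow> dist x a < r \<Longrightarrow> dist (d x) (d a) < d a"
    using a unfolding continuous_on_iff by metis
  define p q where "p = max 0 (a - r / 2)" and "q = min l (a + r / 2)"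
  have pq: "p < q" "0 \<le> p" "q \<le> l" using r(1) a l by (auto simp: p_def q_def)
  have ne: "w x \<noteq> w' x" if "x \<in> {p..q}" for x
  proof -
    have "x \<in> {0..l}" "dist x a < r" using that r(1) a by (auto simp: p_def q_def dist_real_def abs_if)
    then have "dist (d x) (d a) < d a" by (rule r(2))
    then show ?thesis by (auto simp: d_def dist_real_def)
  qed
  have "AE x in edge_measure l. x \<notin> {p..q}"
    using ae by eventually_elim (use ne in blast)
  then have "emeasure (edge_measure l) {p..q} = 0"
  proof -
    assume "AE x in edge_measure l. x \<notin> {p..q}"
    then have "emeasure (edge_measure l) {x \<in> space (edge_measure l). x \<in> {p..q}} = 0"
      by (rule emeasure_eq_0_AE)
    moreover have "{x \<in> space (edge_measure l). x \<in> {p..q}} = {p..q}" using pq by auto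
    ultimately show ?thesis by simp
  qed
  moreover have "emeasure (edge_measure l) {p..q} = ennreal (q - p)"
    using pq by (simp add: emeasure_edge)
  ultimately show False using pq by simp
qed

lemma edge_trace_eq:
  assumes "0 < l" "continuous_on {0..l} w" "AE x in edge_measure l. u x = w x" "a \<in> {0..l}"
  shows "edge_trace l u a = w a"
  unfolding edge_trace_def
proof (rule the_equality)
  show "\<exists>w'. continuous_on {0..l} w' \<and> (AE x in edge_measure l. u x = w' x) \<and> w' a = w a"
    using assms by blast
  fix c assume "\<exists>w'. continuous_on {0..l} w' \<and> (AE x in edge_measure l. u x = w' x) \<and> w' a = c"
  then obtain w' where w': "continuous_on {0..l} w'" "AE x in edge_measure l. u x = w' x" "w' a = c" by blast
  have "AE x in edge_measure l. w' x = w x" using w'(2) assms(3) by eventually_elim simp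
  then show "c = w a" using continuous_AE_eq[OF assms(1) w'(1) assms(2) _ assms(4)] w'(3) by simp
qed


section \<open>Estimates of the Gagliardo seminorm\<close>

abbreviation edge_pair :: "real \<Rightarrow> (real \<times> real) measure" where
  "edge_pair l \<equiv> edge_measure l \<Otimes>\<^sub>M edge_measure l"

lemma pair_sigma_finite_edge: "pair_sigma_finite (edge_measure l) (edge_measure l)"
  by (simp add: pair_sigma_finite_def sigma_finite_edge)

lemma measurable_edge_id: "(\<lambda>x. x) \<in> borel_measurable (edge_measure l)"
  by (rule borel_measurable_edge) simp

lemma measurable_edge_fst: "u \<in> borel_measurable (edge_measure l) \<Longrightarrow> (\<lambda>z. u (fst z)) \<in> borel_measurable (edge_pair l)"
  by (rule measurable_compose[OF measurable_fst])

lemma measurable_edge_snd: "u \<in> borel_measurable (edge_measure l) \<Longrightarrow> (\<lambda>z. u (snd z)) \<in> borel_measurable (edge_pair l)"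
  by (rule measurable_compose[OF measurable_snd])

text \<open>Written on pairs so that the seminorm becomes a single integral over the product
  measure, which can then be restricted to rectangles. On the diagonal the value is 0.\<close>

definition gagliardo_quotient :: "real \<Rightarrow> (real \<Rightarrow> real) \<Rightarrow> real \<times> real \<Rightarrow> real" where
  "gagliardo_quotient s u z = (u (fst z) - u (snd z))\<^sup>2 / \<bar>fst z - snd z\<bar> powr (1 + 2 * s)"

lemma gagliardo_quotient_nonneg [simp]: "0 \<le> gagliardo_quotient s u z"
  by (simp add: gagliardo_quotient_def)

lemma measurable_gagliardo_quotient:
  assumes "u \<in> borel_measurable (edge_measure l)"
  shows "gagliardo_quotient s u \<in> borel_measurable (edge_pair l)"
proof -
  show ?thesis unfolding gagliardo_quotient_def
    by (rule borel_measurable_divide[OF borel_measurable_power[OF borel_measurable_diff[OF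
          measurable_edge_fst[OF assms] measurable_edge_snd[OF assms]]]
        measurable_abs_powr[OF borel_measurable_diff[OF
          measurable_edge_fst[OF measurable_edge_id] measurable_edge_snd[OF measurable_edge_id]]]])
qed

lemma gagliardo_pair:
  assumes "u \<in> borel_measurable (edge_measure l)"
  shows "gagliardo l s u = (\<integral>\<^sup>+z. ennreal (gagliardo_quotient s u z) \<partial>edge_pair l)"
proof -
  have "(\<integral>\<^sup>+x. \<integral>\<^sup>+y. ennreal (gagliardo_quotient s u (x, y)) \<partial>edge_measure l \<partial>edge_measure l)
      = (\<integral>\<^sup>+z. ennreal (gagliardo_quotient s u z) \<partial>edge_pair l)"
    by (rule sigma_finite_measure.nn_integral_fst[OF sigma_finite_edge])
      (rule measurable_compose[OF measurable_gagliardo_quotient[OF assms] measurable_ennreal])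
  then show ?thesis by (simp only: gagliardo_def gagliardo_quotient_def fst_conv snd_conv)
qed

lemma gagliardo_cong_AE:
  assumes "AE x in edge_measure l. u x = u' x"
  shows "gagliardo l s u = gagliardo l s u'"
  unfolding gagliardo_def
proof (rule nn_integral_cong_AE)
  show "AE x in edge_measure l. (\<integral>\<^sup>+y. ennreal ((u x - u y)\<^sup>2 / \<bar>x - y\<bar> powr (1 + 2 * s)) \<partial>edge_measure l)
     = (\<integral>\<^sup>+y. ennreal ((u' x - u' y)\<^sup>2 / \<bar>x - y\<bar> powr (1 + 2 * s)) \<partial>edge_measure l)"
    using assms
  proof eventually_elim
    case (elim x)
    show ?case
    proof (rule nn_integral_cong_AE)
      show "AE y in edge_measure l. ennreal ((u x - u y)\<^sup>2 / \<bar>x - y\<bar> powr (1 + 2 * s))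
          = ennreal ((u' x - u' y)\<^sup>2 / \<bar>x - y\<bar> powr (1 + 2 * s))"
        using assms by eventually_elim (simp add: elim)
    qed
  qed
qed

text \<open>The crude bound (p + q)^2 <= 2 p^2 + 2 q^2 replaces Minkowski's inequality, as the
  seminorm enters only through finiteness and smallness.\<close>

lemma gagliardo_lin:
  assumes "u \<in> borel_measurable (edge_measure l)" "v \<in> borel_measurable (edge_measure l)"
  shows "gagliardo l s (\<lambda>x. a * u x + b * v x) \<le> ennreal (2 * a\<^sup>2) * gagliardo l s u + ennreal (2 * b\<^sup>2) * gagliardo l s v"
proof -
  note [measurable] = measurable_gagliardo_quotient[OF assms(1), of s] measurable_gagliardo_quotient[OF assms(2), of s]
  have le: "gagliardo_quotient s (\<lambda>x. a * u x + b * v x) z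
      \<le> 2 * a\<^sup>2 * gagliardo_quotient s u z + 2 * b\<^sup>2 * gagliardo_quotient s v z" for z
  proof -
    have *: "(a * p + b * q)\<^sup>2 \<le> 2 * a\<^sup>2 * p\<^sup>2 + 2 * b\<^sup>2 * q\<^sup>2" for p q
      using zero_le_power2[of "a * p - b * q"] by (simp add: power2_eq_square algebra_simps)
    have "(a * u (fst z) + b * v (fst z) - (a * u (snd z) + b * v (snd z)))\<^sup>2
      = (a * (u (fst z) - u (snd z)) + b * (v (fst z) - v (snd z)))\<^sup>2" by (simp add: algebra_simps)
    also have "\<dots> \<le> 2 * a\<^sup>2 * (u (fst z) - u (snd z))\<^sup>2 + 2 * b\<^sup>2 * (v (fst z) - v (snd z))\<^sup>2" by (rule *)
    finally have "(a * u (fst z) + b * v (fst z) - (a * u (snd z) + b * v (snd z)))\<^sup>2 / \<bar>fst z - snd z\<bar> powr (1 + 2 * s)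
      \<le> (2 * a\<^sup>2 * (u (fst z) - u (snd z))\<^sup>2 + 2 * b\<^sup>2 * (v (fst z) - v (snd z))\<^sup>2) / \<bar>fst z - snd z\<bar> powr (1 + 2 * s)"
      by (rule divide_right_mono) simp
    then show ?thesis by (simp add: gagliardo_quotient_def add_divide_distrib)
  qed
  have "gagliardo l s (\<lambda>x. a * u x + b * v x) = (\<integral>\<^sup>+z. ennreal (gagliardo_quotient s (\<lambda>x. a * u x + b * v x) z) \<partial>edge_pair l)"
    using assms by (intro gagliardo_pair) simp
  also have "\<dots> \<le> (\<integral>\<^sup>+z. ennreal (2 * a\<^sup>2) * ennreal (gagliardo_quotient s u z) + ennreal (2 * b\<^sup>2) * ennreal (gagliardo_quotient s v z) \<partial>edge_pair l)"
    using le by (intro nn_integral_mono) (simp add: ennreal_mult[symmetric] ennreal_plus[symmetric] ennreal_leI del: ennreal_plus)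
  also have "\<dots> = ennreal (2 * a\<^sup>2) * gagliardo l s u + ennreal (2 * b\<^sup>2) * gagliardo l s v"
    using assms by (simp add: gagliardo_pair nn_integral_add nn_integral_cmult)
  finally show ?thesis .
qed

text \<open>Translation by x moves the edge into [-l,l], and each half of that interval contributes
  at most the integral of z^p over [0,l].\<close>

lemma nn_integral_abs_powr_edge:
  assumes "p > -1" "x \<in> {0..l}"
  shows "(\<integral>\<^sup>+y. ennreal (\<bar>x - y\<bar> powr p) \<partial>edge_measure l) \<le> ennreal (2 * (l powr (p + 1) / (p + 1)))"
proof -
  define J where "J = l powr (p + 1) / (p + 1)"
  have l: "l \<ge> 0" using assms(2) by auto
  have J: "J \<ge> 0" using assms(1) by (simp add: J_def)
  have J0: "(\<integral>\<^sup>+z. ennreal (z powr p) * indicator {0..l} z \<partial>lborel) = ennreal J"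
    unfolding J_def by (rule nn_integral_has_integral_lebesgue'[OF _ has_integral_powr_from_0[OF assms(1) l]]) simp
  have J1: "(\<integral>\<^sup>+z. ennreal (\<bar>z\<bar> powr p) * indicator {0..l} z \<partial>lborel) = ennreal J"
  proof -
    have "ennreal (\<bar>z\<bar> powr p) * indicator {0..l} z = ennreal (z powr p) * indicator {0..l} z" for z
      by (auto simp: indicator_def)
    then have "(\<integral>\<^sup>+z. ennreal (\<bar>z\<bar> powr p) * indicator {0..l} z \<partial>lborel) = (\<integral>\<^sup>+z. ennreal (z powr p) * indicator {0..l} z \<partial>lborel)"
      by (intro nn_integral_cong)
    with J0 show ?thesis by (simp only:)
  qed
  have J2: "(\<integral>\<^sup>+z. ennreal (\<bar>z\<bar> powr p) * indicator {0..l} (- z) \<partial>lborel) = ennreal J"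
    using nn_integral_real_affine[of "\<lambda>z. ennreal (\<bar>z\<bar> powr p) * indicator {0..l} z" "-1" 0] J1 by simp
  have "(\<integral>\<^sup>+y. ennreal (\<bar>x - y\<bar> powr p) \<partial>edge_measure l) = (\<integral>\<^sup>+y. ennreal (\<bar>x - y\<bar> powr p) * indicator {0..l} y \<partial>lborel)"
    by (rule nn_integral_edge)
  also have "\<dots> = (\<integral>\<^sup>+z. ennreal (\<bar>z\<bar> powr p) * indicator {0..l} (x + z) \<partial>lborel)"
    using nn_integral_real_affine[of "\<lambda>y. ennreal (\<bar>x - y\<bar> powr p) * indicator {0..l} y" 1 x] by simp
  also have "\<dots> \<le> (\<integral>\<^sup>+z. ennreal (\<bar>z\<bar> powr p) * indicator {0..l} z + ennreal (\<bar>z\<bar> powr p) * indicator {0..l} (- z) \<partial>lborel)"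
    using assms(2) by (intro nn_integral_mono) (auto simp: indicator_def)
  also have "\<dots> = ennreal J + ennreal J"
    by (subst nn_integral_add) (auto simp: J1 J2)
  also have "\<dots> = ennreal (2 * J)" using J by (simp add: ennreal_plus[symmetric] del: ennreal_plus)
  finally show ?thesis by (simp add: J_def)
qed

text \<open>A Schur-type estimate behind two bounds on the seminorm: w = 1/2 serves primitives, w
  the indicator of a small set serves cut-offs. Division leaves the kernel |x - y|^(r - 1 - 2s),
  which is integrable because r > 2s. The factor 4 is 2 for the two sides of x times 2 for the two
  symmetric terms.\<close>

lemma gagliardo_le_kernel:
  assumes l: "0 \<le> l" and c: "c \<ge> 0" and r: "r > 2 * s"
    and w: "w \<in> borel_measurable borel" "\<And>x. 0 \<le> w x"
    and bd: "\<And>x y. x \<in> {0..l} \<Longrightarrow> y \<in> {0..l} \<Longrightarrow> x \<noteq> y \<Longrightarrow> (u x - u y)\<^sup>2 \<le> c * \<bar>x - y\<bar> powr r * (w x + w y)"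
  shows "gagliardo l s u \<le> ennreal (c * 4 * (l powr (r - 2 * s) / (r - 2 * s))) * (\<integral>\<^sup>+x. ennreal (w x) \<partial>edge_measure l)"
proof -
  define p where "p = r - 1 - 2 * s"
  define J where "J = l powr (p + 1) / (p + 1)"
  have p: "p > -1" and J: "J \<ge> 0" using r by (simp_all add: p_def J_def)
  let ?k = "\<lambda>x y. ennreal (c * \<bar>x - y\<bar> powr p)"
  have wm: "w \<in> borel_measurable (edge_measure l)" by (rule borel_measurable_edge[OF w(1)])
  note wm2 = measurable_edge_fst[OF wm] measurable_edge_snd[OF wm]
  have km: "(\<lambda>z. ?k (fst z) (snd z)) \<in> borel_measurable (edge_pair l)"
    by (rule measurable_compose[OF borel_measurable_times[OF borel_measurable_const measurable_abs_powr[OF borel_measurable_diff[OF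
          measurable_edge_fst[OF measurable_edge_id] measurable_edge_snd[OF measurable_edge_id]]]] measurable_ennreal])
  have ptw: "ennreal ((u x - u y)\<^sup>2 / \<bar>x - y\<bar> powr (1 + 2 * s)) \<le> ?k x y * ennreal (w x) + ?k x y * ennreal (w y)"
    if xy: "x \<in> {0..l}" "y \<in> {0..l}" for x y
  proof (cases "x = y")
    case False
    have "(u x - u y)\<^sup>2 / \<bar>x - y\<bar> powr (1 + 2 * s) \<le> (c * \<bar>x - y\<bar> powr r * (w x + w y)) / \<bar>x - y\<bar> powr (1 + 2 * s)"
      using bd[OF xy False] by (rule divide_right_mono) simp
    also have "\<dots> = c * (\<bar>x - y\<bar> powr r / \<bar>x - y\<bar> powr (1 + 2 * s)) * (w x + w y)" by simp
    also have "\<bar>x - y\<bar> powr r / \<bar>x - y\<bar> powr (1 + 2 * s) = \<bar>x - y\<bar> powr p"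
      by (simp add: p_def powr_diff[symmetric] algebra_simps)
    finally have "(u x - u y)\<^sup>2 / \<bar>x - y\<bar> powr (1 + 2 * s) \<le> c * \<bar>x - y\<bar> powr p * w x + c * \<bar>x - y\<bar> powr p * w y"
      by (simp add: distrib_left)
    then have "ennreal ((u x - u y)\<^sup>2 / \<bar>x - y\<bar> powr (1 + 2 * s)) \<le> ennreal (c * \<bar>x - y\<bar> powr p * w x + c * \<bar>x - y\<bar> powr p * w y)"
      by (rule ennreal_leI)
    then show ?thesis using c w(2) by (simp add: ennreal_plus ennreal_mult)
  qed simp
  have kint: "(\<integral>\<^sup>+y. ?k x y \<partial>edge_measure l) \<le> ennreal (c * (2 * J))" if "x \<in> {0..l}" for x
  proof -
    have "(\<integral>\<^sup>+y. ?k x y \<partial>edge_measure l) = ennreal c * (\<integral>\<^sup>+y. ennreal (\<bar>x - y\<bar> powr p) \<partial>edge_measure l)"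
      using c by (subst nn_integral_cmult[symmetric])
        (auto simp: ennreal_mult intro!: borel_measurable_edge)
    also have "\<dots> \<le> ennreal c * ennreal (2 * J)"
      unfolding J_def by (intro mult_left_mono nn_integral_abs_powr_edge p that) simp
    finally show ?thesis using c J by (simp add: ennreal_mult)
  qed
  have one: "(\<integral>\<^sup>+x. \<integral>\<^sup>+y. ?k x y * ennreal (w x) \<partial>edge_measure l \<partial>edge_measure l)
    \<le> ennreal (c * (2 * J)) * (\<integral>\<^sup>+x. ennreal (w x) \<partial>edge_measure l)"
  proof -
    have "(\<integral>\<^sup>+x. \<integral>\<^sup>+y. ?k x y * ennreal (w x) \<partial>edge_measure l \<partial>edge_measure l)
      \<le> (\<integral>\<^sup>+x. ennreal (c * (2 * J)) * ennreal (w x) \<partial>edge_measure l)"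
    proof (rule nn_integral_mono)
      fix x assume "x \<in> space (edge_measure l)"
      then have x: "x \<in> {0..l}" by simp
      have "(\<integral>\<^sup>+y. ?k x y * ennreal (w x) \<partial>edge_measure l) = (\<integral>\<^sup>+y. ?k x y \<partial>edge_measure l) * ennreal (w x)"
        by (rule nn_integral_multc) (auto intro!: borel_measurable_edge)
      also have "\<dots> \<le> ennreal (c * (2 * J)) * ennreal (w x)" by (intro mult_right_mono kint x) simp
      finally show "(\<integral>\<^sup>+y. ?k x y * ennreal (w x) \<partial>edge_measure l) \<le> ennreal (c * (2 * J)) * ennreal (w x)" .
    qed
    also have "\<dots> = ennreal (c * (2 * J)) * (\<integral>\<^sup>+x. ennreal (w x) \<partial>edge_measure l)"
      using wm by (intro nn_integral_cmult) simp
    finally show ?thesis .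
  qed
  \<comment> \<open>The kernel is symmetric, so exchanging the order of integration turns the second
    term into the first.\<close>
  have two: "(\<integral>\<^sup>+x. \<integral>\<^sup>+y. ?k x y * ennreal (w y) \<partial>edge_measure l \<partial>edge_measure l)
     = (\<integral>\<^sup>+x. \<integral>\<^sup>+y. ?k x y * ennreal (w x) \<partial>edge_measure l \<partial>edge_measure l)"
  proof -
    have "(\<integral>\<^sup>+y. \<integral>\<^sup>+x. ?k x y * ennreal (w y) \<partial>edge_measure l \<partial>edge_measure l)
        = (\<integral>\<^sup>+x. \<integral>\<^sup>+y. ?k x y * ennreal (w y) \<partial>edge_measure l \<partial>edge_measure l)"
      by (rule pair_sigma_finite.Fubini'[OF pair_sigma_finite_edge])
        (use km wm2 in \<open>simp add: case_prod_beta\<close>)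
    then show ?thesis by (simp add: abs_minus_commute)
  qed
  have "gagliardo l s u \<le> (\<integral>\<^sup>+x. \<integral>\<^sup>+y. (?k x y * ennreal (w x) + ?k x y * ennreal (w y)) \<partial>edge_measure l \<partial>edge_measure l)"
    unfolding gagliardo_def using ptw by (intro nn_integral_mono) auto
  also have "\<dots> = (\<integral>\<^sup>+x. (\<integral>\<^sup>+y. ?k x y * ennreal (w x) \<partial>edge_measure l) + (\<integral>\<^sup>+y. ?k x y * ennreal (w y) \<partial>edge_measure l) \<partial>edge_measure l)"
    by (intro nn_integral_cong nn_integral_add) (use w in \<open>auto intro!: borel_measurable_edge\<close>)
  also have "\<dots> = (\<integral>\<^sup>+x. \<integral>\<^sup>+y. ?k x y * ennreal (w x) \<partial>edge_measure l \<partial>edge_measure l)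
      + (\<integral>\<^sup>+x. \<integral>\<^sup>+y. ?k x y * ennreal (w y) \<partial>edge_measure l \<partial>edge_measure l)"
    using km wm2 by (intro nn_integral_add sigma_finite_measure.borel_measurable_nn_integral[OF sigma_finite_edge])
      (simp_all add: case_prod_beta)
  also have "\<dots> \<le> ennreal (c * (2 * J)) * (\<integral>\<^sup>+x. ennreal (w x) \<partial>edge_measure l)
      + ennreal (c * (2 * J)) * (\<integral>\<^sup>+x. ennreal (w x) \<partial>edge_measure l)"
    unfolding two by (intro add_mono one)
  also have "\<dots> = ennreal (c * 4 * J) * (\<integral>\<^sup>+x. ennreal (w x) \<partial>edge_measure l)"
  proof -
    have "ennreal (c * (2 * J)) + ennreal (c * (2 * J)) = ennreal (c * 4 * J)"
      using c J by (subst ennreal_plus[symmetric]) auto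
    then show ?thesis by (simp only: distrib_right[symmetric])
  qed
  finally show ?thesis by (simp add: J_def p_def)
qed

section \<open>Fractional Sobolev spaces\<close>

lemma Hs_norm_square: "(Hs_norm l s u)\<^sup>2 = (L2_norm l u)\<^sup>2 + enn2real (gagliardo l s u)"
  by (simp add: Hs_norm_def)

lemma Hs_norm_nonneg [simp]: "0 \<le> Hs_norm l s u"
  by (simp add: Hs_norm_def)

lemma L2_norm_lin_square:
  assumes "u \<in> L2_edge l" "v \<in> L2_edge l"
  shows "(L2_norm l (\<lambda>x. a * u x + b * v x))\<^sup>2 \<le> 2 * a\<^sup>2 * (L2_norm l u)\<^sup>2 + 2 * b\<^sup>2 * (L2_norm l v)\<^sup>2"
proof -
  have "L2_norm l (\<lambda>x. a * u x + b * v x) \<le> \<bar>a\<bar> * L2_norm l u + \<bar>b\<bar> * L2_norm l v"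
    using L2_norm_triangle[OF L2_edge_cmult[OF assms(1), of a] L2_edge_cmult[OF assms(2), of b]] by (simp add: L2_norm_cmult)
  then have "(L2_norm l (\<lambda>x. a * u x + b * v x))\<^sup>2 \<le> (\<bar>a\<bar> * L2_norm l u + \<bar>b\<bar> * L2_norm l v)\<^sup>2"
    by (rule power_mono) simp
  also have "\<dots> \<le> 2 * (\<bar>a\<bar> * L2_norm l u)\<^sup>2 + 2 * (\<bar>b\<bar> * L2_norm l v)\<^sup>2"
    using zero_le_power2[of "\<bar>a\<bar> * L2_norm l u - \<bar>b\<bar> * L2_norm l v"]
    unfolding power2_sum power2_diff by linarith
  finally show ?thesis by (simp add: power_mult_distrib)
qed

lemma Hs_lin:
  assumes "u \<in> Hs_edge l s" "v \<in> Hs_edge l s"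
  shows "(\<lambda>x. a * u x + b * v x) \<in> Hs_edge l s"
    and "(Hs_norm l s (\<lambda>x. a * u x + b * v x))\<^sup>2 \<le> 2 * a\<^sup>2 * (Hs_norm l s u)\<^sup>2 + 2 * b\<^sup>2 * (Hs_norm l s v)\<^sup>2"
proof -
  have L2: "u \<in> L2_edge l" "v \<in> L2_edge l" using assms by (auto simp: Hs_edge_def)
  have fin: "gagliardo l s u < \<infinity>" "gagliardo l s v < \<infinity>" using assms by (auto simp: Hs_edge_def)
  have le: "gagliardo l s (\<lambda>x. a * u x + b * v x) \<le> ennreal (2 * a\<^sup>2) * gagliardo l s u + ennreal (2 * b\<^sup>2) * gagliardo l s v"
    using L2 by (intro gagliardo_lin) (auto simp: L2_edge_def)
  also have "\<dots> < \<infinity>" using fin by (simp add: ennreal_mult_less_top)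
  finally show "(\<lambda>x. a * u x + b * v x) \<in> Hs_edge l s"
    using L2_edge_add[OF L2_edge_cmult[OF L2(1)] L2_edge_cmult[OF L2(2)]] by (simp add: Hs_edge_def)
  have e: "ennreal (2 * a\<^sup>2) * gagliardo l s u + ennreal (2 * b\<^sup>2) * gagliardo l s v
      = ennreal (2 * a\<^sup>2 * enn2real (gagliardo l s u) + 2 * b\<^sup>2 * enn2real (gagliardo l s v))"
    using fin by (simp add: ennreal_plus ennreal_mult)
  have "enn2real (gagliardo l s (\<lambda>x. a * u x + b * v x)) \<le> 2 * a\<^sup>2 * enn2real (gagliardo l s u) + 2 * b\<^sup>2 * enn2real (gagliardo l s v)"
    using le unfolding e by (intro enn2real_leI) auto
  then show "(Hs_norm l s (\<lambda>x. a * u x + b * v x))\<^sup>2 \<le> 2 * a\<^sup>2 * (Hs_norm l s u)\<^sup>2 + 2 * b\<^sup>2 * (Hs_norm l s v)\<^sup>2"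
    unfolding Hs_norm_square using L2_norm_lin_square[OF L2, of a b] by (simp add: distrib_left)
qed

text \<open>Halving e still suffices with the factor-2 inequality in place of the triangle
  inequality, since 2 (e/2)^2 + 2 (e/2)^2 = e^2.\<close>

lemma Hs_norm_add_less:
  assumes "u \<in> Hs_edge l s" "v \<in> Hs_edge l s" "Hs_norm l s u < e / 2" "Hs_norm l s v < e / 2"
  shows "Hs_norm l s (\<lambda>x. u x + v x) < e"
proof -
  have e: "e > 0" using assms(3) Hs_norm_nonneg[of l s u] by linarith
  have "(Hs_norm l s u)\<^sup>2 < (e / 2)\<^sup>2" "(Hs_norm l s v)\<^sup>2 < (e / 2)\<^sup>2"
    using assms by (auto intro!: power_strict_mono)
  moreover have "(Hs_norm l s (\<lambda>x. u x + v x))\<^sup>2 \<le> 2 * (Hs_norm l s u)\<^sup>2 + 2 * (Hs_norm l s v)\<^sup>2"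
    using Hs_lin(2)[OF assms(1,2), of 1 1] by simp
  ultimately have "(Hs_norm l s (\<lambda>x. u x + v x))\<^sup>2 < e\<^sup>2" by (simp add: power_divide)
  then show ?thesis using e by (intro power2_less_imp_less[of _ e]) auto
qed

text \<open>The squared Hoelder bound has exponent r = 1, and r > 2s is exactly s < 1/2. The weight
  1/2 makes \<open>w x + w y\<close> equal to 1.\<close>

lemma gagliardo_primitive:
  assumes "0 \<le> l" "s < 1 / 2" "primitive l u v"
  shows "gagliardo l s u \<le> ennreal ((L2_norm l v)\<^sup>2 * (2 * l * (l powr (1 - 2 * s) / (1 - 2 * s))))"
proof -
  have "gagliardo l s u \<le> ennreal ((L2_norm l v)\<^sup>2 * 4 * (l powr (1 - 2 * s) / (1 - 2 * s))) * (\<integral>\<^sup>+x. ennreal (1 / 2) \<partial>edge_measure l)"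
  proof (rule gagliardo_le_kernel[OF assms(1)])
    fix x y assume "x \<in> {0..l}" "y \<in> {0..l}" "x \<noteq> y"
    then show "(u x - u y)\<^sup>2 \<le> (L2_norm l v)\<^sup>2 * \<bar>x - y\<bar> powr 1 * (1 / 2 + 1 / 2)"
      using primitive_Holder[OF assms(3), of x y] by (simp add: mult.commute)
  qed (use assms(2) in auto)
  also have "(\<integral>\<^sup>+x. ennreal (1 / 2) \<partial>edge_measure l) = ennreal (l / 2)"
  proof -
    have "(\<integral>\<^sup>+x. ennreal (1 / 2) \<partial>edge_measure l) = ennreal (1 / 2) * ennreal l"
      using assms(1) by (subst nn_integral_const) (simp add: emeasure_edge)
    also have "\<dots> = ennreal (l / 2)" using assms(1) by (subst ennreal_mult[symmetric]) auto
    finally show ?thesis .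
  qed
  also have "ennreal ((L2_norm l v)\<^sup>2 * 4 * (l powr (1 - 2 * s) / (1 - 2 * s))) * ennreal (l / 2)
     = ennreal ((L2_norm l v)\<^sup>2 * (2 * l * (l powr (1 - 2 * s) / (1 - 2 * s))))"
    using assms by (subst ennreal_mult[symmetric]) (auto simp: algebra_simps)
  finally show ?thesis .
qed

lemma primitive_Hs: "0 \<le> l \<Longrightarrow> s < 1 / 2 \<Longrightarrow> primitive l u v \<Longrightarrow> u \<in> Hs_edge l s"
  using gagliardo_primitive[of l s u v] primitive_L2[of l u v]
  by (auto simp: Hs_edge_def intro: le_less_trans[OF _ ennreal_less_top])

lemma test_function_Hs: "0 \<le> l \<Longrightarrow> s < 1 / 2 \<Longrightarrow> \<phi> \<in> test_functions l \<Longrightarrow> \<phi> \<in> Hs_edge l s"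
  by (rule primitive_Hs[OF _ _ test_function_primitive])

text \<open>As u starts at 0, its derivative controls the L2 part of the norm too (Poincare's
  inequality).\<close>

lemma Hs_norm_primitive_0:
  assumes "0 \<le> l" "s < 1 / 2" "primitive l u v" "u 0 = 0"
  shows "(Hs_norm l s u)\<^sup>2 \<le> (l\<^sup>2 + 2 * l * (l powr (1 - 2 * s) / (1 - 2 * s))) * (L2_norm l v)\<^sup>2"
proof -
  have "\<bar>u x\<bar> \<le> sqrt l * L2_norm l v" if x: "x \<in> {0..l}" for x
  proof -
    have "(u x)\<^sup>2 \<le> \<bar>x\<bar> * (L2_norm l v)\<^sup>2"
      using primitive_Holder[OF assms(3) x, of 0] assms(1,4) by simp
    also have "\<dots> \<le> l * (L2_norm l v)\<^sup>2" using x by (intro mult_right_mono) auto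
    also have "\<dots> = (sqrt l * L2_norm l v)\<^sup>2" using assms(1) by (simp add: power_mult_distrib)
    finally show ?thesis using assms(1) by (simp add: abs_le_square_iff[symmetric] abs_mult)
  qed
  then have "(L2_norm l u)\<^sup>2 \<le> (sqrt l * L2_norm l v)\<^sup>2 * l"
    using assms(1) by (intro L2_norm_bounded primitive_L2[OF assms(3)]) auto
  also have "\<dots> = l\<^sup>2 * (L2_norm l v)\<^sup>2" using assms(1) by (simp add: power_mult_distrib power2_eq_square)
  finally have 1: "(L2_norm l u)\<^sup>2 \<le> l\<^sup>2 * (L2_norm l v)\<^sup>2" .
  have "enn2real (gagliardo l s u) \<le> (L2_norm l v)\<^sup>2 * (2 * l * (l powr (1 - 2 * s) / (1 - 2 * s)))"
    using gagliardo_primitive[OF assms(1-3)] assms(1,2) by (intro enn2real_leI) auto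
  with 1 show ?thesis unfolding Hs_norm_square by (simp add: algebra_simps)
qed

section \<open>The closure of the test functions in the fractional space\<close>

lemma Hs0_limit:
  assumes u: "u \<in> Hs_edge l s" and s: "0 \<le> l" "s < 1 / 2"
    and "\<And>e. e > 0 \<Longrightarrow> \<exists>w\<in>Hs0_edge l s. Hs_norm l s (\<lambda>x. u x - w x) < e"
  shows "u \<in> Hs0_edge l s"
  unfolding Hs0_edge_def
proof (intro CollectI conjI allI impI u)
  fix e :: real assume "e > 0"
  then obtain w where w: "w \<in> Hs0_edge l s" "Hs_norm l s (\<lambda>x. u x - w x) < e / 2" using assms(4)[of "e / 2"] by auto
  then obtain \<phi> where \<phi>: "\<phi> \<in> test_functions l" "Hs_norm l s (\<lambda>x. w x - \<phi> x) < e / 2"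
    using \<open>e > 0\<close> unfolding Hs0_edge_def by (auto dest!: spec[of _ "e / 2"])
  have wH: "w \<in> Hs_edge l s" using w(1) by (simp add: Hs0_edge_def)
  have "Hs_norm l s (\<lambda>x. (u x - w x) + (w x - \<phi> x)) < e"
    using Hs_lin(1)[OF u wH, of 1 "-1"] Hs_lin(1)[OF wH test_function_Hs[OF s \<phi>(1)], of 1 "-1"] w(2) \<phi>(2)
    by (intro Hs_norm_add_less) auto
  then show "\<exists>\<phi>\<in>test_functions l. Hs_norm l s (\<lambda>x. u x - \<phi> x) < e" using \<phi>(1) by auto
qed

lemma test_function_Hs0:
  assumes "0 \<le> l" "s < 1 / 2" "\<phi> \<in> test_functions l"
  shows "\<phi> \<in> Hs0_edge l s"
proof -
  have "Hs_norm l s (\<lambda>x. \<phi> x - \<phi> x) = 0"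
    by (simp add: Hs_norm_def L2_norm_def L2_inner_def gagliardo_def)
  then show ?thesis using test_function_Hs[OF assms] assms(3) unfolding Hs0_edge_def by (auto intro!: bexI[of _ \<phi>])
qed

lemma Hs0_lin:
  assumes s: "0 \<le> l" "s < 1 / 2" and u: "u \<in> Hs0_edge l s" and v: "v \<in> Hs0_edge l s"
  shows "(\<lambda>x. a * u x + b * v x) \<in> Hs0_edge l s"
  unfolding Hs0_edge_def
proof (intro CollectI conjI allI impI)
  have H: "u \<in> Hs_edge l s" "v \<in> Hs_edge l s" using u v by (auto simp: Hs0_edge_def)
  then show "(\<lambda>x. a * u x + b * v x) \<in> Hs_edge l s" by (rule Hs_lin)
  fix e :: real assume e: "e > 0"
  \<comment> \<open>As K is at least 1, d = e / K satisfies d <= e and hence K d^2 = d e <=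
    e^2.\<close>
  define K where "K = 2 * a\<^sup>2 + 2 * b\<^sup>2 + 1"
  have K: "K \<ge> 1" by (simp add: K_def)
  define d where "d = e / K"
  have d: "d > 0" "K * d = e" using e K by (simp_all add: d_def)
  have de: "d \<le> e" using d K mult_right_mono[of 1 K d] by simp
  obtain \<phi> \<psi> where \<phi>: "\<phi> \<in> test_functions l" "Hs_norm l s (\<lambda>x. u x - \<phi> x) < d"
    and \<psi>: "\<psi> \<in> test_functions l" "Hs_norm l s (\<lambda>x. v x - \<psi> x) < d"
    using u v d(1) unfolding Hs0_edge_def by blast
  have H': "(\<lambda>x. u x - \<phi> x) \<in> Hs_edge l s" "(\<lambda>x. v x - \<psi> x) \<in> Hs_edge l s"
    using Hs_lin(1)[OF H(1) test_function_Hs[OF s \<phi>(1)], of 1 "-1"]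
      Hs_lin(1)[OF H(2) test_function_Hs[OF s \<psi>(1)], of 1 "-1"] by auto
  have "(Hs_norm l s (\<lambda>x. u x - \<phi> x))\<^sup>2 \<le> d\<^sup>2" "(Hs_norm l s (\<lambda>x. v x - \<psi> x))\<^sup>2 \<le> d\<^sup>2"
    using \<phi>(2) \<psi>(2) by (auto intro!: power_mono)
  then have "2 * a\<^sup>2 * (Hs_norm l s (\<lambda>x. u x - \<phi> x))\<^sup>2 + 2 * b\<^sup>2 * (Hs_norm l s (\<lambda>x. v x - \<psi> x))\<^sup>2
      \<le> 2 * a\<^sup>2 * d\<^sup>2 + 2 * b\<^sup>2 * d\<^sup>2"
    by (intro add_mono mult_left_mono) auto
  also have "\<dots> < K * d\<^sup>2" using d(1) by (simp add: K_def algebra_simps)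
  also have "\<dots> = d * e" using d(2) by (simp add: power2_eq_square mult.assoc[symmetric] mult.commute)
  also have "\<dots> \<le> e\<^sup>2" using de e by (simp add: power2_eq_square)
  finally have "(Hs_norm l s (\<lambda>x. a * (u x - \<phi> x) + b * (v x - \<psi> x)))\<^sup>2 < e\<^sup>2"
    using Hs_lin(2)[OF H', of a b] by linarith
  then have "Hs_norm l s (\<lambda>x. a * (u x - \<phi> x) + b * (v x - \<psi> x)) < e"
    using e by (intro power2_less_imp_less[of _ e]) auto
  then have "Hs_norm l s (\<lambda>x. a * u x + b * v x - (a * \<phi> x + b * \<psi> x)) < e" by (simp add: algebra_simps)
  then show "\<exists>\<phi>\<in>test_functions l. Hs_norm l s (\<lambda>x. a * u x + b * v x - \<phi> x) < e"
    using test_function_lin[OF \<phi>(1) \<psi>(1), of a b] by (intro bexI[of _ "\<lambda>x. a * \<phi> x + b * \<psi> x"])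
qed

text \<open>Approximate the derivative in L2 by a test function, correct its mean with a multiple of
  \<theta>, and integrate. The correction is small because v has mean zero, which is what the two
  boundary values say.\<close>

lemma primitive_vanishing_Hs0:
  assumes l: "0 < l" and s: "s < 1 / 2" and u: "primitive l u v" and u0: "u 0 = 0" "u l = 0"
  shows "u \<in> Hs0_edge l s"
proof (rule Hs0_limit)
  show "u \<in> Hs_edge l s" using primitive_Hs[OF _ s u] l by simp
  fix e :: real assume e: "e > 0"
  note v = primitiveD(1)[OF u]
  obtain \<theta> where \<theta>: "\<theta> \<in> test_functions l" "\<theta> \<in> smooth" "L2_inner l \<theta> (\<lambda>x. 1) = 1"
    using test_function_integral_1[OF l] by blast
  have \<theta>L: "\<theta> \<in> L2_edge l" by (rule test_function_L2[OF \<theta>(1)])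
  define C where "C = l\<^sup>2 + 2 * l * (l powr (1 - 2 * s) / (1 - 2 * s))"
  have C: "C \<ge> 0" using l s by (simp add: C_def)
  define B where "B = 1 + L2_norm l (\<lambda>x. 1) * L2_norm l \<theta>"
  have B: "B \<ge> 1" by (simp add: B_def)
  \<comment> \<open>With this choice the final bound C (d B)^2 lies below ((C + 1) d B)^2 = e^2; the
    factor B pays for the correction of the mean.\<close>
  define d where "d = e / ((C + 1) * B)"
  have d: "d > 0" using e C B by (simp add: d_def)
  obtain \<psi> where \<psi>: "\<psi> \<in> test_functions l" "\<psi> \<in> smooth" "L2_norm l (\<lambda>x. v x - \<psi> x) < d"
    using test_functions_dense_L2[OF l v d] by blast
  have \<psi>L: "\<psi> \<in> L2_edge l" by (rule test_function_L2[OF \<psi>(1)])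
  define m where "m = L2_inner l \<psi> (\<lambda>x. 1)"
  have "u l - u 0 = (LINT t:{0..l}|edge_measure l. v t)" by (rule primitiveD(3)[OF u]) (use l in auto)
  then have "L2_inner l v (\<lambda>x. 1) = 0" using u0 by (simp add: set_integral_edge_whole L2_inner_def)
  then have "m = - L2_inner l (\<lambda>x. v x - \<psi> x) (\<lambda>x. 1)"
    using L2_inner_diff_left[OF v \<psi>L L2_edge_const] by (simp add: m_def)
  then have m: "\<bar>m\<bar> \<le> d * L2_norm l (\<lambda>x. 1)"
    using L2_inner_le[OF L2_edge_diff[OF v \<psi>L] L2_edge_const, of 1] \<psi>(3)
      mult_right_mono[of "L2_norm l (\<lambda>x. v x - \<psi> x)" d "L2_norm l (\<lambda>x. 1)"] by simp
  define \<eta> where "\<eta> = (\<lambda>x. 1 * \<psi> x + (- m) * \<theta> x)"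
  have \<eta>T: "\<eta> \<in> test_functions l" unfolding \<eta>_def by (rule test_function_lin[OF \<psi>(1) \<theta>(1)])
  have "\<eta> \<in> smooth" unfolding \<eta>_def by (rule smooth_add[OF smooth_cmult[OF \<psi>(2)] smooth_cmult[OF \<theta>(2)]])
  moreover have "L2_inner l \<eta> (\<lambda>x. 1) = 0"
    unfolding \<eta>_def using L2_inner_add_left[OF L2_edge_cmult[OF \<psi>L, of 1] L2_edge_cmult[OF \<theta>L, of "-m"] L2_edge_const, of 1] \<theta>(3)
      L2_inner_cmult_left[of l "-m" \<theta> "\<lambda>x. 1"] by (simp add: m_def)
  ultimately obtain \<Phi> where \<Phi>: "\<Phi> \<in> test_functions l" "deriv \<Phi> = \<eta>"
    using test_function_antiderivative[OF \<eta>T] by metis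
  have p: "primitive l (\<lambda>x. u x - \<Phi> x) (\<lambda>x. v x - \<eta> x)"
    using primitive_diff[OF u test_function_primitive[OF \<Phi>(1)]] \<Phi>(2) by simp
  have "L2_norm l (\<lambda>x. v x - \<eta> x) = L2_norm l (\<lambda>x. (v x - \<psi> x) + m * \<theta> x)" by (simp add: \<eta>_def algebra_simps)
  also have "\<dots> \<le> L2_norm l (\<lambda>x. v x - \<psi> x) + \<bar>m\<bar> * L2_norm l \<theta>"
    using L2_norm_triangle[OF L2_edge_diff[OF v \<psi>L] L2_edge_cmult[OF \<theta>L, of m]] by (simp add: L2_norm_cmult)
  also have "\<dots> < d + d * L2_norm l (\<lambda>x. 1) * L2_norm l \<theta>"
    using \<psi>(3) m by (intro add_less_le_mono mult_right_mono) auto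
  also have "\<dots> = d * B" by (simp add: B_def algebra_simps)
  finally have "L2_norm l (\<lambda>x. v x - \<eta> x) < d * B" .
  then have "(L2_norm l (\<lambda>x. v x - \<eta> x))\<^sup>2 \<le> (d * B)\<^sup>2" by (intro power_mono) auto
  moreover have "(Hs_norm l s (\<lambda>x. u x - \<Phi> x))\<^sup>2 \<le> C * (L2_norm l (\<lambda>x. v x - \<eta> x))\<^sup>2"
    unfolding C_def using test_function_zero(1)[OF \<Phi>(1), of 0] u0 l s by (intro Hs_norm_primitive_0 p) auto
  ultimately have "(Hs_norm l s (\<lambda>x. u x - \<Phi> x))\<^sup>2 \<le> C * (d * B)\<^sup>2" using C by (meson mult_left_mono order_trans)
  also have "\<dots> < (C + 1)\<^sup>2 * (d * B)\<^sup>2"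
  proof -
    have "C < (C + 1)\<^sup>2"
    proof -
      have "(C + 1)\<^sup>2 = C * C + 2 * C + 1" by (simp add: power2_eq_square algebra_simps)
      then show ?thesis using C zero_le_square[of C] by linarith
    qed
    then show ?thesis using d B by (intro mult_strict_right_mono) auto
  qed
  also have "\<dots> = e\<^sup>2"
  proof -
    have "(C + 1) * (d * B) = e" using C B by (simp add: d_def)
    then show ?thesis by (simp add: power_mult_distrib[symmetric])
  qed
  finally have "Hs_norm l s (\<lambda>x. u x - \<Phi> x) < e" using e by (intro power2_less_imp_less[of _ e]) auto
  then show "\<exists>w\<in>Hs0_edge l s. Hs_norm l s (\<lambda>x. u x - w x) < e"
    using test_function_Hs0[OF _ s \<Phi>(1)] l by (intro bexI[of _ \<Phi>]) auto
qed (use l s in auto)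

text \<open>
  This is where \<open>s < 1/2\<close> enters decisively: steps of width \<open>1/n\<close> have small norm in \<open>H\<^sup>s\<close>, so
  boundary values can be cut off.
\<close>

lemma step_Hs_norm_tendsto_0:
  assumes l: "0 < l" and s: "0 \<le> s" "s < 1 / 2" and L: "L \<ge> 0"
    and U: "\<And>n. U n \<in> borel_measurable (edge_measure l)" "\<And>n x. 0 \<le> U n x \<and> U n x \<le> 1"
      "\<And>n x y. \<bar>U n x - U n y\<bar> \<le> L * real (Suc n) * \<bar>x - y\<bar>"
    and A: "\<And>n. A n \<in> sets borel" "\<And>n. emeasure (edge_measure l) (A n \<inter> {0..l}) \<le> ennreal (2 / real (Suc n))"
      "\<And>n x. x \<in> {0..l} \<Longrightarrow> x \<notin> A n \<Longrightarrow> U n x = 0"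
  shows "(\<lambda>n. Hs_norm l s (U n)) \<longlonglongrightarrow> 0"
proof -
  \<comment> \<open>An exponent strictly between 2s and 1, which exists since s < 1/2. The lower
    bound makes the kernel integrable; the upper one makes the product of the Lipschitz factor
    (n+1)^q and the measure 2/(n+1) tend to 0.\<close>
  define q where "q = (1 + 2 * s) / 2"
  have q: "2 * s < q" "0 < q" "q < 1" using s by (simp_all add: q_def)
  define J where "J = 4 * (l powr (q - 2 * s) / (q - 2 * s))"
  have J: "J \<ge> 0" using q by (simp add: J_def)
  define C where "C = (L + 1) powr q * J * 2"
  have C: "C \<ge> 0" using J by (simp add: C_def)
  have bound: "(Hs_norm l s (U n))\<^sup>2 \<le> 2 / real (Suc n) + C * real (Suc n) powr (q - 1)" for n
  proof -
    let ?N = "real (Suc n)"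
    have wint: "(\<integral>\<^sup>+x. ennreal (indicator (A n) x) \<partial>edge_measure l) \<le> ennreal (2 / ?N)"
    proof -
      have "(\<integral>\<^sup>+x. ennreal (indicator (A n) x) \<partial>edge_measure l) = (\<integral>\<^sup>+x. indicator (A n \<inter> {0..l}) x \<partial>edge_measure l)"
        by (intro nn_integral_cong) (auto simp: indicator_def)
      also have "\<dots> = emeasure (edge_measure l) (A n \<inter> {0..l})"
        using A(1)[of n] by (intro nn_integral_indicator) (auto simp: sets_edge)
      finally show ?thesis using A(2)[of n] by simp
    qed
    have UL: "U n \<in> L2_edge l" using U(2)[of n] by (intro L2_edge_bounded[OF U(1), where B = 1]) auto
    have "ennreal ((L2_norm l (U n))\<^sup>2) = (\<integral>\<^sup>+x. ennreal ((U n x)\<^sup>2) \<partial>edge_measure l)"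
      unfolding L2_norm_square by (rule nn_integral_eq_integral[symmetric]) (use L2_edge_square[OF UL] in auto)
    also have "\<dots> \<le> (\<integral>\<^sup>+x. ennreal (indicator (A n) x) \<partial>edge_measure l)"
    proof (intro nn_integral_mono ennreal_leI)
      fix x assume "x \<in> space (edge_measure l)"
      then show "(U n x)\<^sup>2 \<le> indicator (A n) x"
        using A(3)[of x n] U(2)[of n x] by (auto simp: indicator_def power_le_one)
    qed
    also note wint
    finally have 1: "(L2_norm l (U n))\<^sup>2 \<le> 2 / ?N" by (subst (asm) ennreal_le_iff) auto
    have "gagliardo l s (U n) \<le> ennreal (((L + 1) * ?N) powr q * 4 * (l powr (q - 2 * s) / (q - 2 * s)))
        * (\<integral>\<^sup>+x. ennreal (indicator (A n) x) \<partial>edge_measure l)"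
    proof (rule gagliardo_le_kernel)
      fix x y assume xy: "x \<in> {0..l}" "y \<in> {0..l}" "x \<noteq> y"
      have *: "(U n x - U n y)\<^sup>2 \<le> ((L + 1) * ?N) powr q * \<bar>x - y\<bar> powr q"
      proof -
        \<comment> \<open>L + 1 instead of L keeps this positive for x distinct from y even if L =
          0. The square is then bounded by t^2 for t <= 1 and by 1 otherwise, in both cases by
          t^q.\<close>
        let ?t = "(L + 1) * ?N * \<bar>x - y\<bar>"
        have t: "\<bar>U n x - U n y\<bar> \<le> ?t" "\<bar>U n x - U n y\<bar> \<le> 1" "?t \<ge> 0"
          using U(3)[of n x y] U(2)[of n x] U(2)[of n y] L
          by (auto intro: order_trans[OF _ mult_right_mono[OF mult_right_mono]])
        have "(U n x - U n y)\<^sup>2 \<le> ?t powr q"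
        proof (cases "?t \<le> 1")
          case True
          have tp: "?t > 0" using xy(3) L by simp
          have "(U n x - U n y)\<^sup>2 \<le> ?t\<^sup>2" using t by (metis abs_le_square_iff abs_of_nonneg)
          also have "\<dots> = ?t powr 2" using tp by (simp add: powr_numeral)
          also have "\<dots> \<le> ?t powr q" using True tp q by (intro powr_mono') auto
          finally show ?thesis .
        next
          case False
          have "(U n x - U n y)\<^sup>2 \<le> 1" using t(2) by (simp add: abs_square_le_1)
          also have "\<dots> \<le> ?t powr q" using False q by (intro ge_one_powr_ge_zero) auto
          finally show ?thesis .
        qed
        then show ?thesis using L by (simp add: powr_mult)
      qed
      show "(U n x - U n y)\<^sup>2 \<le> ((L + 1) * ?N) powr q * \<bar>x - y\<bar> powr q * (indicator (A n) x + indicator (A n) y)"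
      proof (cases "x \<in> A n \<or> y \<in> A n")
        case True
        then have "1 \<le> indicator (A n) x + (indicator (A n) y :: real)" by (auto simp: indicator_def)
        from mult_left_mono[OF this, of "((L + 1) * ?N) powr q * \<bar>x - y\<bar> powr q"] show ?thesis using * by simp
      next
        case False
        then show ?thesis using A(3)[OF xy(1)] A(3)[OF xy(2)] by simp
      qed
    qed (use l q A(1) in auto)
    also have "\<dots> \<le> ennreal (((L + 1) * ?N) powr q * 4 * (l powr (q - 2 * s) / (q - 2 * s))) * ennreal (2 / ?N)"
      by (intro mult_left_mono wint) simp
    also have "\<dots> = ennreal (((L + 1) * ?N) powr q * J * (2 / ?N))"
      unfolding J_def using q by (subst ennreal_mult[symmetric]) (auto simp: mult.assoc)
    also have "((L + 1) * ?N) powr q * J * (2 / ?N) = C * ?N powr (q - 1)"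
      using L by (simp add: C_def powr_mult powr_diff del: of_nat_Suc)
    finally have "enn2real (gagliardo l s (U n)) \<le> C * ?N powr (q - 1)"
      using C by (intro enn2real_leI) auto
    with 1 show ?thesis unfolding Hs_norm_square by simp
  qed
  have lim: "(\<lambda>n. 2 / real (Suc n) + C * real (Suc n) powr (q - 1)) \<longlonglongrightarrow> 0 + C * 0"
  proof (intro tendsto_intros)
    show "(\<lambda>n. 2 / real (Suc n)) \<longlonglongrightarrow> 0"
      using tendsto_mult[OF tendsto_const[of 2] LIMSEQ_inverse_real_of_nat] by (simp add: divide_inverse)
    have "filterlim (\<lambda>n. real (Suc n)) at_top sequentially"
      using filterlim_real_sequentially filterlim_Suc by (rule filterlim_compose)
    then show "(\<lambda>n. real (Suc n) powr (q - 1)) \<longlonglongrightarrow> 0" using q by (intro tendsto_neg_powr) auto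
  qed
  have "(\<lambda>n. (Hs_norm l s (U n))\<^sup>2) \<longlonglongrightarrow> 0"
    by (rule tendsto_sandwich[OF _ _ tendsto_const lim[simplified]]) (use bound in auto)
  then have "(\<lambda>n. sqrt ((Hs_norm l s (U n))\<^sup>2)) \<longlonglongrightarrow> sqrt 0" by (rule tendsto_real_sqrt)
  then show ?thesis by simp
qed

text \<open>Subtract the combination of cut-offs near 0 and near l that has the same boundary values
  as u. The rest vanishes at both ends and lies in the closure by the previous case, and what was
  subtracted is small in norm.\<close>

lemma primitive_Hs0:
  assumes l: "0 < l" and s: "0 \<le> s" "s < 1 / 2" and u: "primitive l u v"
  shows "u \<in> Hs0_edge l s"
proof (rule Hs0_limit)
  show uH: "u \<in> Hs_edge l s" using primitive_Hs[OF _ s(2) u] l by simp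
  obtain L where L: "L \<ge> 0" "\<And>x y. \<bar>smooth_step x - smooth_step y\<bar> \<le> L * \<bar>x - y\<bar>"
    using smooth_step_props(6) by blast
  define A where "A n x = 1 - smooth_step (real (Suc n) * x + (-1))" for n x
  define B where "B n x = smooth_step (real (Suc n) * x + (2 - real (Suc n) * l))" for n x
  have sm: "A n \<in> smooth" "B n \<in> smooth" for n
    unfolding A_def B_def by (rule smooth_diff[OF smooth_const smooth_affine[OF smooth_step_props(1)]],
      rule smooth_affine[OF smooth_step_props(1)])
  have pr: "primitive l (A n) (deriv (A n))" "primitive l (B n) (deriv (B n))" for n
    using smooth_DERIV[OF sm(1)] smooth_DERIV[OF sm(2)] smooth_continuous_on[OF smooth_deriv[OF sm(1)], of UNIV]
      smooth_continuous_on[OF smooth_deriv[OF sm(2)], of UNIV]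
    by (auto intro!: primitive_FTC simp: continuous_on_eq_continuous_at)
  have lip: "\<bar>smooth_step (c * x + d) - smooth_step (c * y + d)\<bar> \<le> L * c * \<bar>x - y\<bar>" if "c > 0" for c d x y
  proof -
    have "\<bar>smooth_step (c * x + d) - smooth_step (c * y + d)\<bar> \<le> L * \<bar>(c * x + d) - (c * y + d)\<bar>" by (rule L(2))
    also have "(c * x + d) - (c * y + d) = c * (x - y)" by (simp add: algebra_simps)
    finally show ?thesis using that by (simp add: abs_mult mult.assoc)
  qed
  have limA: "(\<lambda>n. Hs_norm l s (A n)) \<longlonglongrightarrow> 0"
  proof (rule step_Hs_norm_tendsto_0[OF l s L(1), where A = "\<lambda>n. {..2 / real (Suc n)}"])
    show "A n \<in> borel_measurable (edge_measure l)" for n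
      by (intro borel_measurable_edge_continuous_on smooth_continuous_on sm)
    show "0 \<le> A n x \<and> A n x \<le> 1" for n x unfolding A_def using smooth_step_props(4,5) by simp
    show "\<bar>A n x - A n y\<bar> \<le> L * real (Suc n) * \<bar>x - y\<bar>" for n x y
      using lip[of "real (Suc n)" y "-1" x] unfolding A_def by (simp add: abs_minus_commute)
    show "emeasure (edge_measure l) ({..2 / real (Suc n)} \<inter> {0..l}) \<le> ennreal (2 / real (Suc n))" for n
    proof -
      have "emeasure (edge_measure l) ({..2 / real (Suc n)} \<inter> {0..l}) = emeasure lborel ({..2 / real (Suc n)} \<inter> {0..l})"
        by (intro emeasure_edge) auto
      also have "\<dots> \<le> emeasure lborel {0..2 / real (Suc n)}" by (intro emeasure_mono) auto
      finally show ?thesis by simp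
    qed
    show "A n x = 0" if "x \<in> {0..l}" "x \<notin> {..2 / real (Suc n)}" for n x
    proof -
      have "2 < real (Suc n) * x" using that(2) by (simp add: field_simps del: of_nat_Suc)
      then show ?thesis unfolding A_def by (simp add: smooth_step_props(3) del: of_nat_Suc)
    qed
  qed simp
  have limB: "(\<lambda>n. Hs_norm l s (B n)) \<longlonglongrightarrow> 0"
  proof (rule step_Hs_norm_tendsto_0[OF l s L(1), where A = "\<lambda>n. {l - 2 / real (Suc n)..}"])
    show "B n \<in> borel_measurable (edge_measure l)" for n
      by (intro borel_measurable_edge_continuous_on smooth_continuous_on sm)
    show "0 \<le> B n x \<and> B n x \<le> 1" for n x unfolding B_def using smooth_step_props(4,5) by simp
    show "\<bar>B n x - B n y\<bar> \<le> L * real (Suc n) * \<bar>x - y\<bar>" for n x y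
      unfolding B_def by (rule lip) simp
    show "emeasure (edge_measure l) ({l - 2 / real (Suc n)..} \<inter> {0..l}) \<le> ennreal (2 / real (Suc n))" for n
    proof -
      have "emeasure (edge_measure l) ({l - 2 / real (Suc n)..} \<inter> {0..l}) = emeasure lborel ({l - 2 / real (Suc n)..} \<inter> {0..l})"
        by (intro emeasure_edge) auto
      also have "\<dots> \<le> emeasure lborel {l - 2 / real (Suc n)..l}" by (intro emeasure_mono) auto
      finally show ?thesis by simp
    qed
    show "B n x = 0" if "x \<in> {0..l}" "x \<notin> {l - 2 / real (Suc n)..}" for n x
    proof -
      have "real (Suc n) * x + (2 - real (Suc n) * l) \<le> 0" using that(2) by (simp add: field_simps del: of_nat_Suc)
      then show ?thesis unfolding B_def by (simp add: smooth_step_props(2) del: of_nat_Suc)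
    qed
  qed simp
  fix e :: real assume e: "e > 0"
  have "(\<lambda>n. 2 * (u 0)\<^sup>2 * (Hs_norm l s (A n))\<^sup>2 + 2 * (u l)\<^sup>2 * (Hs_norm l s (B n))\<^sup>2) \<longlonglongrightarrow> 2 * (u 0)\<^sup>2 * 0\<^sup>2 + 2 * (u l)\<^sup>2 * 0\<^sup>2"
    by (intro tendsto_intros limA limB)
  then have ev: "eventually (\<lambda>n. 2 * (u 0)\<^sup>2 * (Hs_norm l s (A n))\<^sup>2 + 2 * (u l)\<^sup>2 * (Hs_norm l s (B n))\<^sup>2 < e\<^sup>2) sequentially"
    using e by (intro order_tendstoD(2)) auto
  \<comment> \<open>For such indices each cut-off has died out at the opposite end of the
    edge.\<close>
  obtain N where N: "3 / l < real N" using reals_Archimedean2 by blast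
  have "eventually (\<lambda>n. n \<ge> N) sequentially" by (rule eventually_ge_at_top)
  with ev have "eventually (\<lambda>n. n \<ge> N \<and> 2 * (u 0)\<^sup>2 * (Hs_norm l s (A n))\<^sup>2 + 2 * (u l)\<^sup>2 * (Hs_norm l s (B n))\<^sup>2 < e\<^sup>2) sequentially"
    by eventually_elim simp
  then obtain n where n: "n \<ge> N" "2 * (u 0)\<^sup>2 * (Hs_norm l s (A n))\<^sup>2 + 2 * (u l)\<^sup>2 * (Hs_norm l s (B n))\<^sup>2 < e\<^sup>2"
    by (auto simp: eventually_sequentially)
  have "3 / l < real (Suc n)" using N n(1) by linarith
  then have 3: "3 < real (Suc n) * l" using l by (simp add: field_simps del: of_nat_Suc)
  have bv: "A n 0 = 1" "B n l = 1" "A n l = 0" "B n 0 = 0"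
    using 3 by (simp_all add: A_def B_def smooth_step_props(2,3) del: of_nat_Suc)
  define w where "w = (\<lambda>x. u 0 * A n x + u l * B n x)"
  have HAB: "A n \<in> Hs_edge l s" "B n \<in> Hs_edge l s" using primitive_Hs[OF _ s(2) pr(1)] primitive_Hs[OF _ s(2) pr(2)] l by auto
  have "(Hs_norm l s w)\<^sup>2 < e\<^sup>2" unfolding w_def using Hs_lin(2)[OF HAB, of "u 0" "u l"] n(2) by linarith
  then have we: "Hs_norm l s w < e" using e by (intro power2_less_imp_less[of _ e]) auto
  have "primitive l (\<lambda>x. u x - w x) (\<lambda>x. v x - (u 0 * deriv (A n) x + u l * deriv (B n) x))"
    unfolding w_def by (rule primitive_diff[OF u primitive_lin[OF pr(1) pr(2)]])
  then have "(\<lambda>x. u x - w x) \<in> Hs0_edge l s"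
    by (rule primitive_vanishing_Hs0[OF l s(2)]) (simp_all add: w_def bv)
  then show "\<exists>w\<in>Hs0_edge l s. Hs_norm l s (\<lambda>x. u x - w x) < e"
    using we by (intro bexI[of _ "\<lambda>x. u x - w x"]) simp
qed (use l s in auto)

lemma Hs0_cong_AE:
  assumes "u \<in> Hs0_edge l s" "u' \<in> borel_measurable (edge_measure l)" "AE x in edge_measure l. u' x = u x"
  shows "u' \<in> Hs0_edge l s"
proof -
  have u: "u \<in> L2_edge l" "gagliardo l s u < \<infinity>" using assms(1) by (auto simp: Hs0_edge_def Hs_edge_def)
  have u': "u' \<in> L2_edge l" by (rule L2_edge_cong_AE[OF assms(2) u(1) assms(3)])
  have "Hs_norm l s (\<lambda>x. u' x - \<phi> x) = Hs_norm l s (\<lambda>x. u x - \<phi> x)" if "\<phi> \<in> test_functions l" for \<phi>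
  proof -
    have ae: "AE x in edge_measure l. u' x - \<phi> x = u x - \<phi> x" using assms(3) by eventually_elim simp
    show ?thesis
      unfolding Hs_norm_def gagliardo_cong_AE[OF ae]
      using L2_norm_cong_AE[OF _ _ ae] L2_edge_diff[OF u(1) test_function_L2[OF that]] L2_edge_diff[OF u' test_function_L2[OF that]]
      by simp
  qed
  then show ?thesis
    using assms(1) u' gagliardo_cong_AE[OF assms(3)] by (auto simp: Hs0_edge_def Hs_edge_def)
qed


section \<open>Dyadic averages\<close>

definition dyadic_avg :: "real \<Rightarrow> (real \<Rightarrow> real) \<Rightarrow> nat \<Rightarrow> nat \<Rightarrow> real" where
  "dyadic_avg l h n j = 2 ^ n / l * (LINT t:{node l n j..node l n (Suc j)}|edge_measure l. h t)"

definition gagliardo_on :: "real \<Rightarrow> real \<Rightarrow> (real \<Rightarrow> real) \<Rightarrow> real set \<Rightarrow> real set \<Rightarrow> ennreal" where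
  "gagliardo_on l s u X Y = (\<integral>\<^sup>+z. ennreal (gagliardo_quotient s u z) * indicator (X \<times> Y) z \<partial>edge_pair l)"

lemma sets_edge_Ico: "0 \<le> a \<Longrightarrow> b \<le> l \<Longrightarrow> {a..<b} \<in> sets (edge_measure l)"
  by (auto simp: sets_edge)

text \<open>Half-open cells are disjoint, as needed for rectangles in the product, while averages
  and primitives are written with closed cells; this passes between the two.\<close>

lemma set_integral_Ico_Icc:
  fixes g :: "real \<Rightarrow> real"
  assumes "g \<in> borel_measurable (edge_measure l)" "0 \<le> a" "b \<le> l"
  shows "(LINT t:{a..<b}|edge_measure l. g t) = (LINT t:{a..b}|edge_measure l. g t)"
  unfolding set_lebesgue_integral_def
proof (rule integral_cong_AE)
  have "{a..b} \<in> sets (edge_measure l)" using assms by (auto simp: sets_edge)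
  then show "(\<lambda>t. indicat_real {a..<b} t *\<^sub>R g t) \<in> borel_measurable (edge_measure l)"
    "(\<lambda>t. indicat_real {a..b} t *\<^sub>R g t) \<in> borel_measurable (edge_measure l)"
    using sets_edge_Ico[OF assms(2,3)] assms(1) by simp_all
  show "AE t in edge_measure l. indicat_real {a..<b} t *\<^sub>R g t = indicat_real {a..b} t *\<^sub>R g t"
    using AE_edge_not_in_finite[OF finite.insertI[OF finite.emptyI], of b l]
    by eventually_elim (auto simp: indicator_def)
qed

lemma set_integrable_edge_Ico:
  fixes v :: "real \<Rightarrow> real"
  assumes "integrable (edge_measure l) v" "0 \<le> x" "y \<le> l"
  shows "set_integrable (edge_measure l) {x..<y} v"
  unfolding set_integrable_def using assms
  by (intro integrable_mult_indicator sets_edge_Ico)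

text \<open>
  Jensen's inequality for the difference of the averages over two adjacent cells, without an
  integral over the product: expand the square and use Cauchy-Schwarz in each variable.
\<close>

lemma adjacent_averages_le_gagliardo:
  assumes h: "h \<in> L2_edge l" and d: "0 < d" and a: "0 \<le> a" "a + 2 * d \<le> l" and s: "0 \<le> s"
  shows "ennreal (((LINT t:{a..a + d}|edge_measure l. h t) - (LINT t:{a + d..a + 2 * d}|edge_measure l. h t))\<^sup>2)
     \<le> ennreal ((2 * d) powr (1 + 2 * s)) * gagliardo_on l s h {a..<a + d} {a + d..<a + 2 * d}"
proof -
  let ?M = "edge_measure l" and ?X = "{a..<a + d}" and ?Y = "{a + d..<a + 2 * d}"
  let ?K = "(2 * d) powr (1 + 2 * s)"
  note hm = L2_edge_measurable[OF h]
  note ih = L2_edge_integrable[OF h] and ih2 = L2_edge_square[OF h]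
  have X: "?X \<in> sets ?M" "?Y \<in> sets ?M" using a d by (auto intro!: sets_edge_Ico)
  define A where "A = (LINT t:{a..a + d}|?M. h t)"
  define B where "B = (LINT t:{a + d..a + 2 * d}|?M. h t)"
  define A2 where "A2 = (LINT t:{a..a + d}|?M. (h t)\<^sup>2)"
  define B2 where "B2 = (LINT t:{a + d..a + 2 * d}|?M. (h t)\<^sup>2)"
  have CS: "A\<^sup>2 \<le> d * A2" "B\<^sup>2 \<le> d * B2"
    using set_integral_edge_Cauchy_Schwarz[OF h, of a "a + d"] set_integral_edge_Cauchy_Schwarz[OF h, of "a + d" "a + 2 * d"] a d
    by (simp_all add: A_def B_def A2_def B2_def)
  have onem: "(\<lambda>t. 1 :: real) \<in> borel_measurable ?M" by simp
  have hm2: "(\<lambda>t. (h t)\<^sup>2) \<in> borel_measurable ?M" using hm by simp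
  have Y1: "(LINT t:?Y|?M. 1) = d" "(LINT t:?Y|?M. h t) = B" "(LINT t:?Y|?M. (h t)\<^sup>2) = B2"
    using set_integral_Ico_Icc[OF onem, of "a + d" "a + 2 * d"] set_integral_Ico_Icc[OF hm, of "a + d" "a + 2 * d"]
      set_integral_Ico_Icc[OF hm2, of "a + d" "a + 2 * d"] set_integral_edge_const[of "a + d" "a + 2 * d" l 1] a d
    by (simp_all add: B_def B2_def)
  have X1: "(LINT t:?X|?M. 1) = d" "(LINT t:?X|?M. h t) = A" "(LINT t:?X|?M. (h t)\<^sup>2) = A2"
    using set_integral_Ico_Icc[OF onem, of a "a + d"] set_integral_Ico_Icc[OF hm, of a "a + d"]
      set_integral_Ico_Icc[OF hm2, of a "a + d"] set_integral_edge_const[of a "a + d" l 1] a d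
    by (simp_all add: A_def A2_def)
  have iX: "set_integrable ?M ?X (\<lambda>t. 1 :: real)" "set_integrable ?M ?X h" "set_integrable ?M ?X (\<lambda>t. (h t)\<^sup>2)"
    and iY: "set_integrable ?M ?Y (\<lambda>t. 1 :: real)" "set_integrable ?M ?Y h" "set_integrable ?M ?Y (\<lambda>t. (h t)\<^sup>2)"
    using a d ih ih2 L2_edge_integrable[OF L2_edge_const] by (auto intro!: set_integrable_edge_Ico)
  have inner: "(\<integral>\<^sup>+y. ennreal ((h x - h y)\<^sup>2) * indicator ?Y y \<partial>?M) = ennreal (d * (h x)\<^sup>2 - 2 * B * h x + B2)" for x
  proof -
    have e: "(h x - h y)\<^sup>2 = (h x)\<^sup>2 * 1 + ((- 2 * h x) * h y + (h y)\<^sup>2)" for y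
      by (simp add: power2_eq_square algebra_simps)
    have i: "set_integrable ?M ?Y (\<lambda>y. (h x - h y)\<^sup>2)"
      unfolding e by (intro set_integral_add(1) set_integrable_mult_right iY)
    have v: "(LINT y:?Y|?M. (h x - h y)\<^sup>2) = (h x)\<^sup>2 * d + ((- 2 * h x) * B + B2)"
      unfolding e by (subst set_integral_add(2), intro set_integrable_mult_right iY, intro set_integral_add(1) set_integrable_mult_right iY,
        subst set_integral_add(2), intro set_integrable_mult_right iY, rule iY, simp only: set_integral_mult_right Y1)
    have "(\<integral>\<^sup>+y. ennreal ((h x - h y)\<^sup>2) * indicator ?Y y \<partial>?M) = (\<integral>\<^sup>+y. ennreal (indicator ?Y y *\<^sub>R (h x - h y)\<^sup>2) \<partial>?M)"
      by (intro nn_integral_cong) (auto simp: indicator_def)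
    also have "\<dots> = ennreal (LINT y:?Y|?M. (h x - h y)\<^sup>2)"
      unfolding set_lebesgue_integral_def
      by (rule nn_integral_eq_integral) (use i in \<open>auto simp: set_integrable_def\<close>)
    finally show ?thesis unfolding v by (simp add: algebra_simps)
  qed
  \<comment> \<open>\<open>ennreal\<close> truncates negative numbers, so the value of the inner
    integral has to be seen to be nonnegative: multiply by d and complete the square, using
    Cauchy-Schwarz for B.\<close>
  have nnin: "0 \<le> d * (h x)\<^sup>2 - 2 * B * h x + B2" for x
  proof -
    have "0 \<le> (d * h x - B)\<^sup>2" by simp
    also have "\<dots> \<le> d * (d * (h x)\<^sup>2 - 2 * B * h x + B2)" using CS(2) by (simp add: power2_eq_square algebra_simps)
    finally show ?thesis using d by (simp add: zero_le_mult_iff)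
  qed
  have outer: "(\<integral>\<^sup>+x. ennreal (d * (h x)\<^sup>2 - 2 * B * h x + B2) * indicator ?X x \<partial>?M) = ennreal (d * A2 - 2 * B * A + B2 * d)"
  proof -
    have e: "d * (h x)\<^sup>2 - 2 * B * h x + B2 = d * (h x)\<^sup>2 + ((- 2 * B) * h x + B2 * 1)" for x
      by simp
    have i: "set_integrable ?M ?X (\<lambda>x. d * (h x)\<^sup>2 - 2 * B * h x + B2)"
      unfolding e by (intro set_integral_add(1) set_integrable_mult_right iX)
    have v: "(LINT x:?X|?M. d * (h x)\<^sup>2 - 2 * B * h x + B2) = d * A2 + ((- 2 * B) * A + B2 * d)"
      unfolding e by (subst set_integral_add(2), intro set_integrable_mult_right iX, intro set_integral_add(1) set_integrable_mult_right iX,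
        subst set_integral_add(2), intro set_integrable_mult_right iX, intro set_integrable_mult_right iX, simp only: set_integral_mult_right X1)
    have "(\<integral>\<^sup>+x. ennreal (d * (h x)\<^sup>2 - 2 * B * h x + B2) * indicator ?X x \<partial>?M)
        = (\<integral>\<^sup>+x. ennreal (indicator ?X x *\<^sub>R (d * (h x)\<^sup>2 - 2 * B * h x + B2)) \<partial>?M)"
      by (intro nn_integral_cong) (auto simp: indicator_def)
    also have "\<dots> = ennreal (LINT x:?X|?M. d * (h x)\<^sup>2 - 2 * B * h x + B2)"
      unfolding set_lebesgue_integral_def
      by (rule nn_integral_eq_integral) (use i nnin in \<open>auto simp: set_integrable_def intro!: AE_I2\<close>)
    finally show ?thesis unfolding v by (simp add: algebra_simps)
  qed
  have qm: "(\<lambda>z. ennreal (gagliardo_quotient s h z)) \<in> borel_measurable (edge_pair l)"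
    by (rule measurable_compose[OF measurable_gagliardo_quotient[OF hm] measurable_ennreal])
  have XY: "?X \<times> ?Y \<in> sets (edge_pair l)" by (rule pair_measureI[OF X])
  have "ennreal ((A - B)\<^sup>2) \<le> ennreal (d * A2 - 2 * B * A + B2 * d)"
    using CS by (intro ennreal_leI) (simp add: power2_eq_square algebra_simps)
  also have "\<dots> = (\<integral>\<^sup>+x. \<integral>\<^sup>+y. ennreal ((h x - h y)\<^sup>2) * indicator (?X \<times> ?Y) (x, y) \<partial>?M \<partial>?M)"
    unfolding outer[symmetric] inner[symmetric]
  proof (rule nn_integral_cong)
    fix x
    show "(\<integral>\<^sup>+y. ennreal ((h x - h y)\<^sup>2) * indicator ?Y y \<partial>?M) * indicator ?X x
       = (\<integral>\<^sup>+y. ennreal ((h x - h y)\<^sup>2) * indicator (?X \<times> ?Y) (x, y) \<partial>?M)"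
      by (cases "x \<in> ?X") (auto intro!: nn_integral_cong simp: indicator_def)
  qed
  also have "\<dots> \<le> (\<integral>\<^sup>+x. \<integral>\<^sup>+y. ennreal ?K * (ennreal (gagliardo_quotient s h (x, y)) * indicator (?X \<times> ?Y) (x, y)) \<partial>?M \<partial>?M)"
  proof (intro nn_integral_mono)
    fix x y
    show "ennreal ((h x - h y)\<^sup>2) * indicator (?X \<times> ?Y) (x, y)
        \<le> ennreal ?K * (ennreal (gagliardo_quotient s h (x, y)) * indicator (?X \<times> ?Y) (x, y))"
    proof (cases "(x, y) \<in> ?X \<times> ?Y")
      case True
      \<comment> \<open>The half-open cells force x < y, so the power of |x - y| may be cancelled
        against the quotient.\<close>
      then have xy: "0 < \<bar>x - y\<bar>" "\<bar>x - y\<bar> \<le> 2 * d" by auto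
      have "(h x - h y)\<^sup>2 = \<bar>x - y\<bar> powr (1 + 2 * s) * gagliardo_quotient s h (x, y)"
        using xy by (simp add: gagliardo_quotient_def)
      also have "\<dots> \<le> ?K * gagliardo_quotient s h (x, y)"
        using xy s by (intro mult_right_mono powr_mono2) auto
      finally have "ennreal ((h x - h y)\<^sup>2) \<le> ennreal (?K * gagliardo_quotient s h (x, y))" by (rule ennreal_leI)
      then show ?thesis using True by (simp add: ennreal_mult)
    qed simp
  qed
  also have "\<dots> = (\<integral>\<^sup>+z. ennreal ?K * (ennreal (gagliardo_quotient s h z) * indicator (?X \<times> ?Y) z) \<partial>edge_pair l)"
    using qm XY by (intro sigma_finite_measure.nn_integral_fst[OF sigma_finite_edge]) simp
  also have "\<dots> = ennreal ?K * gagliardo_on l s h ?X ?Y"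
    unfolding gagliardo_on_def using qm XY by (intro nn_integral_cmult) simp
  finally show ?thesis by (simp add: A_def B_def)
qed

text \<open>The two diagonal subsquares and one off-diagonal rectangle are disjoint in the square;
  the mirror image of the rectangle is given away.\<close>

lemma gagliardo_on_split:
  assumes u: "u \<in> borel_measurable (edge_measure l)" and "0 \<le> a" "a \<le> m" "m \<le> b" "b \<le> l"
  shows "gagliardo_on l s u {a..<m} {a..<m} + gagliardo_on l s u {m..<b} {m..<b} + gagliardo_on l s u {a..<m} {m..<b}
    \<le> gagliardo_on l s u {a..<b} {a..<b}"
proof -
  have qm [measurable]: "(\<lambda>z. ennreal (gagliardo_quotient s u z)) \<in> borel_measurable (edge_pair l)"
    by (rule measurable_compose[OF measurable_gagliardo_quotient[OF u] measurable_ennreal])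
  have X: "{a..<m} \<in> sets (edge_measure l)" "{m..<b} \<in> sets (edge_measure l)"
    using assms by (auto intro!: sets_edge_Ico)
  have [measurable]: "{a..<m} \<times> {a..<m} \<in> sets (edge_pair l)" "{m..<b} \<times> {m..<b} \<in> sets (edge_pair l)"
    "{a..<m} \<times> {m..<b} \<in> sets (edge_pair l)" using X by auto
  have "gagliardo_on l s u {a..<m} {a..<m} + gagliardo_on l s u {m..<b} {m..<b} + gagliardo_on l s u {a..<m} {m..<b}
    = (\<integral>\<^sup>+z. ennreal (gagliardo_quotient s u z) * indicator ({a..<m} \<times> {a..<m}) z
         + ennreal (gagliardo_quotient s u z) * indicator ({m..<b} \<times> {m..<b}) z
         + ennreal (gagliardo_quotient s u z) * indicator ({a..<m} \<times> {m..<b}) z \<partial>edge_pair l)"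
    unfolding gagliardo_on_def by (simp add: nn_integral_add)
  also have "\<dots> \<le> gagliardo_on l s u {a..<b} {a..<b}"
    unfolding gagliardo_on_def using assms(3,4) by (intro nn_integral_mono) (auto simp: indicator_def)
  finally show ?thesis .
qed

lemma gagliardo_on_le:
  assumes "u \<in> borel_measurable (edge_measure l)"
  shows "gagliardo_on l s u X Y \<le> gagliardo l s u"
  unfolding gagliardo_on_def gagliardo_pair[OF assms]
  by (intro nn_integral_mono) (auto simp: indicator_def)

text \<open>Up to scaling these are the squared Haar coefficients of h at level n.\<close>

definition avg_jumps :: "real \<Rightarrow> (real \<Rightarrow> real) \<Rightarrow> nat \<Rightarrow> real" where
  "avg_jumps l h n = (\<Sum>j<2 ^ n. (dyadic_avg l h (Suc n) (2 * j) - dyadic_avg l h (Suc n) (Suc (2 * j)))\<^sup>2)"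

lemma sum_even_odd: "(\<Sum>i<2 * n. g i) = (\<Sum>j<n. g (2 * j) + g (Suc (2 * j)))" for g :: "nat \<Rightarrow> 'a :: comm_monoid_add"
  by (induction n) (simp_all add: add.assoc)

text \<open>
  A pair \<open>x < y\<close> is separated at exactly one level of the dyadic tree, so the cells
  left half times right half are disjoint over all levels and one copy of the
  seminorm suffices.
\<close>

lemma sum_avg_jumps_le:
  assumes l: "0 < l" and s: "0 \<le> s" and h: "h \<in> L2_edge l" and fin: "gagliardo l s h < \<infinity>"
  defines "\<mu> \<equiv> 2 powr (1 - 2 * s)"
  shows "(\<Sum>n<N. (1 / \<mu>) ^ n * avg_jumps l h n) \<le> 4 * l powr (2 * s - 1) * enn2real (gagliardo l s h)"
proof -
  note hm = L2_edge_measurable[OF h]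
  define C where "C = 4 * l powr (2 * s - 1)"
  have C: "C \<ge> 0" by (simp add: C_def)
  have \<mu>: "\<mu> > 0" by (simp add: \<mu>_def)
  let ?I = "\<lambda>n j. {node l n j..<node l n (Suc j)}"
  \<comment> \<open>\<open>T n\<close> is the part of the seminorm from pairs in a common cell of
    level n; \<open>R n\<close> is the part from pairs in a common cell of level n that the next
    bisection separates.\<close>
  define T where "T n = (\<Sum>j<2 ^ n. gagliardo_on l s h (?I n j) (?I n j))" for n
  define R where "R n = (\<Sum>j<2 ^ n. gagliardo_on l s h (?I (Suc n) (2 * j)) (?I (Suc n) (Suc (2 * j))))" for n
  have nd: "node l (Suc n) (Suc (Suc (2 * j))) = node l n (Suc j)" for n j
    using node_refine[of l n "Suc j"] by simp
  have step: "T (Suc n) + R n \<le> T n" for n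
  proof -
    have "T (Suc n) + R n = (\<Sum>j<2 ^ n. gagliardo_on l s h (?I (Suc n) (2 * j)) (?I (Suc n) (2 * j))
        + gagliardo_on l s h (?I (Suc n) (Suc (2 * j))) (?I (Suc n) (Suc (2 * j)))
        + gagliardo_on l s h (?I (Suc n) (2 * j)) (?I (Suc n) (Suc (2 * j))))"
      unfolding T_def R_def by (simp only: power_Suc sum_even_odd sum.distrib)
    also have "\<dots> \<le> T n"
      unfolding T_def
    proof (rule sum_mono)
      fix j assume "j \<in> {..<2 ^ n :: nat}"
      then have j: "Suc j \<le> 2 ^ n" by auto
      show "gagliardo_on l s h (?I (Suc n) (2 * j)) (?I (Suc n) (2 * j))
        + gagliardo_on l s h (?I (Suc n) (Suc (2 * j))) (?I (Suc n) (Suc (2 * j)))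
        + gagliardo_on l s h (?I (Suc n) (2 * j)) (?I (Suc n) (Suc (2 * j)))
        \<le> gagliardo_on l s h (?I n j) (?I n j)"
        unfolding nd unfolding node_refine
        using node_bounds[OF less_imp_le[OF l], of j n] node_bounds[OF less_imp_le[OF l] j] j
          node_mono[OF less_imp_le[OF l], of "2 * j" "Suc (2 * j)" "Suc n"]
          node_mono[OF less_imp_le[OF l], of "Suc (2 * j)" "Suc (Suc (2 * j))" "Suc n"]
        by (intro gagliardo_on_split hm) (auto simp: nd node_refine)
    qed
    finally show ?thesis .
  qed
  have "T N + (\<Sum>n<N. R n) \<le> T 0" for N
  proof (induction N)
    case (Suc N)
    have "T (Suc N) + (\<Sum>n<Suc N. R n) = (T (Suc N) + R N) + (\<Sum>n<N. R n)" by (simp add: ac_simps)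
    also have "\<dots> \<le> T N + (\<Sum>n<N. R n)" by (intro add_right_mono step)
    finally show ?case using Suc by (rule order_trans)
  qed simp
  note T0 = this
  have "(\<Sum>n<N. R n) \<le> T N + (\<Sum>n<N. R n)" by (rule add_increasing) simp_all
  also have "\<dots> \<le> T 0" by (rule T0)
  also have "\<dots> \<le> gagliardo l s h" unfolding T_def using gagliardo_on_le[OF hm] by simp
  finally have sumR: "(\<Sum>n<N. R n) \<le> gagliardo l s h" .
  have cell: "ennreal ((1 / \<mu>) ^ n * (dyadic_avg l h (Suc n) (2 * j) - dyadic_avg l h (Suc n) (Suc (2 * j)))\<^sup>2)
      \<le> ennreal C * gagliardo_on l s h (?I (Suc n) (2 * j)) (?I (Suc n) (Suc (2 * j)))" if "j < 2 ^ n" for n j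
  proof -
    define d where "d = l / 2 ^ Suc n"
    have d: "d > 0" using l by (simp add: d_def)
    define a where "a = node l n j"
    have a2: "node l (Suc n) (2 * j) = a" "node l (Suc n) (Suc (2 * j)) = a + d" "node l (Suc n) (Suc (Suc (2 * j))) = a + 2 * d"
      unfolding a_def d_def by (simp_all add: node_def field_simps)
    have ad: "a + 2 * d = node l n (Suc j)" using a2(3) nd by simp
    have ab: "0 \<le> a" "a + 2 * d \<le> l"
      using node_bounds[OF less_imp_le[OF l], of j n] node_bounds[OF less_imp_le[OF l], of "Suc j" n] that
      unfolding ad by (simp_all add: a_def)
    let ?D = "(LINT t:{a..a + d}|edge_measure l. h t) - (LINT t:{a + d..a + 2 * d}|edge_measure l. h t)"
    have av: "dyadic_avg l h (Suc n) (2 * j) - dyadic_avg l h (Suc n) (Suc (2 * j)) = ?D / d"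
    proof -
      have "2 ^ Suc n / l = 1 / d" by (simp add: d_def)
      then show ?thesis unfolding dyadic_avg_def a2 by (simp only: diff_divide_distrib times_divide_eq_left mult_1)
    qed
    \<comment> \<open>Since 2d = l / 2^n, the power (2d)^(1 + 2s) is 4 d^2 times l^(2s - 1) times
      \<open>\<mu> ^ n\<close>. The weight is thus exactly the one that removes n from the
      constant.\<close>
    have c: "(1 / \<mu>) ^ n * (1 / d\<^sup>2) * (2 * d) powr (1 + 2 * s) = C"
    proof -
      have e: "2 * d = l * (1 / 2) ^ n" by (simp add: d_def power_divide)
      have "(2 * d) powr (1 + 2 * s) = (2 * d) powr (2 + (2 * s - 1))" by simp
      also have "\<dots> = (2 * d) powr 2 * (2 * d) powr (2 * s - 1)" by (rule powr_add)
      also have "(2 * d) powr 2 = 4 * d\<^sup>2" using d powr_realpow[of "2 * d" 2] by (simp add: power_mult_distrib)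
      also have "(2 * d) powr (2 * s - 1) = l powr (2 * s - 1) * ((1 / 2) ^ n) powr (2 * s - 1)"
        unfolding e using l by (intro powr_mult)
      also have "((1 / 2 :: real) ^ n) powr (2 * s - 1) = \<mu> ^ n"
      proof -
        have "((1 / 2 :: real) ^ n) = 2 powr (- real n)"
          by (simp add: powr_minus_divide powr_realpow power_divide)
        then have "((1 / 2 :: real) ^ n) powr (2 * s - 1) = 2 powr (- real n * (2 * s - 1))"
          by (simp only: powr_powr)
        also have "- real n * (2 * s - 1) = (1 - 2 * s) * real n" by (simp add: algebra_simps)
        also have "2 powr ((1 - 2 * s) * real n) = \<mu> ^ n"
          unfolding \<mu>_def by (subst powr_realpow[symmetric]) (simp_all only: powr_powr, simp)
        finally show ?thesis .
      qed
      finally have "(2 * d) powr (1 + 2 * s) = 4 * d\<^sup>2 * (l powr (2 * s - 1) * \<mu> ^ n)" .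
      then show ?thesis using \<mu> d by (simp add: C_def power_one_over)
    qed
    have "ennreal ((1 / \<mu>) ^ n * (?D / d)\<^sup>2) = ennreal ((1 / \<mu>) ^ n * (1 / d\<^sup>2)) * ennreal (?D\<^sup>2)"
      using \<mu> by (subst ennreal_mult[symmetric]) (auto simp: power_divide)
    also have "\<dots> \<le> ennreal ((1 / \<mu>) ^ n * (1 / d\<^sup>2)) * (ennreal ((2 * d) powr (1 + 2 * s)) * gagliardo_on l s h {a..<a + d} {a + d..<a + 2 * d})"
      by (intro mult_left_mono adjacent_averages_le_gagliardo h d ab s) simp
    also have "\<dots> = (ennreal ((1 / \<mu>) ^ n * (1 / d\<^sup>2)) * ennreal ((2 * d) powr (1 + 2 * s))) * gagliardo_on l s h {a..<a + d} {a + d..<a + 2 * d}"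
      by (simp only: mult.assoc)
    also have "ennreal ((1 / \<mu>) ^ n * (1 / d\<^sup>2)) * ennreal ((2 * d) powr (1 + 2 * s)) = ennreal C"
      unfolding c[symmetric] using \<mu> by (intro ennreal_mult[symmetric]) auto
    finally show ?thesis unfolding av a2 .
  qed
  have "ennreal (\<Sum>n<N. (1 / \<mu>) ^ n * avg_jumps l h n)
      = (\<Sum>n<N. \<Sum>j<2 ^ n. ennreal ((1 / \<mu>) ^ n * (dyadic_avg l h (Suc n) (2 * j) - dyadic_avg l h (Suc n) (Suc (2 * j)))\<^sup>2))"
  proof -
    define G where "G n j = (1 / \<mu>) ^ n * (dyadic_avg l h (Suc n) (2 * j) - dyadic_avg l h (Suc n) (Suc (2 * j)))\<^sup>2" for n j
    have "0 \<le> G n j" for n j using \<mu> by (simp add: G_def)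
    then have "ennreal (\<Sum>n<N. \<Sum>j<2 ^ n. G n j) = (\<Sum>n<N. \<Sum>j<2 ^ n. ennreal (G n j))"
      by (simp add: sum_ennreal sum_nonneg)
    then show ?thesis unfolding avg_jumps_def sum_distrib_left G_def .
  qed
  also have "\<dots> \<le> (\<Sum>n<N. ennreal C * R n)"
    unfolding R_def sum_distrib_left by (intro sum_mono cell) simp
  also have "\<dots> = ennreal C * (\<Sum>n<N. R n)" by (simp add: sum_distrib_left)
  also have "\<dots> \<le> ennreal C * gagliardo l s h" by (intro mult_left_mono sumR) simp
  also have "\<dots> = ennreal (C * enn2real (gagliardo l s h))" using fin C by (simp add: ennreal_mult)
  finally have "ennreal (\<Sum>n<N. (1 / \<mu>) ^ n * avg_jumps l h n) \<le> ennreal (C * enn2real (gagliardo l s h))" .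
  moreover have "0 \<le> C * enn2real (gagliardo l s h)" using C by simp
  ultimately show ?thesis unfolding C_def[symmetric] by (simp only: ennreal_le_iff)
qed

section \<open>The distributional derivative of a continuous function on dyadic averages\<close>

text \<open>This is the integral of h against the derivative of the piecewise linear interpolant of
  f on the partition of level n.\<close>

definition dyadic_form :: "real \<Rightarrow> (real \<Rightarrow> real) \<Rightarrow> (real \<Rightarrow> real) \<Rightarrow> nat \<Rightarrow> real" where
  "dyadic_form l f h n = (\<Sum>j<2 ^ n. (f (node l n (Suc j)) - f (node l n j)) * dyadic_avg l h n j)"

text \<open>Twice the Faber-Schauder coefficient of f on the cell j: its deviation at the midpoint
  from linear interpolation.\<close>

definition second_diff :: "real \<Rightarrow> (real \<Rightarrow> real) \<Rightarrow> nat \<Rightarrow> nat \<Rightarrow> real" where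
  "second_diff l f n j = 2 * f (node l (Suc n) (Suc (2 * j))) - f (node l n j) - f (node l n (Suc j))"

lemma dyadic_avg_refine:
  assumes "0 < l" "h \<in> L2_edge l" "j < 2 ^ n"
  shows "dyadic_avg l h n j = (dyadic_avg l h (Suc n) (2 * j) + dyadic_avg l h (Suc n) (Suc (2 * j))) / 2"
proof -
  have nd: "node l (Suc n) (Suc (Suc (2 * j))) = node l n (Suc j)"
    using node_refine[of l n "Suc j"] by simp
  have "(LINT t:{node l n j..node l n (Suc j)}|edge_measure l. h t)
    = (LINT t:{node l n j..node l (Suc n) (Suc (2 * j))}|edge_measure l. h t)
      + (LINT t:{node l (Suc n) (Suc (2 * j))..node l n (Suc j)}|edge_measure l. h t)"
  proof (rule set_integral_edge_combine[OF L2_edge_integrable[OF assms(2)]])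
    show "0 \<le> node l n j" "node l n (Suc j) \<le> l" using node_bounds[OF less_imp_le[OF assms(1)]] assms(3) by auto
    show "node l n j \<le> node l (Suc n) (Suc (2 * j))" "node l (Suc n) (Suc (2 * j)) \<le> node l n (Suc j)"
      using node_mono[OF less_imp_le[OF assms(1)], of "2 * j" "Suc (2 * j)" "Suc n"]
        node_mono[OF less_imp_le[OF assms(1)], of "Suc (2 * j)" "Suc (Suc (2 * j))" "Suc n"]
      by (auto simp: nd node_refine)
  qed
  then show ?thesis unfolding dyadic_avg_def nd node_refine by (simp add: algebra_simps)
qed

text \<open>Writing the average over a cell as the mean of the averages over its halves, the part
  common to both halves cancels and the difference of the two averages remains.\<close>

lemma dyadic_form_Suc:
  assumes "0 < l" "h \<in> L2_edge l"
  shows "dyadic_form l f h (Suc n) - dyadic_form l f h n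
    = (\<Sum>j<2 ^ n. second_diff l f n j * (dyadic_avg l h (Suc n) (2 * j) - dyadic_avg l h (Suc n) (Suc (2 * j))) / 2)"
proof -
  have nd: "node l (Suc n) (Suc (Suc (2 * j))) = node l n (Suc j)" for j
    using node_refine[of l n "Suc j"] by simp
  have "dyadic_form l f h (Suc n) - dyadic_form l f h n
    = (\<Sum>j<2 ^ n. (f (node l (Suc n) (Suc (2 * j))) - f (node l n j)) * dyadic_avg l h (Suc n) (2 * j)
       + (f (node l n (Suc j)) - f (node l (Suc n) (Suc (2 * j)))) * dyadic_avg l h (Suc n) (Suc (2 * j))
       - (f (node l n (Suc j)) - f (node l n j)) * dyadic_avg l h n j)"
    unfolding dyadic_form_def power_Suc sum_even_odd nd node_refine by (simp add: sum_subtractf)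
  also have "\<dots> = (\<Sum>j<2 ^ n. second_diff l f n j * (dyadic_avg l h (Suc n) (2 * j) - dyadic_avg l h (Suc n) (Suc (2 * j))) / 2)"
  proof (rule sum.cong[OF refl])
    fix j assume "j \<in> {..<2 ^ n :: nat}"
    then have j: "j < 2 ^ n" by simp
    show "(f (node l (Suc n) (Suc (2 * j))) - f (node l n j)) * dyadic_avg l h (Suc n) (2 * j)
       + (f (node l n (Suc j)) - f (node l (Suc n) (Suc (2 * j)))) * dyadic_avg l h (Suc n) (Suc (2 * j))
       - (f (node l n (Suc j)) - f (node l n j)) * dyadic_avg l h n j
      = second_diff l f n j * (dyadic_avg l h (Suc n) (2 * j) - dyadic_avg l h (Suc n) (Suc (2 * j))) / 2"
      unfolding dyadic_avg_refine[OF assms j] second_diff_def by (simp add: field_simps)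
  qed
  finally show ?thesis .
qed

lemma dyadic_form_cong_AE:
  assumes "h \<in> L2_edge l" "h' \<in> L2_edge l" "AE x in edge_measure l. h x = h' x" "0 \<le> l"
  shows "dyadic_form l f h n = dyadic_form l f h' n"
  unfolding dyadic_form_def
proof (rule sum.cong[OF refl])
  fix j assume "j \<in> {..<2 ^ n :: nat}"
  then have "{node l n j..node l n (Suc j)} \<in> sets (edge_measure l)"
    using node_bounds[OF assms(4), of j n] node_bounds[OF assms(4), of "Suc j" n] by (auto simp: sets_edge)
  then have "(LINT t:{node l n j..node l n (Suc j)}|edge_measure l. h t) = (LINT t:{node l n j..node l n (Suc j)}|edge_measure l. h' t)"
    unfolding set_lebesgue_integral_def
    by (intro integral_cong_AE) (use assms in \<open>auto simp: L2_edge_def\<close>)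
  then show "(f (node l n (Suc j)) - f (node l n j)) * dyadic_avg l h n j = (f (node l n (Suc j)) - f (node l n j)) * dyadic_avg l h' n j"
    by (simp add: dyadic_avg_def)
qed

lemma dyadic_form_lin:
  assumes "u \<in> L2_edge l" "v \<in> L2_edge l" "0 \<le> l"
  shows "dyadic_form l f (\<lambda>x. a * u x + b * v x) n = a * dyadic_form l f u n + b * dyadic_form l f v n"
proof -
  have "dyadic_avg l (\<lambda>x. a * u x + b * v x) n j = a * dyadic_avg l u n j + b * dyadic_avg l v n j" if "j < 2 ^ n" for j
  proof -
    have b: "0 \<le> node l n j" "node l n (Suc j) \<le> l"
      using node_bounds[OF assms(3), of j n] node_bounds[OF assms(3), of "Suc j" n] that by auto
    show ?thesis
      unfolding dyadic_avg_def
      using set_integrable_edge[OF L2_edge_integrable[OF assms(1)] b] set_integrable_edge[OF L2_edge_integrable[OF assms(2)] b]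
      by (simp add: set_integral_add algebra_simps)
  qed
  then have "dyadic_form l f (\<lambda>x. a * u x + b * v x) n
     = (\<Sum>j<2 ^ n. a * ((f (node l n (Suc j)) - f (node l n j)) * dyadic_avg l u n j) + b * ((f (node l n (Suc j)) - f (node l n j)) * dyadic_avg l v n j))"
    unfolding dyadic_form_def by (intro sum.cong) (auto simp: algebra_simps)
  then show ?thesis by (simp add: dyadic_form_def sum.distrib sum_distrib_left)
qed

text \<open>First each average of h is replaced by the value at the left end; the error is at most
  the oscillation of f times the variation of h over the cell. Abel summation then moves the
  differences from f to h, leaving the boundary term minus a Riemann-Stieltjes sum.\<close>

lemma dyadic_form_primitive:
  assumes l: "0 < l" and h: "primitive l h k" and f: "continuous_on {0..l} f"
  shows "dyadic_form l f h \<longlonglongrightarrow> f l * h l - f 0 * h 0 - L2_inner l f k"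
proof -
  note l0 = less_imp_le[OF l]
  let ?x = "node l"
  have tag: "?x n (Suc j) \<in> {?x n j..?x n (Suc j)}" for n j
    using node_mono[OF l0, of j "Suc j" n] by auto
  have RS: "(\<lambda>n. \<Sum>j<2 ^ n. f (?x n (Suc j)) * (h (?x n (Suc j)) - h (?x n j))) \<longlonglongrightarrow> L2_inner l f k"
    by (rule Riemann_Stieltjes_tendsto[OF l0 h f tag])
  have Abel: "(\<Sum>j<2 ^ n. (f (?x n (Suc j)) - f (?x n j)) * h (?x n j))
      = f l * h l - f 0 * h 0 - (\<Sum>j<2 ^ n. f (?x n (Suc j)) * (h (?x n (Suc j)) - h (?x n j)))" for n
  proof -
    have "(\<Sum>j<2 ^ n. (f (?x n (Suc j)) - f (?x n j)) * h (?x n j)) + (\<Sum>j<2 ^ n. f (?x n (Suc j)) * (h (?x n (Suc j)) - h (?x n j)))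
      = (\<Sum>j<2 ^ n. f (?x n (Suc j)) * h (?x n (Suc j)) - f (?x n j) * h (?x n j))"
      unfolding sum.distrib[symmetric] by (simp add: algebra_simps)
    also have "\<dots> = f l * h l - f 0 * h 0"
      using sum_lessThan_telescope[of "\<lambda>j. f (?x n j) * h (?x n j)" "2 ^ n"] by simp
    finally show ?thesis by simp
  qed
  have "(\<lambda>n. dyadic_form l f h n - (\<Sum>j<2 ^ n. (f (?x n (Suc j)) - f (?x n j)) * h (?x n j))) \<longlonglongrightarrow> 0"
  proof (rule LIMSEQ_I)
    fix r :: real assume "r > 0"
    define C where "C = (\<integral>t. \<bar>k t\<bar> \<partial>edge_measure l)"
    have C: "C \<ge> 0" by (simp add: C_def)
    define e where "e = r / (C + 1)"
    have e: "e > 0" "e * (C + 1) = r" using C \<open>r > 0\<close> by (simp_all add: e_def)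
    obtain N where N: "\<And>n j x y. n \<ge> N \<Longrightarrow> j < 2 ^ n \<Longrightarrow> x \<in> {?x n j..?x n (Suc j)} \<Longrightarrow>
        y \<in> {?x n j..?x n (Suc j)} \<Longrightarrow> \<bar>f x - f y\<bar> \<le> e"
      using uniform_oscillation[OF l0 f e(1)] by blast
    note ik = integrable_abs[OF primitiveD(2)[OF h]]
    have hc: "continuous_on {0..l} h" by (rule primitive_continuous_on[OF h])
    note hL = primitive_L2[OF h]
    show "\<exists>N. \<forall>n\<ge>N. norm (dyadic_form l f h n - (\<Sum>j<2 ^ n. (f (?x n (Suc j)) - f (?x n j)) * h (?x n j)) - 0) < r"
    proof (intro exI allI impI)
      fix n assume n: "n \<ge> N"
      let ?I = "\<lambda>j. {?x n j..?x n (Suc j)}"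
      have "\<bar>dyadic_form l f h n - (\<Sum>j<2 ^ n. (f (?x n (Suc j)) - f (?x n j)) * h (?x n j))\<bar>
         = \<bar>\<Sum>j<2 ^ n. (f (?x n (Suc j)) - f (?x n j)) * (dyadic_avg l h n j - h (?x n j))\<bar>"
        unfolding dyadic_form_def by (simp add: sum_subtractf[symmetric] right_diff_distrib)
      also have "\<dots> \<le> (\<Sum>j<2 ^ n. \<bar>(f (?x n (Suc j)) - f (?x n j)) * (dyadic_avg l h n j - h (?x n j))\<bar>)"
        by (rule sum_abs)
      also have "\<dots> \<le> (\<Sum>j<2 ^ n. e * (LINT t:?I j|edge_measure l. \<bar>k t\<bar>))"
      proof (rule sum_mono)
        fix j assume "j \<in> {..<2 ^ n :: nat}"
        then have j: "j < 2 ^ n" by simp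
        define K where "K = (LINT t:?I j|edge_measure l. \<bar>k t\<bar>)"
        have b: "0 \<le> ?x n j" "?x n j \<le> ?x n (Suc j)" "?x n (Suc j) \<le> l"
          using node_bounds[OF l0] node_mono[OF l0] j by auto
        have d: "?x n (Suc j) - ?x n j = l / 2 ^ n" by (rule node_Suc_diff)
        have osc: "\<bar>h t - h (?x n j)\<bar> \<le> K" if "t \<in> ?I j" for t
        proof -
          have "h t - h (?x n j) = (LINT t:{?x n j..t}|edge_measure l. k t)"
            using that b by (intro primitiveD(3)[OF h]) auto
          also have "\<bar>\<dots>\<bar> \<le> (LINT t:{?x n j..t}|edge_measure l. \<bar>k t\<bar>)" by (rule set_integral_edge_abs)
          also have "\<dots> \<le> K" unfolding K_def using that b by (intro set_integral_edge_mono_set ik) auto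
          finally show ?thesis .
        qed
        have ih: "set_integrable (edge_measure l) (?I j) h" "set_integrable (edge_measure l) (?I j) (\<lambda>t. h (?x n j))"
          using set_integrable_edge[OF L2_edge_integrable[OF hL] b(1,3)] set_integrable_edge[OF L2_edge_integrable[OF L2_edge_const] b(1,3)]
          by auto
        have "dyadic_avg l h n j - h (?x n j) = 2 ^ n / l * ((LINT t:?I j|edge_measure l. h t) - (LINT t:?I j|edge_measure l. h (?x n j)))"
          unfolding dyadic_avg_def set_integral_edge_const[OF b] d using l by (simp add: field_simps)
        also have "(LINT t:?I j|edge_measure l. h t) - (LINT t:?I j|edge_measure l. h (?x n j)) = (LINT t:?I j|edge_measure l. (h t - h (?x n j)) * 1)"
          using set_integral_diff(2)[OF ih] by simp
        finally have eq: "dyadic_avg l h n j - h (?x n j) = 2 ^ n / l * (LINT t:?I j|edge_measure l. (h t - h (?x n j)) * 1)" .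
        have "\<bar>LINT t:?I j|edge_measure l. (h t - h (?x n j)) * 1\<bar> \<le> K * (LINT t:?I j|edge_measure l. \<bar>1\<bar>)"
          using L2_edge_measurable[OF hL]
          by (intro set_integral_edge_bound(2)[OF L2_edge_integrable[OF L2_edge_const] b] osc) auto
        also have "(LINT t:?I j|edge_measure l. \<bar>1\<bar>) = l / 2 ^ n"
          using set_integral_edge_const[OF b, of 1] d by simp
        finally have "\<bar>dyadic_avg l h n j - h (?x n j)\<bar> \<le> 2 ^ n / l * (K * (l / 2 ^ n))"
          unfolding eq abs_mult using l by (intro mult_mono) auto
        then have 1: "\<bar>dyadic_avg l h n j - h (?x n j)\<bar> \<le> K" using l by simp
        have "\<bar>f (?x n (Suc j)) - f (?x n j)\<bar> \<le> e" using b by (intro N[OF n j]) auto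
        then show "\<bar>(f (?x n (Suc j)) - f (?x n j)) * (dyadic_avg l h n j - h (?x n j))\<bar> \<le> e * (LINT t:?I j|edge_measure l. \<bar>k t\<bar>)"
          unfolding abs_mult K_def[symmetric] using 1 e(1) by (intro mult_mono) auto
      qed
      also have "\<dots> = e * C"
        unfolding sum_distrib_left[symmetric] sum_set_integral_nodes_all[OF l0 ik] C_def ..
      also have "\<dots> < r" using e by (simp add: distrib_left)
      finally show "norm (dyadic_form l f h n - (\<Sum>j<2 ^ n. (f (?x n (Suc j)) - f (?x n j)) * h (?x n j)) - 0) < r" by simp
    qed
  qed
  moreover have "(\<lambda>n. \<Sum>j<2 ^ n. (f (?x n (Suc j)) - f (?x n j)) * h (?x n j)) \<longlonglongrightarrow> f l * h l - f 0 * h 0 - L2_inner l f k"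
    unfolding Abel by (intro tendsto_diff tendsto_const RS)
  ultimately have "(\<lambda>n. (dyadic_form l f h n - (\<Sum>j<2 ^ n. (f (?x n (Suc j)) - f (?x n j)) * h (?x n j)))
     + (\<Sum>j<2 ^ n. (f (?x n (Suc j)) - f (?x n j)) * h (?x n j))) \<longlonglongrightarrow> 0 + (f l * h l - f 0 * h 0 - L2_inner l f k)"
    by (rule tendsto_add)
  then show ?thesis by simp
qed

text \<open>The increments between levels are estimated by Cauchy-Schwarz twice, over the cells of a
  level and over the levels, where \<open>\<mu> ^ n\<close> and \<open>(1 / \<mu>) ^ n\<close>
  cancel. The form at level 0 yields the first summand of the constant, the telescoping series the
  second.\<close>

lemma dyadic_form_bounded:
  assumes l: "0 < l" and s: "0 \<le> s" and h: "h \<in> Hs_edge l s"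
  defines "\<mu> \<equiv> 2 powr (1 - 2 * s)"
  assumes sm: "summable (\<lambda>n. \<mu> ^ n * (\<Sum>j<2 ^ n. (second_diff l f n j)\<^sup>2))"
  defines "S \<equiv> (\<Sum>n. \<mu> ^ n * (\<Sum>j<2 ^ n. (second_diff l f n j)\<^sup>2))"
  shows "convergent (dyadic_form l f h)"
    and "\<bar>lim (dyadic_form l f h)\<bar> \<le> (\<bar>f l - f 0\<bar> * sqrt l / l + sqrt S * sqrt (4 * l powr (2 * s - 1))) * Hs_norm l s h"
proof -
  have hL: "h \<in> L2_edge l" and fin: "gagliardo l s h < \<infinity>" using h by (auto simp: Hs_edge_def)
  have \<mu>: "\<mu> > 0" by (simp add: \<mu>_def)
  define a where "a n = \<mu> ^ n * (\<Sum>j<2 ^ n. (second_diff l f n j)\<^sup>2)" for n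
  define b where "b n = (1 / \<mu>) ^ n * avg_jumps l h n" for n
  define G where "G = 4 * l powr (2 * s - 1) * enn2real (gagliardo l s h)"
  have G: "G \<ge> 0" by (simp add: G_def)
  have a0: "a n \<ge> 0" for n using \<mu> by (simp add: a_def sum_nonneg)
  have b0: "b n \<ge> 0" for n using \<mu> by (simp add: b_def avg_jumps_def sum_nonneg)
  have S: "(\<Sum>n<N. a n) \<le> S" for N unfolding S_def a_def[symmetric]
    using a0 sm by (intro sum_le_suminf) (auto simp: a_def)
  have S0: "S \<ge> 0" using S[of 0] by simp
  have bG: "(\<Sum>n<N. b n) \<le> G" for N
    unfolding b_def G_def \<mu>_def by (rule sum_avg_jumps_le[OF l s hL fin])
  define D where "D n = dyadic_form l f h (Suc n) - dyadic_form l f h n" for n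
  have D: "\<bar>D n\<bar> \<le> sqrt (a n) * sqrt (b n)" for n
  proof -
    let ?e = "\<lambda>j. dyadic_avg l h (Suc n) (2 * j) - dyadic_avg l h (Suc n) (Suc (2 * j))"
    have "\<bar>D n\<bar> \<le> (\<Sum>j<2 ^ n. \<bar>second_diff l f n j * ?e j / 2\<bar>)"
      unfolding D_def dyadic_form_Suc[OF l hL] by (rule sum_abs)
    also have "\<dots> \<le> (\<Sum>j<2 ^ n. \<bar>second_diff l f n j\<bar> * \<bar>?e j\<bar>)"
      by (intro sum_mono) (simp add: abs_mult)
    also have "\<dots> \<le> L2_set (second_diff l f n) {..<2 ^ n} * L2_set ?e {..<2 ^ n}" by (rule L2_set_mult_ineq)
    also have "\<dots> = sqrt (a n) * sqrt (b n)"
      unfolding L2_set_def a_def b_def avg_jumps_def real_sqrt_mult[symmetric] using \<mu> by (simp add: power_one_over)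
    finally show ?thesis .
  qed
  have sumD: "(\<Sum>n<N. \<bar>D n\<bar>) \<le> sqrt S * sqrt G" for N
  proof -
    have "(\<Sum>n<N. \<bar>D n\<bar>) \<le> (\<Sum>n<N. \<bar>sqrt (a n)\<bar> * \<bar>sqrt (b n)\<bar>)"
      using D a0 b0 by (intro sum_mono) simp
    also have "\<dots> \<le> L2_set (\<lambda>n. sqrt (a n)) {..<N} * L2_set (\<lambda>n. sqrt (b n)) {..<N}" by (rule L2_set_mult_ineq)
    also have "\<dots> = sqrt (\<Sum>n<N. a n) * sqrt (\<Sum>n<N. b n)" using a0 b0 by (simp add: L2_set_def)
    also have "\<dots> \<le> sqrt S * sqrt G" using S S0 bG a0 b0 by (intro mult_mono real_sqrt_le_mono) (auto intro!: sum_nonneg)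
    finally show ?thesis .
  qed
  have sD: "summable (\<lambda>n. \<bar>D n\<bar>)" using sumD by (intro summableI_nonneg_bounded) auto
  have tel: "(\<Sum>n<N. D n) = dyadic_form l f h N - dyadic_form l f h 0" for N
    unfolding D_def by (rule sum_lessThan_telescope)
  have "(\<lambda>N. dyadic_form l f h 0 + (\<Sum>n<N. D n)) \<longlonglongrightarrow> dyadic_form l f h 0 + suminf D"
    using summable_LIMSEQ[OF summable_rabs_cancel[OF sD]] by (intro tendsto_add tendsto_const)
  then have lim: "dyadic_form l f h \<longlonglongrightarrow> dyadic_form l f h 0 + suminf D" unfolding tel by simp
  then show "convergent (dyadic_form l f h)" by (rule convergentI)
  have "\<bar>suminf D\<bar> \<le> (\<Sum>n. \<bar>D n\<bar>)" by (rule summable_rabs[OF sD])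
  also have "\<dots> \<le> sqrt S * sqrt G" by (rule suminf_le_const[OF sD sumD])
  also have "sqrt G \<le> sqrt (4 * l powr (2 * s - 1)) * Hs_norm l s h"
  proof -
    have "sqrt G = sqrt (4 * l powr (2 * s - 1)) * sqrt (enn2real (gagliardo l s h))"
      by (simp add: G_def real_sqrt_mult)
    also have "sqrt (enn2real (gagliardo l s h)) \<le> Hs_norm l s h" unfolding Hs_norm_def by simp
    finally show ?thesis by (simp add: mult_left_mono)
  qed
  finally have 1: "\<bar>suminf D\<bar> \<le> sqrt S * (sqrt (4 * l powr (2 * s - 1)) * Hs_norm l s h)" using S0 by (simp add: mult_left_mono)
  have 0: "\<bar>dyadic_form l f h 0\<bar> \<le> \<bar>f l - f 0\<bar> * sqrt l / l * Hs_norm l s h"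
  proof -
    have n1: "node l 0 (Suc 0) = l" using node_last[of l 0] by simp
    have "(LINT t:{0..l}|edge_measure l. h t)\<^sup>2 \<le> l * (LINT t:{0..l}|edge_measure l. (h t)\<^sup>2)"
      using set_integral_edge_Cauchy_Schwarz[OF hL, of 0 l] l by simp
    also have "\<dots> = (sqrt l * L2_norm l h)\<^sup>2"
      using l by (simp add: set_integral_edge_whole power_mult_distrib L2_norm_square)
    finally have "\<bar>LINT t:{0..l}|edge_measure l. h t\<bar> \<le> \<bar>sqrt l * L2_norm l h\<bar>" unfolding abs_le_square_iff .
    also have "\<dots> = sqrt l * L2_norm l h" using l by simp
    also have "\<dots> \<le> sqrt l * Hs_norm l s h"
      using l unfolding Hs_norm_def by (intro mult_left_mono real_le_rsqrt) auto
    finally have "\<bar>LINT t:{0..l}|edge_measure l. h t\<bar> \<le> sqrt l * Hs_norm l s h" .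
    then have "\<bar>f l - f 0\<bar> * (1 / l * \<bar>LINT t:{0..l}|edge_measure l. h t\<bar>) \<le> \<bar>f l - f 0\<bar> * (1 / l * (sqrt l * Hs_norm l s h))"
      using l by (intro mult_left_mono) auto
    then show ?thesis using l by (simp add: dyadic_form_def dyadic_avg_def n1 abs_mult)
  qed
  have "\<bar>lim (dyadic_form l f h)\<bar> \<le> \<bar>dyadic_form l f h 0\<bar> + \<bar>suminf D\<bar>" unfolding limI[OF lim] by (rule abs_triangle_ineq)
  with 0 1 show "\<bar>lim (dyadic_form l f h)\<bar> \<le> (\<bar>f l - f 0\<bar> * sqrt l / l + sqrt S * sqrt (4 * l powr (2 * s - 1))) * Hs_norm l s h"
    by (simp add: distrib_right mult.assoc)
qed

section \<open>The dual weak derivative\<close>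

text \<open>Both functionals are bounded and agree on test functions, which are dense in
  \<open>Hs0_edge\<close>; outside that set both take the default value because they are
  extensional.\<close>

lemma Hneg_unique:
  assumes s: "0 \<le> l" "s < 1 / 2" and F: "F \<in> Hneg_edge l s" and G: "G \<in> Hneg_edge l s"
    and eq: "\<And>\<phi>. \<phi> \<in> test_functions l \<Longrightarrow> F \<phi> = G \<phi>"
  shows "F = G"
proof
  fix u
  show "F u = G u"
  proof (cases "u \<in> Hs0_edge l s")
    case False
    then show ?thesis using F G by (simp add: Hneg_edge_def extensional_def)
  next
    case u: True
    obtain C where C: "\<forall>w\<in>Hs0_edge l s. \<bar>F w\<bar> \<le> C * Hs_norm l s w"
      using F unfolding Hneg_edge_def by blast
    obtain D where D: "\<forall>w\<in>Hs0_edge l s. \<bar>G w\<bar> \<le> D * Hs_norm l s w"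
      using G unfolding Hneg_edge_def by blast
    have lin: "H (\<lambda>x. a * u x + b * v x) = a * H u + b * H v"
      if "H \<in> Hneg_edge l s" "u \<in> Hs0_edge l s" "v \<in> Hs0_edge l s" for H u v a b
      using that by (simp add: Hneg_edge_def)
    have "\<bar>F u - G u\<bar> \<le> (\<bar>C\<bar> + \<bar>D\<bar>) * e" if e: "e > 0" for e
    proof -
      obtain \<phi> where \<phi>: "\<phi> \<in> test_functions l" "Hs_norm l s (\<lambda>x. u x - \<phi> x) < e"
        using u e by (auto simp: Hs0_edge_def)
      have \<phi>0: "\<phi> \<in> Hs0_edge l s" by (rule test_function_Hs0[OF s \<phi>(1)])
      define w where "w = (\<lambda>x. 1 * u x + (-1) * \<phi> x)"
      have w0: "w \<in> Hs0_edge l s" unfolding w_def by (rule Hs0_lin[OF s u \<phi>0])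
      have we: "Hs_norm l s w \<le> e" using \<phi>(2) by (simp add: w_def)
      have "F w = F u - F \<phi>" "G w = G u - G \<phi>" unfolding w_def lin[OF F u \<phi>0] lin[OF G u \<phi>0] by simp_all
      then have "F u - G u = F w - G w" using eq[OF \<phi>(1)] by simp
      also have "\<bar>\<dots>\<bar> \<le> \<bar>F w\<bar> + \<bar>G w\<bar>" by simp
      also have "\<dots> \<le> C * Hs_norm l s w + D * Hs_norm l s w" by (intro add_mono C[rule_format] D[rule_format] w0)
      also have "\<dots> \<le> \<bar>C\<bar> * e + \<bar>D\<bar> * e" using we by (intro add_mono mult_mono) auto
      finally show ?thesis by (simp add: distrib_right)
    qed
    note * = this
    show ?thesis
    proof (rule ccontr)
      assume "F u \<noteq> G u"
      then have p: "\<bar>F u - G u\<bar> > 0" by simp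
      let ?K = "\<bar>C\<bar> + \<bar>D\<bar> + 1"
      have K: "?K > 0" by (simp add: add_nonneg_pos)
      have "\<bar>F u - G u\<bar> \<le> (?K - 1) * (\<bar>F u - G u\<bar> / ?K)" using *[of "\<bar>F u - G u\<bar> / ?K"] p K by simp
      also have "\<dots> < ?K * (\<bar>F u - G u\<bar> / ?K)" using p K by (intro mult_strict_right_mono divide_pos_pos) auto
      also have "\<dots> = \<bar>F u - G u\<bar>" using K by simp
      finally show False by simp
    qed
  qed
qed

text \<open>The limit of the dyadic forms is shown to be the functional described by the
  \<open>THE\<close>, and is then evaluated at w. As w is only almost everywhere equal to the
  primitive h, its membership in \<open>Hs0_edge\<close> and its forms are carried over from
  h.\<close>

lemma weak_deriv_dual_primitive:
  assumes l: "0 < l" and \<beta>: "1 / 2 < \<beta>" "\<beta> < 1" and u: "u \<in> L2_edge l"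
    and f: "continuous_on {0..l} f" "AE x in edge_measure l. u x = f x"
    and sm: "summable (\<lambda>n. (2 powr (2 * \<beta> - 1)) ^ n * (\<Sum>j<2 ^ n. (second_diff l f n j)\<^sup>2))"
    and h: "primitive l h k" and w: "w \<in> L2_edge l" "AE x in edge_measure l. w x = h x"
  shows "weak_deriv_dual l \<beta> u w = f l * h l - f 0 * h 0 - L2_inner l f k"
proof -
  define s where "s = 1 - \<beta>"
  have s: "0 \<le> s" "s < 1 / 2" using \<beta> by (simp_all add: s_def)
  note l0 = less_imp_le[OF l]
  have fL: "f \<in> L2_edge l" by (rule L2_edge_continuous_on[OF f(1)])
  have sm': "summable (\<lambda>n. (2 powr (1 - 2 * s)) ^ n * (\<Sum>j<2 ^ n. (second_diff l f n j)\<^sup>2))"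
  proof -
    have "2 * \<beta> - 1 = 1 - 2 * s" by (simp add: s_def)
    with sm show ?thesis by (simp only:)
  qed
  note conv = dyadic_form_bounded(1)[OF l s(1) _ sm'] and bd = dyadic_form_bounded(2)[OF l s(1) _ sm']
  define F where "F = restrict (\<lambda>v. lim (dyadic_form l f v)) (Hs0_edge l s)"
  have Hs: "v \<in> Hs_edge l s" "v \<in> L2_edge l" if "v \<in> Hs0_edge l s" for v
    using that by (auto simp: Hs0_edge_def Hs_edge_def)
  have limv: "dyadic_form l f v \<longlonglongrightarrow> F v" if "v \<in> Hs0_edge l s" for v
    using conv[OF Hs(1)[OF that]] that by (simp add: F_def convergent_LIMSEQ_iff)
  have FH: "F \<in> Hneg_edge l s"
    unfolding Hneg_edge_def
  proof (intro CollectI conjI ballI allI)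
    show "F \<in> extensional (Hs0_edge l s)" by (simp add: F_def)
    fix v v' a b assume v: "v \<in> Hs0_edge l s" "v' \<in> Hs0_edge l s"
    have A: "(\<lambda>n. a * dyadic_form l f v n + b * dyadic_form l f v' n) \<longlonglongrightarrow> a * F v + b * F v'"
      by (intro tendsto_intros limv v)
    have B: "(\<lambda>n. a * dyadic_form l f v n + b * dyadic_form l f v' n) = dyadic_form l f (\<lambda>x. a * v x + b * v' x)"
      by (rule ext) (rule dyadic_form_lin[OF Hs(2)[OF v(1)] Hs(2)[OF v(2)] l0, symmetric])
    show "F (\<lambda>x. a * v x + b * v' x) = a * F v + b * F v'"
      by (rule LIMSEQ_unique[OF limv[OF Hs0_lin[OF l0 s(2) v]] A[unfolded B]])
  next
    show "\<exists>C. \<forall>v\<in>Hs0_edge l s. \<bar>F v\<bar> \<le> C * Hs_norm l s v"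
    proof (intro exI ballI)
      fix v assume v: "v \<in> Hs0_edge l s"
      then have "F v = lim (dyadic_form l f v)" by (simp add: F_def)
      then show "\<bar>F v\<bar> \<le> (\<bar>f l - f 0\<bar> * sqrt l / l + sqrt (\<Sum>n. (2 powr (1 - 2 * s)) ^ n * (\<Sum>j<2 ^ n. (second_diff l f n j)\<^sup>2))
          * sqrt (4 * l powr (2 * s - 1))) * Hs_norm l s v"
        using bd[OF Hs(1)[OF v]] by (simp only:)
    qed
  qed
  have Ftest: "F \<phi> = - L2_inner l u (deriv \<phi>)" if \<phi>: "\<phi> \<in> test_functions l" for \<phi>
  proof -
    have "F \<phi> = f l * \<phi> l - f 0 * \<phi> 0 - L2_inner l f (deriv \<phi>)"
      by (rule LIMSEQ_unique[OF limv[OF test_function_Hs0[OF l0 s(2) \<phi>]] dyadic_form_primitive[OF l test_function_primitive[OF \<phi>] f(1)]])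
    also have "\<dots> = - L2_inner l u (deriv \<phi>)"
      using test_function_zero[OF \<phi>] L2_inner_cong_AE[OF u fL test_function_deriv_L2[OF \<phi>] f(2)] by simp
    finally show ?thesis .
  qed
  have "weak_deriv_dual l \<beta> u = F"
  proof -
    have "(THE F. F \<in> Hneg_edge l s \<and> (\<forall>\<phi>\<in>test_functions l. F \<phi> = - L2_inner l u (deriv \<phi>))) = F"
    proof (rule the_equality)
      show "F \<in> Hneg_edge l s \<and> (\<forall>\<phi>\<in>test_functions l. F \<phi> = - L2_inner l u (deriv \<phi>))"
        using FH Ftest by blast
      fix G assume G: "G \<in> Hneg_edge l s \<and> (\<forall>\<phi>\<in>test_functions l. G \<phi> = - L2_inner l u (deriv \<phi>))"
      show "G = F"
        by (rule Hneg_unique[OF l0 s(2) conjunct1[OF G] FH]) (use G Ftest in simp)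
    qed
    moreover have "\<beta> \<noteq> 1" using \<beta> by simp
    ultimately show ?thesis unfolding weak_deriv_dual_def s_def[symmetric] by (simp only: if_False)
  qed
  moreover have "w \<in> Hs0_edge l s"
    by (rule Hs0_cong_AE[OF primitive_Hs0[OF l s h] L2_edge_measurable[OF w(1)] w(2)])
  then have "dyadic_form l f w \<longlonglongrightarrow> F w" by (rule limv)
  moreover have wh: "dyadic_form l f w = dyadic_form l f h"
    by (rule ext) (rule dyadic_form_cong_AE[OF w(1) primitive_L2[OF h] w(2) l0])
  ultimately show ?thesis
    using LIMSEQ_unique[of "dyadic_form l f h" "F w", OF _ dyadic_form_primitive[OF l h f(1)]] by (simp only: wh)
qed


section \<open>Traces and second differences by interpolation\<close>

text \<open>Average d(x)^2 <= 2 d(t)^2 + 2 (d(x) - d(t))^2 over t in the cell. The two resulting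
  terms scale oppositely with the cell length, which can therefore be matched to the level.\<close>

lemma primitive_cell_bound:
  assumes d: "primitive l d d'" and pq: "0 \<le> p" "p < q" "q \<le> l" and x: "x \<in> {p..q}"
  shows "(d x)\<^sup>2 \<le> 2 / (q - p) * (LINT t:{p..q}|edge_measure l. (d t)\<^sup>2) + 2 * (q - p) * (LINT t:{p..q}|edge_measure l. (d' t)\<^sup>2)"
proof -
  define D where "D = (LINT t:{p..q}|edge_measure l. (d' t)\<^sup>2)"
  note sq = L2_edge_square[OF primitiveD(1)[OF d]]
  note dL = primitive_L2[OF d]
  have *: "(d y - d z)\<^sup>2 \<le> (q - p) * D" if "p \<le> z" "z \<le> y" "y \<le> q" for y z
  proof -
    have "(d y - d z)\<^sup>2 \<le> (y - z) * (LINT t:{z..y}|edge_measure l. (d' t)\<^sup>2)"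
      using that pq primitiveD(3)[OF d, of z y] set_integral_edge_Cauchy_Schwarz[OF primitiveD(1)[OF d], of z y] by simp
    also have "\<dots> \<le> (q - p) * (LINT t:{z..y}|edge_measure l. (d' t)\<^sup>2)"
      using that by (intro mult_right_mono) (auto simp: set_lebesgue_integral_def)
    also have "\<dots> \<le> (q - p) * D"
      unfolding D_def using that pq by (intro mult_left_mono set_integral_edge_mono_set sq) auto
    finally show ?thesis .
  qed
  have ptw: "(d x)\<^sup>2 \<le> 2 * (d t)\<^sup>2 + 2 * ((q - p) * D)" if "t \<in> {p..q}" for t
  proof -
    have "(d x - d t)\<^sup>2 \<le> (q - p) * D"
      using *[of t x] *[of x t] x that by (cases "t \<le> x") (auto simp: power2_commute)
    moreover have "(d x)\<^sup>2 \<le> 2 * (d t)\<^sup>2 + 2 * (d x - d t)\<^sup>2"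
      using zero_le_power2[of "d x - 2 * d t"] by (simp add: power2_eq_square algebra_simps)
    ultimately show ?thesis by linarith
  qed
  have i1: "set_integrable (edge_measure l) {p..q} (\<lambda>t. c)" for c :: real
    by (rule set_integrable_edge[OF L2_edge_integrable[OF L2_edge_const] pq(1,3)])
  have i2: "set_integrable (edge_measure l) {p..q} (\<lambda>t. 2 * (d t)\<^sup>2)"
    using set_integrable_edge[OF L2_edge_square[OF dL] pq(1,3)] by simp
  have "(LINT t:{p..q}|edge_measure l. (d x)\<^sup>2) \<le> (LINT t:{p..q}|edge_measure l. 2 * (d t)\<^sup>2 + 2 * ((q - p) * D))"
    by (rule set_integral_mono[OF i1 set_integral_add(1)[OF i2 i1]]) (rule ptw)
  also have "\<dots> = (LINT t:{p..q}|edge_measure l. 2 * (d t)\<^sup>2) + (LINT t:{p..q}|edge_measure l. 2 * ((q - p) * D))"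
    by (rule set_integral_add(2)[OF i2 i1])
  finally have "(d x)\<^sup>2 * (q - p) \<le> 2 * (LINT t:{p..q}|edge_measure l. (d t)\<^sup>2) + 2 * ((q - p) * D) * (q - p)"
    using pq by (simp only: set_integral_edge_const less_imp_le set_integral_mult_right)
  then have "(d x)\<^sup>2 \<le> (2 * (LINT t:{p..q}|edge_measure l. (d t)\<^sup>2) + 2 * ((q - p) * D) * (q - p)) / (q - p)"
    using pq by (simp only: pos_le_divide_eq diff_gt_0_iff_gt)
  also have "\<dots> = 2 / (q - p) * (LINT t:{p..q}|edge_measure l. (d t)\<^sup>2) + 2 * (q - p) * D"
    using pq by (simp add: add_divide_distrib)
  finally show ?thesis by (simp only: D_def)
qed

lemma primitive_sup_bound:
  assumes l: "0 < l" and d: "primitive l d d'" and x: "x \<in> {0..l}"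
  shows "(d x)\<^sup>2 \<le> 2 * 2 ^ n / l * (L2_norm l d)\<^sup>2 + 2 * (l / 2 ^ n) * (L2_norm l d')\<^sup>2"
proof -
  define \<delta> where "\<delta> = l / 2 ^ n"
  have \<delta>: "0 < \<delta>" "\<delta> \<le> l" using l by (simp_all add: \<delta>_def divide_le_eq)
  \<comment> \<open>The left end of an interval of length \<delta> that contains x and is pushed
    back into the edge when x is close to l.\<close>
  define p where "p = min x (l - \<delta>)"
  have p: "0 \<le> p" "p < p + \<delta>" "p + \<delta> \<le> l" "x \<in> {p..p + \<delta>}" using x \<delta> by (auto simp: p_def)
  have "(d x)\<^sup>2 \<le> 2 / \<delta> * (LINT t:{p..p + \<delta>}|edge_measure l. (d t)\<^sup>2) + 2 * \<delta> * (LINT t:{p..p + \<delta>}|edge_measure l. (d' t)\<^sup>2)"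
    using primitive_cell_bound[OF d p] by simp
  also have "\<dots> \<le> 2 / \<delta> * (LINT t:{0..l}|edge_measure l. (d t)\<^sup>2) + 2 * \<delta> * (LINT t:{0..l}|edge_measure l. (d' t)\<^sup>2)"
    using p \<delta> L2_edge_square[OF primitive_L2[OF d]] L2_edge_square[OF primitiveD(1)[OF d]]
    by (intro add_mono mult_left_mono set_integral_edge_mono_set) auto
  also have "2 / \<delta> = 2 * 2 ^ n / l" by (simp add: \<delta>_def)
  finally show ?thesis by (simp only: set_integral_edge_whole L2_norm_square \<delta>_def)
qed

text \<open>Summing the cell bound over left end points costs no factor because the cells tile the
  edge. The factor 2 pays for the last node l.\<close>

lemma primitive_nodes_bound:
  assumes l: "0 < l" and d: "primitive l d d'"
  shows "(\<Sum>j\<le>2 ^ n. (d (node l n j))\<^sup>2) \<le> 2 * (2 * 2 ^ n / l * (L2_norm l d)\<^sup>2 + 2 * (l / 2 ^ n) * (L2_norm l d')\<^sup>2)"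
proof -
  note l0 = less_imp_le[OF l]
  let ?I = "\<lambda>j. {node l n j..node l n (Suc j)}"
  have "(\<Sum>j<2 ^ n. (d (node l n j))\<^sup>2) \<le> (\<Sum>j<2 ^ n. 2 * 2 ^ n / l * (LINT t:?I j|edge_measure l. (d t)\<^sup>2)
      + 2 * (l / 2 ^ n) * (LINT t:?I j|edge_measure l. (d' t)\<^sup>2))"
  proof (rule sum_mono)
    fix j assume "j \<in> {..<2 ^ n :: nat}"
    then have j: "j < 2 ^ n" by simp
    have nd: "node l n (Suc j) - node l n j = l / 2 ^ n" by (rule node_Suc_diff)
    have lt: "node l n j < node l n (Suc j)"
    proof -
      have "0 < l / 2 ^ n" using l by simp
      with nd show ?thesis by linarith
    qed
    have "(d (node l n j))\<^sup>2 \<le> 2 / (l / 2 ^ n) * (LINT t:?I j|edge_measure l. (d t)\<^sup>2)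
      + 2 * (l / 2 ^ n) * (LINT t:?I j|edge_measure l. (d' t)\<^sup>2)"
      using primitive_cell_bound[OF d _ lt, of "node l n j"] node_bounds[OF l0, of j n] node_bounds[OF l0, of "Suc j" n] j lt
      unfolding nd by auto
    then show "(d (node l n j))\<^sup>2 \<le> 2 * 2 ^ n / l * (LINT t:?I j|edge_measure l. (d t)\<^sup>2)
      + 2 * (l / 2 ^ n) * (LINT t:?I j|edge_measure l. (d' t)\<^sup>2)" by simp
  qed
  also have "\<dots> = 2 * 2 ^ n / l * (L2_norm l d)\<^sup>2 + 2 * (l / 2 ^ n) * (L2_norm l d')\<^sup>2"
    unfolding sum.distrib sum_distrib_left[symmetric] L2_norm_square
      sum_set_integral_nodes_all[OF l0 L2_edge_square[OF primitive_L2[OF d]]]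
      sum_set_integral_nodes_all[OF l0 L2_edge_square[OF primitiveD(1)[OF d]]] ..
  finally have 1: "(\<Sum>j<2 ^ n. (d (node l n j))\<^sup>2) \<le> 2 * 2 ^ n / l * (L2_norm l d)\<^sup>2 + 2 * (l / 2 ^ n) * (L2_norm l d')\<^sup>2" .
  have "(d l)\<^sup>2 \<le> 2 * 2 ^ n / l * (L2_norm l d)\<^sup>2 + 2 * (l / 2 ^ n) * (L2_norm l d')\<^sup>2"
    using l by (intro primitive_sup_bound[OF l d]) auto
  moreover have "(\<Sum>j\<le>2 ^ n. (d (node l n j))\<^sup>2) = (\<Sum>j<2 ^ n. (d (node l n j))\<^sup>2) + (d l)\<^sup>2"
    using lessThan_Suc_atMost[of "2 ^ n"] by (metis node_last sum.lessThan_Suc)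
  ultimately show ?thesis using 1 unfolding mult_2[of "2 * 2 ^ n / l * _ + _"] by (simp only: add_mono)
qed

text \<open>The recursion runs downwards from the terminal value 0. Squaring costs one factor 1/(1 -
  r) by convexity; absorbing r times the shifted sum on the left costs the other. The bound does not
  depend on N, so N may tend to infinity later.\<close>

lemma discrete_Hardy:
  fixes T \<alpha> :: "nat \<Rightarrow> real"
  assumes r: "0 < r" "r < 1" and T: "\<And>n. 0 \<le> T n" "T N = 0"
    and rec: "\<And>n. n < N \<Longrightarrow> T n \<le> r * T (Suc n) + \<alpha> n"
  shows "(\<Sum>n<N. (T n)\<^sup>2) \<le> (\<Sum>n<N. (\<alpha> n)\<^sup>2) / (1 - r)\<^sup>2"
proof -
  have cv: "(r * x + a)\<^sup>2 \<le> r * x\<^sup>2 + a\<^sup>2 / (1 - r)" for x a :: real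
  proof -
    have "r * x\<^sup>2 + a\<^sup>2 / (1 - r) - (r * x + a)\<^sup>2 = r * ((1 - r) * x - a)\<^sup>2 / (1 - r)"
      using r by (simp add: field_simps power2_eq_square)
    also have "\<dots> \<ge> 0" using r by simp
    finally show ?thesis by simp
  qed
  have step: "(T n)\<^sup>2 \<le> r * (T (Suc n))\<^sup>2 + (\<alpha> n)\<^sup>2 / (1 - r)" if "n < N" for n
  proof -
    have "(T n)\<^sup>2 \<le> (r * T (Suc n) + \<alpha> n)\<^sup>2" using rec[OF that] T(1) by (intro power_mono) auto
    also note cv
    finally show ?thesis .
  qed
  have "(\<Sum>n<N. (T n)\<^sup>2) \<le> (\<Sum>n<N. r * (T (Suc n))\<^sup>2 + (\<alpha> n)\<^sup>2 / (1 - r))"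
    by (intro sum_mono step) simp
  also have "\<dots> = r * (\<Sum>n<N. (T (Suc n))\<^sup>2) + (\<Sum>n<N. (\<alpha> n)\<^sup>2) / (1 - r)"
    by (simp add: sum.distrib sum_distrib_left sum_divide_distrib)
  also have "(\<Sum>n<N. (T (Suc n))\<^sup>2) = (\<Sum>n<N. (T n)\<^sup>2) - (T 0)\<^sup>2"
    using sum.lessThan_Suc_shift[of "\<lambda>n. (T n)\<^sup>2" N] T(2) by simp
  also have "r * ((\<Sum>n<N. (T n)\<^sup>2) - (T 0)\<^sup>2) \<le> r * (\<Sum>n<N. (T n)\<^sup>2)" using r by (simp add: right_diff_distrib)
  finally have "(1 - r) * (\<Sum>n<N. (T n)\<^sup>2) \<le> (\<Sum>n<N. (\<alpha> n)\<^sup>2) / (1 - r)" by (simp add: left_diff_distrib)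
  then have "(\<Sum>n<N. (T n)\<^sup>2) \<le> (\<Sum>n<N. (\<alpha> n)\<^sup>2) / (1 - r) / (1 - r)"
    using r by (subst pos_le_divide_eq) (auto simp: mult.commute)
  then show ?thesis by (simp add: power2_eq_square)
qed

text \<open>A second difference is the difference of two successive increments, each bounded by
  Cauchy-Schwarz on its half cell.\<close>

lemma second_diff_primitive_sum:
  assumes l: "0 < l" and w: "primitive l w w'"
  shows "(\<Sum>j<2 ^ n. (second_diff l w n j)\<^sup>2) \<le> l / 2 ^ n * (L2_norm l w')\<^sup>2"
proof -
  note l0 = less_imp_le[OF l]
  note wL = primitiveD(1)[OF w]
  let ?J = "\<lambda>j. LINT t:{node l n j..node l n (Suc j)}|edge_measure l. (w' t)\<^sup>2"
  have "(\<Sum>j<2 ^ n. (second_diff l w n j)\<^sup>2) \<le> (\<Sum>j<2 ^ n. l / 2 ^ n * ?J j)"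
  proof (rule sum_mono)
    fix j assume "j \<in> {..<2 ^ n :: nat}"
    then have j: "j < 2 ^ n" by simp
    define \<delta> where "\<delta> = l / 2 ^ n / 2"
    have \<delta>: "\<delta> > 0" using l by (simp add: \<delta>_def)
    define a where "a = node l n j"
    have m: "node l (Suc n) (Suc (2 * j)) = a + \<delta>" "node l n (Suc j) = a + 2 * \<delta>"
      by (simp_all add: a_def \<delta>_def node_def field_simps)
    have b: "0 \<le> a" "a + 2 * \<delta> \<le> l"
      using node_bounds[OF l0, of j n] node_bounds[OF l0, of "Suc j" n] j m(2) by (auto simp: a_def)
    define p where "p = w (a + \<delta>) - w a"
    define q where "q = w (a + 2 * \<delta>) - w (a + \<delta>)"
    have p: "p\<^sup>2 \<le> \<delta> * (LINT t:{a..a + \<delta>}|edge_measure l. (w' t)\<^sup>2)"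
      using primitiveD(3)[OF w, of a "a + \<delta>"] set_integral_edge_Cauchy_Schwarz[OF wL, of a "a + \<delta>"] b \<delta> by (simp add: p_def)
    have q: "q\<^sup>2 \<le> \<delta> * (LINT t:{a + \<delta>..a + 2 * \<delta>}|edge_measure l. (w' t)\<^sup>2)"
      using primitiveD(3)[OF w, of "a + \<delta>" "a + 2 * \<delta>"] set_integral_edge_Cauchy_Schwarz[OF wL, of "a + \<delta>" "a + 2 * \<delta>"] b \<delta>
      by (simp add: q_def)
    have "second_diff l w n j = p - q" by (simp add: second_diff_def m p_def q_def a_def)
    moreover have "(p - q)\<^sup>2 \<le> 2 * (p\<^sup>2 + q\<^sup>2)"
      using zero_le_power2[of "p + q"] by (simp add: power2_eq_square algebra_simps)
    ultimately have "(second_diff l w n j)\<^sup>2 \<le> 2 * (p\<^sup>2 + q\<^sup>2)" by simp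
    also have "\<dots> \<le> 2 * (\<delta> * (LINT t:{a..a + \<delta>}|edge_measure l. (w' t)\<^sup>2) + \<delta> * (LINT t:{a + \<delta>..a + 2 * \<delta>}|edge_measure l. (w' t)\<^sup>2))"
      using p q by simp
    also have "\<dots> = 2 * \<delta> * (LINT t:{a..a + 2 * \<delta>}|edge_measure l. (w' t)\<^sup>2)"
      using set_integral_edge_combine[OF L2_edge_square[OF wL], of a "a + \<delta>" "a + 2 * \<delta>"] b \<delta> by (simp add: distrib_left)
    also have "\<dots> = l / 2 ^ n * ?J j" unfolding m(2) a_def[symmetric] by (simp add: \<delta>_def)
    finally show "(second_diff l w n j)\<^sup>2 \<le> l / 2 ^ n * ?J j" .
  qed
  also have "\<dots> = l / 2 ^ n * (L2_norm l w')\<^sup>2"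
    unfolding sum_distrib_left[symmetric] L2_norm_square sum_set_integral_nodes_all[OF l0 L2_edge_square[OF wL]] ..
  finally show ?thesis .
qed

lemma second_diff_nodes_sum:
  "(\<Sum>j<2 ^ n. (second_diff l g n j)\<^sup>2) \<le> 12 * (\<Sum>i\<le>2 ^ Suc n. (g (node l (Suc n) i))\<^sup>2)"
proof -
  let ?g = "\<lambda>i. (g (node l (Suc n) i))\<^sup>2"
  have nd: "node l (Suc n) (Suc (Suc (2 * j))) = node l n (Suc j)" for j
    using node_refine[of l n "Suc j"] by simp
  \<comment> \<open>The middle value is shared between the left and the right half cell. This gives
    two sums over nodes of level n + 1, one of them shifted by one; each is at most the full node
    sum, whence 12 = 6 + 6.\<close>
  have six: "(2 * x - y - z)\<^sup>2 \<le> 6 * (y\<^sup>2 + x\<^sup>2) + 6 * (x\<^sup>2 + z\<^sup>2)" for x y z :: real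
  proof -
    have "0 \<le> (2 * y + x)\<^sup>2 + (2 * z + x)\<^sup>2 + (y - z)\<^sup>2 + 6 * x\<^sup>2" by simp
    also have "\<dots> = 6 * (y\<^sup>2 + x\<^sup>2) + 6 * (x\<^sup>2 + z\<^sup>2) - (2 * x - y - z)\<^sup>2"
      by (simp add: power2_eq_square algebra_simps)
    finally show ?thesis by simp
  qed
  have "(\<Sum>j<2 ^ n. (second_diff l g n j)\<^sup>2)
      \<le> (\<Sum>j<2 ^ n. 6 * (?g (2 * j) + ?g (Suc (2 * j))) + 6 * (?g (Suc (2 * j)) + ?g (Suc (Suc (2 * j)))))"
  proof (rule sum_mono)
    fix j
    have "second_diff l g n j = 2 * g (node l (Suc n) (Suc (2 * j))) - g (node l (Suc n) (2 * j)) - g (node l (Suc n) (Suc (Suc (2 * j))))"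
      by (simp only: second_diff_def nd node_refine)
    then show "(second_diff l g n j)\<^sup>2 \<le> 6 * (?g (2 * j) + ?g (Suc (2 * j))) + 6 * (?g (Suc (2 * j)) + ?g (Suc (Suc (2 * j))))"
      by (simp only: six)
  qed
  also have "\<dots> = 6 * (\<Sum>i<2 * 2 ^ n. ?g i) + 6 * (\<Sum>i<2 * 2 ^ n. ?g (Suc i))"
    by (simp only: sum_even_odd sum.distrib[of "\<lambda>j. 6 * (?g (2 * j) + ?g (Suc (2 * j)))"] sum_distrib_left)
  also have "(\<Sum>i<2 * 2 ^ n. ?g i) \<le> (\<Sum>i\<le>2 * 2 ^ n. ?g i)" by (intro sum_mono2) auto
  also have "(\<Sum>i<2 * 2 ^ n. ?g (Suc i)) \<le> (\<Sum>i\<le>2 * 2 ^ n. ?g i)"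
    by (subst sum.atMost_shift) simp
  finally show ?thesis by simp
qed

lemma L2_norm_le_sup:
  assumes "0 \<le> l" "u \<in> L2_edge l" "0 \<le> B" "\<And>x. x \<in> {0..l} \<Longrightarrow> \<bar>u x\<bar> \<le> B"
  shows "L2_norm l u \<le> B * sqrt l"
proof (rule power2_le_imp_le)
  have "(L2_norm l u)\<^sup>2 \<le> B\<^sup>2 * l" by (rule L2_norm_bounded[OF assms])
  also have "\<dots> = (B * sqrt l)\<^sup>2" using assms(1) by (simp add: power_mult_distrib)
  finally show "(L2_norm l u)\<^sup>2 \<le> (B * sqrt l)\<^sup>2" .
qed (use assms in simp)

text \<open>In the application b = 2^\<beta>, \<open>W n\<close> is a near-optimal H^1 part of u at
  t = 2^(-n), and \<open>a\<close> collects the scaled K-functional values. The increments of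
  \<open>W\<close> have size of order c_n \<mu>^(-n/2) with \<mu> = b^2/2 > 1, hence the series
  converges uniformly. The same bound summed over nodes feeds the Hardy inequality, which controls
  the second differences of the limit.\<close>

lemma interpolation_edge:
  assumes l: "0 < l" and b: "1 < b" "b < 2" "1 < b\<^sup>2 / 2" and u: "u \<in> L2_edge l"
    and W: "\<And>n. primitive l (W n) (W' n)" and a: "\<And>n. 0 \<le> a n" "summable (\<lambda>n. (a n)\<^sup>2)"
    and uW: "\<And>n. L2_norm l (\<lambda>x. u x - W n x) \<le> a n / b ^ n" and W'n: "\<And>n. L2_norm l (W' n) \<le> (2 / b) ^ n * a n"
  shows "\<exists>f. continuous_on {0..l} f \<and> (AE x in edge_measure l. u x = f x) \<and>
     summable (\<lambda>n. (b\<^sup>2 / 2) ^ n * (\<Sum>j<2 ^ n. (second_diff l f n j)\<^sup>2))"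
proof -
  note l0 = less_imp_le[OF l]
  define \<mu> where "\<mu> = b\<^sup>2 / 2"
  have \<mu>: "\<mu> > 1" using b by (simp add: \<mu>_def)
  define c where "c n = a n + a (Suc n)" for n
  have c0: "0 \<le> c n" for n using a(1) by (simp add: c_def)
  have WL: "W n \<in> L2_edge l" "W' n \<in> L2_edge l" for n
    using primitive_L2[OF W] primitiveD(1)[OF W] by auto
  define d where "d = (\<lambda>n x. W (Suc n) x - W n x)"
  define d' where "d' = (\<lambda>n x. W' (Suc n) x - W' n x)"
  have d: "primitive l (d n) (d' n)" for n
    unfolding d_def d'_def by (rule primitive_diff[OF W W])
  have dn: "L2_norm l (d n) \<le> c n / b ^ n" for n
  proof -
    have "L2_norm l (d n) = L2_norm l (\<lambda>x. (u x - W n x) - (u x - W (Suc n) x))" by (simp add: d_def)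
    also have "\<dots> \<le> L2_norm l (\<lambda>x. u x - W n x) + L2_norm l (\<lambda>x. u x - W (Suc n) x)"
      by (intro L2_norm_triangle_diff L2_edge_diff u WL)
    also have "\<dots> \<le> a n / b ^ n + a (Suc n) / b ^ Suc n" by (intro add_mono uW)
    also have "a (Suc n) / b ^ Suc n \<le> a (Suc n) / b ^ n"
      using a(1) b by (intro divide_left_mono) auto
    finally show ?thesis by (simp add: c_def add_divide_distrib)
  qed
  have d'n: "L2_norm l (d' n) \<le> 2 * (2 / b) ^ n * c n" for n
  proof -
    have "L2_norm l (d' n) \<le> L2_norm l (W' (Suc n)) + L2_norm l (W' n)"
      unfolding d'_def by (intro L2_norm_triangle_diff WL)
    also have "\<dots> \<le> (2 / b) ^ Suc n * a (Suc n) + (2 / b) ^ n * a n" by (intro add_mono W'n)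
    also have "(2 / b) ^ Suc n * a (Suc n) \<le> 2 * (2 / b) ^ n * a (Suc n)"
      using b a(1) by (intro mult_right_mono) (auto intro!: mult_right_mono simp: divide_le_eq)
    also have "(2 / b) ^ n * a n \<le> 2 * (2 / b) ^ n * a n"
      using b a(1) by (intro mult_right_mono) auto
    finally show ?thesis by (simp add: c_def distrib_left)
  qed
  define K where "K = 2 / l + 8 * l"
  have K: "K > 0" using l unfolding K_def by (intro add_pos_pos) auto
  \<comment> \<open>Cells of length l / 2^n balance the two terms: 2^n / b^(2n) and (4 / b^2)^n /
    2^n both equal \<open>1 / \<mu> ^ n\<close>.\<close>
  have B: "2 * 2 ^ n / l * (L2_norm l (d n))\<^sup>2 + 2 * (l / 2 ^ n) * (L2_norm l (d' n))\<^sup>2 \<le> K * (c n)\<^sup>2 / \<mu> ^ n" for n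
  proof -
    have e1: "(c n / b ^ n)\<^sup>2 = (c n)\<^sup>2 / (b\<^sup>2) ^ n" by (simp add: power_divide power_mult[symmetric] mult.commute)
    have e2: "(2 * (2 / b) ^ n * c n)\<^sup>2 = 4 * (4 ^ n / (b\<^sup>2) ^ n) * (c n)\<^sup>2"
    proof -
      have "((2 / b) ^ n)\<^sup>2 = ((2 / b)\<^sup>2) ^ n" by (simp add: power_mult[symmetric] mult.commute)
      also have "\<dots> = 4 ^ n / (b\<^sup>2) ^ n" by (simp add: power_divide)
      finally show ?thesis by (simp add: power_mult_distrib)
    qed
    have "2 * 2 ^ n / l * (L2_norm l (d n))\<^sup>2 + 2 * (l / 2 ^ n) * (L2_norm l (d' n))\<^sup>2
       \<le> 2 * 2 ^ n / l * (c n / b ^ n)\<^sup>2 + 2 * (l / 2 ^ n) * (2 * (2 / b) ^ n * c n)\<^sup>2"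
      using l dn d'n by (intro add_mono mult_left_mono power_mono) auto
    also have "\<dots> = 2 * 2 ^ n / l * ((c n)\<^sup>2 / (b\<^sup>2) ^ n) + 2 * (l / 2 ^ n) * (4 * (4 ^ n / (b\<^sup>2) ^ n) * (c n)\<^sup>2)"
      by (simp only: e1 e2)
    also have "\<dots> = K * (c n)\<^sup>2 * (2 ^ n / (b\<^sup>2) ^ n)"
    proof -
      have "(4 :: real) ^ n = 2 ^ n * 2 ^ n" by (simp add: power_mult_distrib[symmetric])
      then show ?thesis using l b by (simp add: K_def field_simps)
    qed
    also have "2 ^ n / (b\<^sup>2) ^ n = 1 / \<mu> ^ n" by (simp add: \<mu>_def power_divide)
    finally show ?thesis by simp
  qed
  have c2: "summable (\<lambda>n. (c n)\<^sup>2)"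
  proof (rule summable_comparison_test')
    show "summable (\<lambda>n. 2 * (a n)\<^sup>2 + 2 * (a (Suc n))\<^sup>2)"
      using a(2) by (intro summable_add summable_mult) (auto simp: summable_Suc_iff[of "\<lambda>n. (a n)\<^sup>2"])
    show "norm ((c n)\<^sup>2) \<le> 2 * (a n)\<^sup>2 + 2 * (a (Suc n))\<^sup>2" for n
    proof -
      have "(c n)\<^sup>2 \<le> 2 * (a n)\<^sup>2 + 2 * (a (Suc n))\<^sup>2"
        using zero_le_power2[of "a n - a (Suc n)"] by (simp add: c_def power2_eq_square algebra_simps)
      then show ?thesis by simp
    qed
  qed
  define C where "C = (\<Sum>n. (c n)\<^sup>2)"
  have Cs: "(\<Sum>n<N. (c n)\<^sup>2) \<le> C" for N unfolding C_def by (intro sum_le_suminf c2) auto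
  have C0: "0 \<le> C" using Cs[of 0] by simp
  have cC: "(c n)\<^sup>2 \<le> C" for n
  proof -
    have "(c n)\<^sup>2 \<le> (\<Sum>n<Suc n. (c n)\<^sup>2)" by (simp add: sum_nonneg)
    then show ?thesis using Cs[of "Suc n"] by linarith
  qed
  define r where "r = 1 / sqrt \<mu>"
  have r: "0 < r" "r < 1" using \<mu> by (auto simp: r_def)
  have r2: "(r ^ n)\<^sup>2 = 1 / \<mu> ^ n" for n
  proof -
    have "(r ^ n)\<^sup>2 = (r\<^sup>2) ^ n" by (simp add: power_mult[symmetric] mult.commute)
    also have "r\<^sup>2 = 1 / \<mu>" using \<mu> by (simp add: r_def power_divide)
    finally show ?thesis by (simp add: power_divide)
  qed
  have dsup: "\<bar>d n x\<bar> \<le> sqrt (K * C) * r ^ n" if "x \<in> {0..l}" for n x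
  proof -
    have "(d n x)\<^sup>2 \<le> K * (c n)\<^sup>2 / \<mu> ^ n" using primitive_sup_bound[OF l d that, of n n] B[of n] by linarith
    also have "\<dots> \<le> K * C / \<mu> ^ n" using cC[of n] K \<mu> by (intro divide_right_mono mult_left_mono) auto
    also have "\<dots> = (sqrt (K * C) * r ^ n)\<^sup>2"
      using K C0 by (simp add: power_mult_distrib r2)
    finally have "\<bar>d n x\<bar> \<le> \<bar>sqrt (K * C) * r ^ n\<bar>" unfolding abs_le_square_iff .
    then show ?thesis using K C0 r by simp
  qed
  have ul: "uniform_limit {0..l} (\<lambda>N x. \<Sum>n<N. d n x) (\<lambda>x. \<Sum>n. d n x) sequentially"
  proof (rule Weierstrass_m_test)
    show "norm (d n x) \<le> sqrt (K * C) * r ^ n" if "x \<in> {0..l}" for n x using dsup[OF that] by simp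
    show "summable (\<lambda>n. sqrt (K * C) * r ^ n)" using r by (intro summable_mult summable_geometric) auto
  qed
  define f where "f = (\<lambda>x. W 0 x + (\<Sum>n. d n x))"
  have WN: "W N x = W 0 x + (\<Sum>n<N. d n x)" for N x
    unfolding d_def using sum_lessThan_telescope[of "\<lambda>n. W n x" N] by simp
  have ulW: "uniform_limit {0..l} W f sequentially"
    using uniform_limit_add[OF uniform_limit_const ul, of "W 0"] unfolding f_def WN[abs_def, symmetric] by (simp add: WN[abs_def, symmetric])
  have Wc: "continuous_on {0..l} (W n)" for n by (rule primitive_continuous_on[OF W])
  have fc: "continuous_on {0..l} f"
    by (rule uniform_limit_theorem[OF _ ulW]) (auto simp: Wc)
  have fL: "f \<in> L2_edge l" by (rule L2_edge_continuous_on[OF fc])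
  have "AE x in edge_measure l. u x - f x = 0"
  proof (rule L2_norm_eq_0_AE[OF L2_edge_diff[OF u fL]])
    have small: "L2_norm l (\<lambda>x. u x - f x) \<le> e" if e: "e > 0" for e
    proof -
      define S where "S = sqrt l + 1"
      have S: "S > 0" using l unfolding S_def by (intro add_pos_pos) auto
      define e' where "e' = e / (2 * S)"
      have e': "e' > 0" using e S by (simp add: e'_def)
      have "(\<lambda>n. sqrt C * (1 / b) ^ n) \<longlonglongrightarrow> sqrt C * 0"
        using b by (intro tendsto_intros LIMSEQ_realpow_zero) auto
      then have "eventually (\<lambda>n. sqrt C * (1 / b) ^ n < e / 2) sequentially"
        using e by (intro order_tendstoD(2)) auto
      moreover have "eventually (\<lambda>n. \<forall>x\<in>{0..l}. dist (W n x) (f x) < e') sequentially"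
        using ulW e' by (simp add: uniform_limit_iff)
      ultimately have "eventually (\<lambda>n. sqrt C * (1 / b) ^ n < e / 2 \<and> (\<forall>x\<in>{0..l}. dist (W n x) (f x) < e')) sequentially"
        by (rule eventually_conj)
      then obtain n where n: "sqrt C * (1 / b) ^ n < e / 2" "\<forall>x\<in>{0..l}. dist (W n x) (f x) < e'"
        using eventually_happens'[OF sequentially_bot] by blast
      have "a n \<le> c n" using a(1) by (simp add: c_def)
      also have "c n \<le> sqrt C" using cC[of n] by (rule real_le_rsqrt)
      finally have "a n / b ^ n \<le> sqrt C / b ^ n" using b by (intro divide_right_mono) auto
      moreover have "sqrt C / b ^ n < e / 2" using n(1) by (simp add: power_one_over)
      ultimately have 1: "L2_norm l (\<lambda>x. u x - W n x) \<le> e / 2" using uW[of n] by linarith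
      have We: "\<bar>W n x - f x\<bar> \<le> e'" if "x \<in> {0..l}" for x
        using n(2)[rule_format, OF that] by (simp add: dist_real_def)
      have "L2_norm l (\<lambda>x. W n x - f x) \<le> e' * sqrt l"
      proof (rule L2_norm_le_sup[OF l0])
        show "(\<lambda>x. W n x - f x) \<in> L2_edge l" by (rule L2_edge_diff[OF WL(1) fL])
        show "0 \<le> e'" using e' by (rule less_imp_le)
        show "\<bar>W n x - f x\<bar> \<le> e'" if "x \<in> {0..l}" for x using that by (rule We)
      qed
      also have "\<dots> \<le> e' * S" using e' by (simp add: S_def)
      also have "\<dots> = e / 2"
        using S by (simp add: e'_def)
      finally have 2: "L2_norm l (\<lambda>x. W n x - f x) \<le> e / 2" .
      have "L2_norm l (\<lambda>x. u x - f x) = L2_norm l (\<lambda>x. (u x - W n x) + (W n x - f x))" by simp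
      also have "\<dots> \<le> L2_norm l (\<lambda>x. u x - W n x) + L2_norm l (\<lambda>x. W n x - f x)"
        by (intro L2_norm_triangle L2_edge_diff u WL fL)
      finally show ?thesis using 1 2 by linarith
    qed
    have "L2_norm l (\<lambda>x. u x - f x) \<le> 0"
    proof (rule field_le_epsilon)
      fix e :: real assume "0 < e"
      from small[OF this] show "L2_norm l (\<lambda>x. u x - f x) \<le> 0 + e" by (simp only: add_0)
    qed
    then show "L2_norm l (\<lambda>x. u x - f x) = 0" using L2_norm_nonneg[of l "\<lambda>x. u x - f x"] by linarith
  qed
  then have ae: "AE x in edge_measure l. u x = f x" by simp
  define H where "H = 2 * K * C / (1 - r)\<^sup>2"
  define E where "E g n = (\<Sum>j\<le>2 ^ n. (g (node l n j) - W n (node l n j))\<^sup>2)" for g n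
  have E0: "0 \<le> E g n" for g n by (simp add: E_def sum_nonneg)
  \<comment> \<open>Measuring the errors against \<open>W N\<close> first gives the Hardy recursion
    its terminal value 0, with a bound that is uniform in N.\<close>
  have fin: "(\<Sum>n<N. \<mu> ^ n * E (W N) n) \<le> H" for N
  proof -
    define T where "T n = sqrt (\<mu> ^ n * E (W N) n)" for n
    have sq\<mu>: "sqrt (\<mu> ^ n) * r = sqrt (\<mu> ^ n) / sqrt \<mu>" for n by (simp add: r_def)
    have "(\<Sum>n<N. (T n)\<^sup>2) \<le> (\<Sum>n<N. (sqrt (2 * K) * c n)\<^sup>2) / (1 - r)\<^sup>2"
    proof (rule discrete_Hardy[OF r])
      show "0 \<le> T n" for n using E0 \<mu> by (simp add: T_def)
      show "T N = 0" by (simp add: T_def E_def)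
      fix n assume "n < N"
      let ?J = "{..2 ^ n :: nat}"
      let ?g = "\<lambda>j. W N (node l n j) - W (Suc n) (node l n j)"
      have "sqrt (E (W N) n) = L2_set (\<lambda>j. ?g j + d n (node l n j)) ?J"
        by (simp add: L2_set_def E_def d_def)
      also have "\<dots> \<le> L2_set ?g ?J + L2_set (\<lambda>j. d n (node l n j)) ?J" by (rule L2_set_triangle_ineq)
      also have "L2_set ?g ?J \<le> sqrt (E (W N) (Suc n))"
      proof -
        \<comment> \<open>The nodes of level n are the even nodes of level n + 1, so passing to the
          finer level only adds terms.\<close>
        have "(\<Sum>j\<in>?J. (?g j)\<^sup>2) = (\<Sum>i\<in>(\<lambda>j. 2 * j) ` ?J. (W N (node l (Suc n) i) - W (Suc n) (node l (Suc n) i))\<^sup>2)"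
          by (subst sum.reindex) (auto simp: inj_on_def node_refine)
        also have "\<dots> \<le> E (W N) (Suc n)" unfolding E_def by (intro sum_mono2) auto
        finally show ?thesis unfolding L2_set_def by (rule real_sqrt_le_mono)
      qed
      also have "L2_set (\<lambda>j. d n (node l n j)) ?J \<le> sqrt (2 * (K * (c n)\<^sup>2 / \<mu> ^ n))"
        unfolding L2_set_def
        by (intro real_sqrt_le_mono order_trans[OF primitive_nodes_bound[OF l d]] mult_left_mono B) simp
      also have "sqrt (2 * (K * (c n)\<^sup>2 / \<mu> ^ n)) = sqrt (2 * K) * c n / sqrt (\<mu> ^ n)"
        using c0 by (simp add: real_sqrt_mult real_sqrt_divide)
      finally have le: "sqrt (E (W N) n) \<le> sqrt (E (W N) (Suc n)) + sqrt (2 * K) * c n / sqrt (\<mu> ^ n)" by simp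
      have "T n = sqrt (\<mu> ^ n) * sqrt (E (W N) n)" by (simp add: T_def real_sqrt_mult)
      also have "\<dots> \<le> sqrt (\<mu> ^ n) * (sqrt (E (W N) (Suc n)) + sqrt (2 * K) * c n / sqrt (\<mu> ^ n))"
        using le \<mu> by (intro mult_left_mono) auto
      also have "\<dots> = r * T (Suc n) + sqrt (2 * K) * c n"
        using \<mu> by (simp add: T_def r_def real_sqrt_mult distrib_left)
      finally show "T n \<le> r * T (Suc n) + sqrt (2 * K) * c n" .
    qed
    also have "(\<Sum>n<N. (sqrt (2 * K) * c n)\<^sup>2) = 2 * K * (\<Sum>n<N. (c n)\<^sup>2)"
      using K by (simp add: power_mult_distrib sum_distrib_left)
    also have "2 * K * (\<Sum>n<N. (c n)\<^sup>2) / (1 - r)\<^sup>2 \<le> H"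
      unfolding H_def using K Cs[of N] by (intro divide_right_mono mult_left_mono) auto
    also have "(\<Sum>n<N. (T n)\<^sup>2) = (\<Sum>n<N. \<mu> ^ n * E (W N) n)"
      using E0 \<mu> by (simp add: T_def)
    finally show ?thesis .
  qed
  \<comment> \<open>For fixed M only finitely many nodes enter, so pointwise convergence of
    \<open>W N\<close> to f passes the bound on.\<close>
  have Ef: "(\<Sum>n<M. \<mu> ^ n * E f n) \<le> H" for M
  proof (rule LIMSEQ_le_const2)
    have "(\<lambda>N. W N x) \<longlonglongrightarrow> f x" if "x \<in> {0..l}" for x
      using ulW that by (rule tendsto_uniform_limitI)
    then show "(\<lambda>N. \<Sum>n<M. \<mu> ^ n * E (W N) n) \<longlonglongrightarrow> (\<Sum>n<M. \<mu> ^ n * E f n)"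
      unfolding E_def using node_bounds(3)[OF l0] by (intro tendsto_intros) auto
    have "(\<Sum>n<M. \<mu> ^ n * E (W N) n) \<le> H" if "N \<ge> M" for N
    proof -
      have "(\<Sum>n<M. \<mu> ^ n * E (W N) n) \<le> (\<Sum>n<N. \<mu> ^ n * E (W N) n)"
        using that E0 \<mu> by (intro sum_mono2) auto
      with fin[of N] show ?thesis by simp
    qed
    then show "\<exists>N0. \<forall>N\<ge>N0. (\<Sum>n<M. \<mu> ^ n * E (W N) n) \<le> H" by blast
  qed
  define A where "A = (\<Sum>n. (a n)\<^sup>2)"
  have As: "(\<Sum>n<N. (a n)\<^sup>2) \<le> A" for N unfolding A_def by (intro sum_le_suminf a(2)) auto
  \<comment> \<open>The midpoints in a second difference of level n are nodes of level n + 1. Hence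
    f is split into \<open>W (Suc n)\<close>, controlled by its derivative, and the remaining error,
    controlled by the node sum \<open>E\<close> at that level.\<close>
  have SD: "\<mu> ^ n * (\<Sum>j<2 ^ n. (second_diff l f n j)\<^sup>2) \<le> 8 * l * (a (Suc n))\<^sup>2 + 24 * (\<mu> ^ Suc n * E f (Suc n))" for n
  proof -
    let ?w = "W (Suc n)" and ?g = "\<lambda>x. f x - W (Suc n) x"
    have "(second_diff l f n j)\<^sup>2 \<le> 2 * (second_diff l ?w n j)\<^sup>2 + 2 * (second_diff l ?g n j)\<^sup>2" for j
    proof -
      have "second_diff l f n j = second_diff l ?w n j + second_diff l ?g n j" by (simp add: second_diff_def)
      then show ?thesis using zero_le_power2[of "second_diff l ?w n j - second_diff l ?g n j"]
        by (simp add: power2_sum power2_diff)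
    qed
    then have "(\<Sum>j<2 ^ n. (second_diff l f n j)\<^sup>2) \<le> 2 * (\<Sum>j<2 ^ n. (second_diff l ?w n j)\<^sup>2) + 2 * (\<Sum>j<2 ^ n. (second_diff l ?g n j)\<^sup>2)"
      unfolding sum_distrib_left sum.distrib[symmetric] by (intro sum_mono)
    also have "\<dots> \<le> 2 * (l / 2 ^ n * (L2_norm l (W' (Suc n)))\<^sup>2) + 2 * (12 * E f (Suc n))"
      unfolding E_def by (intro add_mono mult_left_mono second_diff_primitive_sum[OF l W] second_diff_nodes_sum) auto
    also have "(L2_norm l (W' (Suc n)))\<^sup>2 \<le> ((2 / b) ^ Suc n * a (Suc n))\<^sup>2" by (intro power_mono W'n) simp
    finally have "(\<Sum>j<2 ^ n. (second_diff l f n j)\<^sup>2) \<le> 2 * (l / 2 ^ n * ((2 / b) ^ Suc n * a (Suc n))\<^sup>2) + 24 * E f (Suc n)"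
      using l by (simp add: divide_right_mono mult_left_mono)
    then have "\<mu> ^ n * (\<Sum>j<2 ^ n. (second_diff l f n j)\<^sup>2) \<le> \<mu> ^ n * (2 * (l / 2 ^ n * ((2 / b) ^ Suc n * a (Suc n))\<^sup>2) + 24 * E f (Suc n))"
      using \<mu> by (intro mult_left_mono) auto
    also have "\<dots> = 2 * l * (\<mu> ^ n / 2 ^ n * ((2 / b) ^ Suc n)\<^sup>2) * (a (Suc n))\<^sup>2 + 24 * (\<mu> ^ n * E f (Suc n))"
      unfolding power_mult_distrib[of "(2 / b) ^ Suc n" "a (Suc n)" 2] by (simp only: distrib_left) (simp del: power_Suc)
    finally have 1: "\<mu> ^ n * (\<Sum>j<2 ^ n. (second_diff l f n j)\<^sup>2)
      \<le> 2 * l * (\<mu> ^ n / 2 ^ n * ((2 / b) ^ Suc n)\<^sup>2) * (a (Suc n))\<^sup>2 + 24 * (\<mu> ^ n * E f (Suc n))" .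
    have 2: "\<mu> ^ n / 2 ^ n * ((2 / b) ^ Suc n)\<^sup>2 \<le> 4"
    proof -
      have "((2 / b) ^ Suc n)\<^sup>2 = ((2 / b)\<^sup>2) ^ Suc n" by (simp only: power_mult[symmetric] mult.commute)
      also have "\<dots> = ((2 / b)\<^sup>2) ^ n * (2 / b)\<^sup>2" by (rule power_Suc2)
      finally have "\<mu> ^ n / 2 ^ n * ((2 / b) ^ Suc n)\<^sup>2 = \<mu> ^ n / 2 ^ n * (((2 / b)\<^sup>2) ^ n * (2 / b)\<^sup>2)"
        by (simp only:)
      also have "\<dots> = (\<mu> / 2 * (2 / b)\<^sup>2) ^ n * (2 / b)\<^sup>2"
        by (simp only: power_mult_distrib power_divide times_divide_eq_left times_divide_eq_right mult.assoc)
      also have "\<mu> / 2 * (2 / b)\<^sup>2 = 1" using b by (simp add: \<mu>_def power_divide)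
      also have "1 ^ n * (2 / b)\<^sup>2 \<le> 4"
      proof -
        have "(2 / b)\<^sup>2 \<le> 2\<^sup>2" using b by (intro power_mono) (auto simp: divide_le_eq)
        then show ?thesis by simp
      qed
      finally show ?thesis .
    qed
    have 3: "\<mu> ^ n * E f (Suc n) \<le> \<mu> ^ Suc n * E f (Suc n)"
      using \<mu> E0 by (intro mult_right_mono power_increasing) auto
    have "2 * l * (\<mu> ^ n / 2 ^ n * ((2 / b) ^ Suc n)\<^sup>2) * (a (Suc n))\<^sup>2 + 24 * (\<mu> ^ n * E f (Suc n))
      \<le> 2 * l * 4 * (a (Suc n))\<^sup>2 + 24 * (\<mu> ^ Suc n * E f (Suc n))"
    proof (rule add_mono)
      show "2 * l * (\<mu> ^ n / 2 ^ n * ((2 / b) ^ Suc n)\<^sup>2) * (a (Suc n))\<^sup>2 \<le> 2 * l * 4 * (a (Suc n))\<^sup>2"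
        by (rule mult_right_mono[OF mult_left_mono[OF 2]]) (use l in auto)
      show "24 * (\<mu> ^ n * E f (Suc n)) \<le> 24 * (\<mu> ^ Suc n * E f (Suc n))"
        by (rule mult_left_mono[OF 3]) simp
    qed
    also have "2 * l * 4 = 8 * l" by simp
    finally show ?thesis using 1 by (rule order_trans[rotated])
  qed
  have sm: "summable (\<lambda>n. \<mu> ^ n * (\<Sum>j<2 ^ n. (second_diff l f n j)\<^sup>2))"
  proof (rule summableI_nonneg_bounded)
    show "0 \<le> \<mu> ^ n * (\<Sum>j<2 ^ n. (second_diff l f n j)\<^sup>2)" for n using \<mu> by (simp add: sum_nonneg)
    fix N
    have "(\<Sum>n<N. \<mu> ^ n * (\<Sum>j<2 ^ n. (second_diff l f n j)\<^sup>2)) \<le> (\<Sum>n<N. 8 * l * (a (Suc n))\<^sup>2 + 24 * (\<mu> ^ Suc n * E f (Suc n)))"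
      by (intro sum_mono SD)
    also have "\<dots> = 8 * l * (\<Sum>n<N. (a (Suc n))\<^sup>2) + 24 * (\<Sum>n<N. \<mu> ^ Suc n * E f (Suc n))"
      by (simp only: sum.distrib sum_distrib_left)
    also have "\<dots> \<le> 8 * l * A + 24 * H"
    proof (intro add_mono mult_left_mono)
      show "(\<Sum>n<N. (a (Suc n))\<^sup>2) \<le> A"
      proof -
        have "(\<Sum>n<N. (a (Suc n))\<^sup>2) \<le> (a 0)\<^sup>2 + (\<Sum>n<N. (a (Suc n))\<^sup>2)" by simp
        also have "\<dots> = (\<Sum>n<Suc N. (a n)\<^sup>2)" by (rule sum.lessThan_Suc_shift[symmetric])
        also have "\<dots> \<le> A" by (rule As)
        finally show ?thesis .
      qed
      show "(\<Sum>n<N. \<mu> ^ Suc n * E f (Suc n)) \<le> H"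
      proof -
        have "(\<Sum>n<N. \<mu> ^ Suc n * E f (Suc n)) \<le> \<mu> ^ 0 * E f 0 + (\<Sum>n<N. \<mu> ^ Suc n * E f (Suc n))"
          using E0[of f 0] by simp
        also have "\<dots> = (\<Sum>n<Suc N. \<mu> ^ n * E f n)" by (rule sum.lessThan_Suc_shift[symmetric])
        also have "\<dots> \<le> H" by (rule Ef)
        finally show ?thesis .
      qed
    qed (use l in auto)
    finally show "(\<Sum>n<N. \<mu> ^ n * (\<Sum>j<2 ^ n. (second_diff l f n j)\<^sup>2)) \<le> 8 * l * A + 24 * H" .
  qed
  show ?thesis by (rule exI[of _ f], rule conjI[OF fc conjI[OF ae sm[unfolded \<mu>_def]]])
qed


section \<open>The K-functional\<close>

lemma H1_zero: "(\<lambda>x. 0) \<in> H_edge l (Suc 0)"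
  by (auto simp: is_weak_deriv_def L2_inner_def intro!: bexI[of _ "\<lambda>x. 0"])

text \<open>The three facts share the observation that the set under the infimum is nonempty, by f =
  f + 0, and bounded below by 0; a real \<open>Inf\<close> is informative only then.\<close>

lemma K_functional_bounds:
  assumes f: "f \<in> H_graph \<Gamma> 0" and t: "0 \<le> t"
  shows K_functional_nonneg: "0 \<le> K_functional \<Gamma> t f"
    and K_functional_approx: "e > 0 \<Longrightarrow> \<exists>v w. v \<in> H_graph \<Gamma> 0 \<and> w \<in> H_graph \<Gamma> 1 \<and>
      (\<forall>e\<in>edges \<Gamma>. AE x in edge_measure (len \<Gamma> e). f e x = v e x + w e x) \<and>
      L2_graph_norm \<Gamma> v + t * H1_graph_norm \<Gamma> w < K_functional \<Gamma> t f + e"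
    and K_functional_mono: "t \<le> t' \<Longrightarrow> K_functional \<Gamma> t f \<le> K_functional \<Gamma> t' f"
proof -
  define S where "S t = {L2_graph_norm \<Gamma> v + t * H1_graph_norm \<Gamma> w | v w. v \<in> H_graph \<Gamma> 0 \<and> w \<in> H_graph \<Gamma> 1 \<and>
     (\<forall>e\<in>edges \<Gamma>. AE x in edge_measure (len \<Gamma> e). f e x = v e x + w e x)}" for t
  have K: "K_functional \<Gamma> t f = Inf (S t)" for t by (simp add: K_functional_def S_def)
  have w0: "(\<lambda>e x. 0) \<in> H_graph \<Gamma> 1"
    using H1_zero by (auto simp: H_graph_def)
  have ne: "S t \<noteq> {}" for t
  proof -
    have "\<forall>e\<in>edges \<Gamma>. AE x in edge_measure (len \<Gamma> e). f e x = f e x + 0" by simp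
    with f w0 have "L2_graph_norm \<Gamma> f + t * H1_graph_norm \<Gamma> (\<lambda>e x. 0) \<in> S t"
      unfolding S_def by blast
    then show ?thesis by blast
  qed
  have nn: "0 \<le> y" if "y \<in> S t" "0 \<le> t" for y t
    using that unfolding S_def L2_graph_norm_def H1_graph_norm_def by auto
  have bdd: "bdd_below (S t)" if "0 \<le> t" for t using nn that by (intro bdd_belowI[of _ 0]) auto
  show "0 \<le> K_functional \<Gamma> t f" unfolding K using nn t ne by (intro cInf_greatest) auto
  show "\<exists>v w. v \<in> H_graph \<Gamma> 0 \<and> w \<in> H_graph \<Gamma> 1 \<and>
      (\<forall>e\<in>edges \<Gamma>. AE x in edge_measure (len \<Gamma> e). f e x = v e x + w e x) \<and>
      L2_graph_norm \<Gamma> v + t * H1_graph_norm \<Gamma> w < K_functional \<Gamma> t f + e" if "e > 0"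
  proof -
    have "Inf (S t) < K_functional \<Gamma> t f + e" using that by (simp add: K)
    then obtain y where "y \<in> S t" "y < K_functional \<Gamma> t f + e" using cInf_lessD[OF ne] by blast
    then show ?thesis unfolding S_def by blast
  qed
  show "K_functional \<Gamma> t f \<le> K_functional \<Gamma> t' f" if "t \<le> t'"
    unfolding K
  proof (rule cInf_greatest[OF ne])
    fix y assume "y \<in> S t'"
    then obtain v w where vw: "y = L2_graph_norm \<Gamma> v + t' * H1_graph_norm \<Gamma> w" "v \<in> H_graph \<Gamma> 0" "w \<in> H_graph \<Gamma> 1"
      "\<forall>e\<in>edges \<Gamma>. AE x in edge_measure (len \<Gamma> e). f e x = v e x + w e x" unfolding S_def by blast
    have "Inf (S t) \<le> L2_graph_norm \<Gamma> v + t * H1_graph_norm \<Gamma> w"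
      using vw by (intro cInf_lower bdd t) (auto simp: S_def)
    also have "\<dots> \<le> y" unfolding vw(1) H1_graph_norm_def using that by (intro add_left_mono mult_right_mono) auto
    finally show "Inf (S t) \<le> y" .
  qed
qed

text \<open>A lower sum for the interpolation integral: the interval from 2^(-n) to 2 * 2^(-n)
  contributes at least a fixed multiple of the n-th term, and these intervals are disjoint.\<close>

lemma K_functional_dyadic_summable:
  assumes f: "f \<in> interpolation_graph \<Gamma> \<beta>" and \<beta>: "0 < \<beta>"
  shows "summable (\<lambda>n. ((2 powr \<beta>) ^ n * K_functional \<Gamma> ((1 / 2) ^ n) f)\<^sup>2)"
proof -
  define b where "b = 2 powr \<beta>"
  have b: "b > 1" using \<beta> by (simp add: b_def)
  have f0: "f \<in> H_graph \<Gamma> 0" using f by (simp add: interpolation_graph_def)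
  define \<kappa> where "\<kappa> n = K_functional \<Gamma> ((1 / 2) ^ n) f" for n
  have \<kappa>0: "0 \<le> \<kappa> n" for n unfolding \<kappa>_def by (rule K_functional_nonneg[OF f0]) simp
  define F where "F t = ennreal ((t powr (- \<beta>) * K_functional \<Gamma> t f)\<^sup>2 / t)" for t
  define I where "I = (\<integral>\<^sup>+t. F t * indicator {0<..} t \<partial>lborel)"
  have I: "I < \<infinity>" using f by (simp add: interpolation_graph_def I_def F_def)
  define \<tau> where "\<tau> n = (1 / 2 :: real) ^ n" for n
  have \<tau>: "\<tau> n > 0" for n by (simp add: \<tau>_def)
  \<comment> \<open>A lower bound of the integrand on that interval, since K increases in t while
    t^(-\<beta>) and 1/t decrease. Times the length 2^(-n) it becomes the n-th term divided by 2
    b^2.\<close>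
  define g where "g n = (b ^ n * \<kappa> n / b)\<^sup>2 / (2 * \<tau> n)" for n
  have g0: "0 \<le> g n" for n using \<tau>[of n] by (simp add: g_def)
  let ?J = "\<lambda>n. {\<tau> n<..2 * \<tau> n}"
  have gF: "ennreal (g n) \<le> F t" if t: "t \<in> ?J n" for n t
  proof -
    have tp: "0 < t" "\<tau> n \<le> t" "t \<le> 2 * \<tau> n" using t \<tau>[of n] by auto
    have "b ^ n / b = (2 * \<tau> n) powr (- \<beta>)"
    proof -
      have "\<tau> n = 2 powr (- real n)" by (simp add: \<tau>_def powr_minus_divide powr_realpow power_divide)
      then have "2 * \<tau> n = 2 powr (1 - real n)" by (simp add: powr_diff powr_minus_divide)
      then have "(2 * \<tau> n) powr (- \<beta>) = 2 powr ((1 - real n) * (- \<beta>))" by (simp only: powr_powr)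
      also have "(1 - real n) * (- \<beta>) = \<beta> * real n - \<beta>" by (simp add: algebra_simps)
      also have "2 powr (\<beta> * real n - \<beta>) = b ^ n / b"
        using b by (simp only: powr_diff powr_powr[symmetric] b_def[symmetric]) (simp add: powr_realpow)
      finally show ?thesis by simp
    qed
    also have "\<dots> \<le> t powr (- \<beta>)" using tp \<beta> \<tau>[of n] by (intro powr_mono2') auto
    finally have 1: "b ^ n / b \<le> t powr (- \<beta>)" .
    have 2: "\<kappa> n \<le> K_functional \<Gamma> t f"
      using tp \<tau>[of n] unfolding \<kappa>_def \<tau>_def by (intro K_functional_mono[OF f0]) auto
    have "(b ^ n / b) * \<kappa> n \<le> t powr (- \<beta>) * K_functional \<Gamma> t f"
      using \<kappa>0[of n] b by (intro mult_mono 1 2) auto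
    then have "(b ^ n * \<kappa> n / b)\<^sup>2 \<le> (t powr (- \<beta>) * K_functional \<Gamma> t f)\<^sup>2"
      using \<kappa>0[of n] b by (intro power_mono) auto
    then have "g n \<le> (t powr (- \<beta>) * K_functional \<Gamma> t f)\<^sup>2 / t"
      unfolding g_def using tp by (intro frac_le) auto
    then show ?thesis unfolding F_def by (rule ennreal_leI)
  qed
  have disj: "m = n" if "t \<in> ?J n" "t \<in> ?J m" for m n t
  proof (rule ccontr)
    have *: "False" if "t \<in> ?J n" "t \<in> ?J m" "n < m" for m n
    proof -
      have "\<tau> m \<le> \<tau> (Suc n)" unfolding \<tau>_def using that(3) by (intro power_decreasing) auto
      then have "2 * \<tau> m \<le> \<tau> n" by (simp add: \<tau>_def)
      then show False using that(1,2) by auto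
    qed
    assume "m \<noteq> n"
    then show False using *[of n m] *[of m n] that by (cases "n < m") auto
  qed
  have "(\<Sum>n<N. ennreal (g n) * ennreal (\<tau> n)) \<le> I" for N
  proof -
    have "(\<Sum>n<N. ennreal (g n) * ennreal (\<tau> n)) = (\<Sum>n<N. \<integral>\<^sup>+t. ennreal (g n) * indicator (?J n) t \<partial>lborel)"
      using \<tau> by (intro sum.cong) (auto simp: nn_integral_cmult_indicator less_imp_le)
    also have "\<dots> = (\<integral>\<^sup>+t. (\<Sum>n<N. ennreal (g n) * indicator (?J n) t) \<partial>lborel)"
      by (intro nn_integral_sum[symmetric]) simp
    also have "\<dots> \<le> I"
      unfolding I_def
    proof (rule nn_integral_mono)
      fix t :: real
      show "(\<Sum>n<N. ennreal (g n) * indicator (?J n) t) \<le> F t * indicator {0<..} t"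
      proof (cases "\<exists>m<N. t \<in> ?J m")
        case True
        then obtain m where m: "m < N" "t \<in> ?J m" by blast
        have "(\<Sum>n<N. ennreal (g n) * indicator (?J n) t) = (\<Sum>n<N. if n = m then ennreal (g m) else 0)"
        proof (rule sum.cong[OF refl])
          fix n
          show "ennreal (g n) * indicator (?J n) t = (if n = m then ennreal (g m) else 0)"
            using disj[of t n m] m(2) by (cases "n = m") (auto simp: indicator_def)
        qed
        also have "\<dots> = ennreal (g m)" using m(1) by simp
        also have "\<dots> \<le> F t" by (rule gF[OF m(2)])
        finally show ?thesis using m(2) \<tau>[of m] by (auto simp: indicator_def)
      next
        case False
        then have "(\<Sum>n<N. ennreal (g n) * indicator (?J n) t) = 0" by (intro sum.neutral) (auto simp: indicator_def)
        then show ?thesis by simp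
      qed
    qed
    finally show ?thesis .
  qed
  moreover have e: "ennreal (g n) * ennreal (\<tau> n) = ennreal ((b ^ n * \<kappa> n)\<^sup>2 / (2 * b\<^sup>2))" for n
  proof -
    have "g n * \<tau> n = (b ^ n * \<kappa> n)\<^sup>2 / (2 * b\<^sup>2)" using \<tau>[of n] b by (simp add: g_def power_divide)
    then show ?thesis using g0[of n] \<tau>[of n] by (simp only: ennreal_mult[symmetric] less_imp_le)
  qed
  ultimately have le: "ennreal (\<Sum>n<N. (b ^ n * \<kappa> n)\<^sup>2 / (2 * b\<^sup>2)) \<le> I" for N
    by (subst sum_ennreal[symmetric]) auto
  have "(\<Sum>n<N. (b ^ n * \<kappa> n)\<^sup>2 / (2 * b\<^sup>2)) \<le> enn2real I" for N
  proof -
    have "ennreal (\<Sum>n<N. (b ^ n * \<kappa> n)\<^sup>2 / (2 * b\<^sup>2)) \<le> ennreal (enn2real I)" using le[of N] I by simp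
    then show ?thesis by (subst (asm) ennreal_le_iff) auto
  qed
  then have "summable (\<lambda>n. (b ^ n * \<kappa> n)\<^sup>2 / (2 * b\<^sup>2))"
    by (intro summableI_nonneg_bounded) auto
  then have "summable (\<lambda>n. (2 * b\<^sup>2) * ((b ^ n * \<kappa> n)\<^sup>2 / (2 * b\<^sup>2)))" by (rule summable_mult)
  moreover have "(2 * b\<^sup>2) * (y / (2 * b\<^sup>2)) = y" for y using b by simp
  ultimately show ?thesis by (simp only: b_def[symmetric] \<kappa>_def)
qed

text \<open>A decomposition on the whole graph restricts to each edge with no loss, since the graph
  norms dominate the norms of the parts on an edge.\<close>

lemma interpolation_graph_edge:
  assumes fin: "finite (edges \<Gamma>)" and e: "e \<in> edges \<Gamma>" and l: "0 < len \<Gamma> e"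
    and \<beta>: "1 / 2 < \<beta>" "\<beta> < 1" and f: "f \<in> interpolation_graph \<Gamma> \<beta>"
  shows "\<exists>h. continuous_on {0..len \<Gamma> e} h \<and> (AE x in edge_measure (len \<Gamma> e). f e x = h x) \<and>
     summable (\<lambda>n. (2 powr (2 * \<beta> - 1)) ^ n * (\<Sum>j<2 ^ n. (second_diff (len \<Gamma> e) h n j)\<^sup>2))"
proof -
  define b where "b = 2 powr \<beta>"
  have b2: "b\<^sup>2 / 2 = 2 powr (2 * \<beta> - 1)"
  proof -
    have "b\<^sup>2 = 2 powr \<beta> * 2 powr \<beta>" unfolding b_def by (rule power2_eq_square)
    also have "\<dots> = 2 powr (\<beta> + \<beta>)" by (rule powr_add[symmetric])
    finally have sq: "b\<^sup>2 = 2 powr (2 * \<beta>)" by (subst mult_2)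
    have "2 powr (2 * \<beta> - 1) = 2 powr (2 * \<beta>) / 2 powr (1 :: real)" by (rule powr_diff)
    then show ?thesis unfolding sq by simp
  qed
  have b: "1 < b" "b < 2" "1 < b\<^sup>2 / 2"
  proof -
    show "1 < b" using \<beta> by (simp add: b_def)
    have "2 powr \<beta> < (2 :: real) powr 1" using \<beta> by (intro powr_less_mono) auto
    then show "b < 2" by (simp add: b_def)
    show "1 < b\<^sup>2 / 2" unfolding b2 using \<beta> by simp
  qed
  have f0: "f \<in> H_graph \<Gamma> 0" using f by (simp add: interpolation_graph_def)
  let ?l = "len \<Gamma> e"
  define \<kappa> where "\<kappa> n = K_functional \<Gamma> ((1 / 2) ^ n) f" for n
  have \<kappa>0: "0 \<le> \<kappa> n" for n unfolding \<kappa>_def by (rule K_functional_nonneg[OF f0]) simp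
  define P where "P n v w \<longleftrightarrow> v \<in> H_graph \<Gamma> 0 \<and> w \<in> H_graph \<Gamma> 1 \<and>
      (\<forall>e\<in>edges \<Gamma>. AE x in edge_measure (len \<Gamma> e). f e x = v e x + w e x) \<and>
      L2_graph_norm \<Gamma> v + (1 / 2) ^ n * H1_graph_norm \<Gamma> w < \<kappa> n + (1 / 2) ^ n" for n v w
  have "\<exists>v w. P n v w" for n
    unfolding \<kappa>_def P_def by (rule K_functional_approx[OF f0]) auto
  then obtain v w where "\<And>n. P n (v n) (w n)" by metis
  then have vw: "\<And>n. v n \<in> H_graph \<Gamma> 0" "\<And>n. w n \<in> H_graph \<Gamma> 1"
      "\<And>n. \<forall>e\<in>edges \<Gamma>. AE x in edge_measure (len \<Gamma> e). f e x = v n e x + w n e x"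
      "\<And>n. L2_graph_norm \<Gamma> (v n) + (1 / 2) ^ n * H1_graph_norm \<Gamma> (w n) < \<kappa> n + (1 / 2) ^ n"
    unfolding P_def by blast+
  have fe: "f e \<in> L2_edge ?l" using f0 e by (simp add: H_graph_def)
  have ve: "v n e \<in> L2_edge ?l" for n using vw(1)[of n] e by (simp add: H_graph_def)
  have we: "w n e \<in> H_edge ?l (Suc 0)" for n using vw(2)[of n] e by (simp add: H_graph_def)
  define W' where "W' n = weak_deriv ?l (w n e)" for n
  define Q where "Q n W \<longleftrightarrow> primitive ?l W (W' n) \<and> (AE x in edge_measure ?l. w n e x = W x)" for n W
  have "\<exists>W. Q n W" for n
    unfolding W'_def Q_def by (rule H1_primitive[OF l we[of n]]) blast
  then obtain W where "\<And>n. Q n (W n)" by metis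
  then have W: "\<And>n. primitive ?l (W n) (W' n)" "\<And>n. AE x in edge_measure ?l. w n e x = W n x"
    unfolding Q_def by blast+
  \<comment> \<open>The slack 2^(-n), granted because the infimum need not be attained, contributes
    (b/2)^n; this is square summable as b < 2.\<close>
  define a where "a n = b ^ n * (\<kappa> n + (1 / 2) ^ n)" for n
  have a0: "0 \<le> a n" for n using \<kappa>0[of n] b by (simp add: a_def)
  have H1nn: "0 \<le> H1_graph_norm \<Gamma> (w n)" for n by (simp add: H1_graph_norm_def)
  have L2nn: "0 \<le> L2_graph_norm \<Gamma> (v n)" for n by (simp add: L2_graph_norm_def)
  have 1: "L2_norm ?l (\<lambda>x. f e x - W n x) \<le> a n / b ^ n" for n
  proof -
    have WL: "W n \<in> L2_edge ?l" by (rule primitive_L2[OF W(1)])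
    have "AE x in edge_measure ?l. f e x = v n e x + w n e x" using vw(3)[of n] e by blast
    then have "AE x in edge_measure ?l. f e x - W n x = v n e x"
      using W(2)[of n] by eventually_elim simp
    then have "L2_norm ?l (\<lambda>x. f e x - W n x) = L2_norm ?l (v n e)"
      by (rule L2_norm_cong_AE[OF L2_edge_diff[OF fe WL] ve])
    also have "\<dots> \<le> L2_graph_norm \<Gamma> (v n)"
      unfolding L2_graph_norm_def by (rule member_le_L2_set[OF fin e])
    also have "\<dots> \<le> \<kappa> n + (1 / 2) ^ n"
    proof -
      have "0 \<le> (1 / 2) ^ n * H1_graph_norm \<Gamma> (w n)" using H1nn[of n] by simp
      then show ?thesis using vw(4)[of n] by linarith
    qed
    also have "\<dots> = a n / b ^ n" using b by (simp add: a_def)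
    finally show ?thesis .
  qed
  have 2: "L2_norm ?l (W' n) \<le> (2 / b) ^ n * a n" for n
  proof -
    have "L2_norm ?l (W' n) \<le> H1_norm ?l (w n e)"
      unfolding H1_norm_def W'_def by (rule real_le_rsqrt) simp
    also have "\<dots> \<le> H1_graph_norm \<Gamma> (w n)"
      unfolding H1_graph_norm_def by (rule member_le_L2_set[OF fin e])
    finally have "(1 / 2) ^ n * L2_norm ?l (W' n) \<le> (1 / 2) ^ n * H1_graph_norm \<Gamma> (w n)"
      by (rule mult_left_mono) simp
    also have "\<dots> \<le> \<kappa> n + (1 / 2) ^ n" using vw(4)[of n] L2nn[of n] by linarith
    finally have "2 ^ n * ((1 / 2) ^ n * L2_norm ?l (W' n)) \<le> 2 ^ n * (\<kappa> n + (1 / 2) ^ n)"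
      by (rule mult_left_mono) simp
    moreover have "2 ^ n * ((1 / 2) ^ n * L2_norm ?l (W' n)) = L2_norm ?l (W' n)"
      by (simp add: power_one_over)
    moreover have "2 ^ n * (\<kappa> n + (1 / 2) ^ n) = (2 / b) ^ n * a n"
      using b by (simp add: a_def power_divide)
    ultimately show ?thesis by (simp only:)
  qed
  have 3: "summable (\<lambda>n. (a n)\<^sup>2)"
  proof (rule summable_comparison_test')
    have "summable (\<lambda>n. (b ^ n * \<kappa> n)\<^sup>2)"
      unfolding b_def \<kappa>_def using \<beta> by (intro K_functional_dyadic_summable[OF f]) simp
    moreover have "summable (\<lambda>n. ((b / 2)\<^sup>2) ^ n)"
      using b by (intro summable_geometric) (simp add: abs_square_less_1)
    ultimately show "summable (\<lambda>n. 2 * (b ^ n * \<kappa> n)\<^sup>2 + 2 * ((b / 2)\<^sup>2) ^ n)"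
      by (intro summable_add summable_mult)
    fix n
    have an: "a n = b ^ n * \<kappa> n + (b / 2) ^ n" by (simp add: a_def distrib_left power_divide)
    have sq: "(x + y)\<^sup>2 \<le> 2 * x\<^sup>2 + 2 * y\<^sup>2" for x y :: real
      using zero_le_power2[of "x - y"] by (simp add: power2_eq_square algebra_simps)
    have "((b / 2) ^ n)\<^sup>2 = ((b / 2)\<^sup>2) ^ n" by (simp only: power_mult[symmetric] mult.commute)
    then have "(a n)\<^sup>2 \<le> 2 * (b ^ n * \<kappa> n)\<^sup>2 + 2 * ((b / 2)\<^sup>2) ^ n"
      using sq[of "b ^ n * \<kappa> n" "(b / 2) ^ n"] by (simp only: an)
    then show "norm ((a n)\<^sup>2) \<le> 2 * (b ^ n * \<kappa> n)\<^sup>2 + 2 * ((b / 2)\<^sup>2) ^ n" by simp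
  qed
  from interpolation_edge[OF l b fe W(1) a0 3 1 2] show ?thesis by (simp only: b2)
qed

section \<open>Integration by parts\<close>

text \<open>Both cases lead to one formula for the pairing in terms of a continuous representative u
  of f. Inserting it, the boundary terms cancel and the inner product of u with g'' remains; the
  sign in \<open>end_deriv\<close> at the target end accounts for the boundary term at l.\<close>

lemma edge_integration_by_parts:
  assumes "finite (edges \<Gamma>)" and e: "e \<in> edges \<Gamma>" and l: "0 < len \<Gamma> e"
    and \<beta>: "1 / 2 < \<beta>" "\<beta> \<le> 1" and f: "f \<in> Hs_graph \<Gamma> \<beta>" and g: "g \<in> Hs_graph \<Gamma> 2"
  shows "(\<integral>x. f e x * weak_deriv (len \<Gamma> e) (weak_deriv (len \<Gamma> e) (g e)) x \<partial>edge_measure (len \<Gamma> e))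
    = - (end_value \<Gamma> f (Src e) * end_deriv \<Gamma> g (Src e) + end_value \<Gamma> f (Tgt e) * end_deriv \<Gamma> g (Tgt e))
      - weak_deriv_dual (len \<Gamma> e) \<beta> (f e) (weak_deriv (len \<Gamma> e) (g e))"
proof -
  let ?l = "len \<Gamma> e"
  define g1 where "g1 = weak_deriv ?l (g e)"
  define g2 where "g2 = weak_deriv ?l g1"
  have "(2 :: real) \<in> \<nat>" using of_nat_in_Nats[of 2] by simp
  then have "g e \<in> H_edge ?l (Suc (Suc 0))"
    using g e by (auto simp: Hs_graph_def H_graph_def numeral_2_eq_2)
  then have g1: "g1 \<in> H_edge ?l (Suc 0)" unfolding g1_def by (rule weak_deriv_H2[OF l])
  then have g1L: "g1 \<in> L2_edge ?l" by simp
  obtain h where h: "primitive ?l h g2" "AE x in edge_measure ?l. g1 x = h x"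
    using H1_primitive[OF l g1] unfolding g2_def by blast
  have tr_g: "edge_trace ?l g1 0 = h 0" "edge_trace ?l g1 ?l = h ?l"
    using edge_trace_eq[OF l primitive_continuous_on[OF h(1)] h(2)] l by auto
  have "\<exists>u. continuous_on {0..?l} u \<and> (AE x in edge_measure ?l. f e x = u x) \<and> f e \<in> L2_edge ?l \<and>
      weak_deriv_dual ?l \<beta> (f e) g1 = u ?l * h ?l - u 0 * h 0 - L2_inner ?l u g2"
  proof (cases "\<beta> = 1")
    case True
    then have fe: "f e \<in> H_edge ?l (Suc 0)" using f e by (simp add: Hs_graph_def H_graph_def)
    then obtain u where u: "primitive ?l u (weak_deriv ?l (f e))" "AE x in edge_measure ?l. f e x = u x"
      using H1_primitive[OF l] by blast
    have "weak_deriv_dual ?l \<beta> (f e) g1 = L2_inner ?l g1 (weak_deriv ?l (f e))"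
      using True g1L by (simp add: weak_deriv_dual_def)
    also have "\<dots> = L2_inner ?l h (weak_deriv ?l (f e))"
      by (rule L2_inner_cong_AE[OF g1L primitive_L2[OF h(1)] primitiveD(1)[OF u(1)] h(2)])
    also have "\<dots> = u ?l * h ?l - u 0 * h 0 - L2_inner ?l u g2"
      using primitive_integration_by_parts[OF less_imp_le[OF l] u(1) h(1)] L2_inner_commute[of ?l h] by simp
    finally show ?thesis using u fe primitive_continuous_on[OF u(1)] by (intro exI[of _ u]) simp
  next
    case False
    then have \<beta>1: "\<beta> < 1" using \<beta>(2) by simp
    \<comment> \<open>This selects the interpolation branch of \<open>Hs_graph\<close>.\<close>
    have "\<beta> \<notin> \<nat>"
    proof
      assume "\<beta> \<in> \<nat>"
      then obtain k where "\<beta> = real k" by (rule Nats_cases)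
      then show False using \<beta>(1) \<beta>1 by (cases k) auto
    qed
    then have fi: "f \<in> interpolation_graph \<Gamma> \<beta>" using f by (simp add: Hs_graph_def)
    then have fe: "f e \<in> L2_edge ?l" using e by (simp add: interpolation_graph_def H_graph_def)
    obtain u where u: "continuous_on {0..?l} u" "AE x in edge_measure ?l. f e x = u x"
      "summable (\<lambda>n. (2 powr (2 * \<beta> - 1)) ^ n * (\<Sum>j<2 ^ n. (second_diff ?l u n j)\<^sup>2))"
      using interpolation_graph_edge[OF assms(1) e l \<beta>(1) \<beta>1 fi] by blast
    show ?thesis
      using weak_deriv_dual_primitive[OF l \<beta>(1) \<beta>1 fe u h(1) g1L h(2)] u(1,2) fe by (intro exI[of _ u]) simp
  qed
  then obtain u where u: "continuous_on {0..?l} u" "AE x in edge_measure ?l. f e x = u x" "f e \<in> L2_edge ?l"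
    "weak_deriv_dual ?l \<beta> (f e) g1 = u ?l * h ?l - u 0 * h 0 - L2_inner ?l u g2" by blast
  have tr_f: "edge_trace ?l (f e) 0 = u 0" "edge_trace ?l (f e) ?l = u ?l"
    using edge_trace_eq[OF l u(1,2)] l by auto
  have "(\<integral>x. f e x * g2 x \<partial>edge_measure ?l) = L2_inner ?l (f e) g2" by (simp add: L2_inner_def)
  also have "\<dots> = L2_inner ?l u g2"
    by (rule L2_inner_cong_AE[OF u(3) L2_edge_continuous_on[OF u(1)] primitiveD(1)[OF h(1)] u(2)])
  finally show ?thesis
    using u(4) tr_f tr_g unfolding g2_def g1_def by simp
qed

text \<open>Each edge end lies at exactly one vertex, so the double sum runs once over all edge
  ends. \<open>Src e\<close> and \<open>Tgt e\<close> are distinct even when e is a loop.\<close>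

lemma sum_incident:
  assumes "compact_metric_graph \<Gamma>"
  shows "(\<Sum>v\<in>verts \<Gamma>. \<Sum>a\<in>incident \<Gamma> v. F a) = (\<Sum>e\<in>edges \<Gamma>. F (Src e) + F (Tgt e) :: real)"
proof -
  have fin: "finite (verts \<Gamma>)" "finite (edges \<Gamma>)" and
    ends: "e \<in> edges \<Gamma> \<Longrightarrow> src \<Gamma> e \<in> verts \<Gamma>" "e \<in> edges \<Gamma> \<Longrightarrow> tgt \<Gamma> e \<in> verts \<Gamma>" for e
    using assms by (auto simp: compact_metric_graph_def)
  have inc: "incident \<Gamma> v = Src ` {e \<in> edges \<Gamma>. src \<Gamma> e = v} \<union> Tgt ` {e \<in> edges \<Gamma>. tgt \<Gamma> e = v}" for v
    by (auto simp: incident_def)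
  have "(\<Sum>a\<in>incident \<Gamma> v. F a) = (\<Sum>e | e \<in> edges \<Gamma> \<and> src \<Gamma> e = v. F (Src e)) + (\<Sum>e | e \<in> edges \<Gamma> \<and> tgt \<Gamma> e = v. F (Tgt e))" for v
  proof -
    have "(\<Sum>a\<in>incident \<Gamma> v. F a) = sum F (Src ` {e \<in> edges \<Gamma>. src \<Gamma> e = v}) + sum F (Tgt ` {e \<in> edges \<Gamma>. tgt \<Gamma> e = v})"
      unfolding inc using fin(2) by (intro sum.union_disjoint) auto
    also have "sum F (Src ` {e \<in> edges \<Gamma>. src \<Gamma> e = v}) = (\<Sum>e | e \<in> edges \<Gamma> \<and> src \<Gamma> e = v. F (Src e))"
      by (rule sum.reindex[unfolded o_def]) (simp add: inj_on_def)
    also have "sum F (Tgt ` {e \<in> edges \<Gamma>. tgt \<Gamma> e = v}) = (\<Sum>e | e \<in> edges \<Gamma> \<and> tgt \<Gamma> e = v. F (Tgt e))"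
      by (rule sum.reindex[unfolded o_def]) (simp add: inj_on_def)
    finally show ?thesis .
  qed
  then have "(\<Sum>v\<in>verts \<Gamma>. \<Sum>a\<in>incident \<Gamma> v. F a)
    = (\<Sum>v\<in>verts \<Gamma>. \<Sum>e | e \<in> edges \<Gamma> \<and> src \<Gamma> e = v. F (Src e)) + (\<Sum>v\<in>verts \<Gamma>. \<Sum>e | e \<in> edges \<Gamma> \<and> tgt \<Gamma> e = v. F (Tgt e))"
    by (simp only: sum.distrib)
  also have "(\<Sum>v\<in>verts \<Gamma>. \<Sum>e | e \<in> edges \<Gamma> \<and> src \<Gamma> e = v. F (Src e)) = (\<Sum>e\<in>edges \<Gamma>. F (Src e))"
    by (rule sum.group[OF fin(2,1)]) (use ends in auto)
  also have "(\<Sum>v\<in>verts \<Gamma>. \<Sum>e | e \<in> edges \<Gamma> \<and> tgt \<Gamma> e = v. F (Tgt e)) = (\<Sum>e\<in>edges \<Gamma>. F (Tgt e))"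
    by (rule sum.group[OF fin(2,1)]) (use ends in auto)
  finally show ?thesis by (simp only: sum.distrib)
qed

theorem lemma5p8:
  fixes \<Gamma> :: "('v, 'e) metric_graph" and \<beta> :: real and f g :: "'e \<Rightarrow> real \<Rightarrow> real"
  assumes "compact_metric_graph \<Gamma>"
    and "1 / 2 < \<beta>" and "\<beta> \<le> 1"
    and "f \<in> Hs_graph \<Gamma> \<beta>"
    and "g \<in> Hs_graph \<Gamma> 2"
  shows "(\<Sum>e\<in>edges \<Gamma>. \<integral>x. f e x * weak_deriv (len \<Gamma> e) (weak_deriv (len \<Gamma> e) (g e)) x
            \<partial>edge_measure (len \<Gamma> e)) =
         - (\<Sum>v\<in>verts \<Gamma>. \<Sum>a\<in>incident \<Gamma> v. end_value \<Gamma> f a * end_deriv \<Gamma> g a)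
         - (\<Sum>e\<in>edges \<Gamma>. weak_deriv_dual (len \<Gamma> e) \<beta> (f e) (weak_deriv (len \<Gamma> e) (g e)))
       \<and>
       ((\<forall>v\<in>verts \<Gamma>. kirchhoff_at_vertex \<Gamma> g v) \<and> (\<forall>v\<in>verts \<Gamma>. continuous_at_vertex \<Gamma> f v) \<longrightarrow>
        (\<Sum>e\<in>edges \<Gamma>. \<integral>x. f e x * weak_deriv (len \<Gamma> e) (weak_deriv (len \<Gamma> e) (g e)) x
            \<partial>edge_measure (len \<Gamma> e)) =
         - (\<Sum>e\<in>edges \<Gamma>. weak_deriv_dual (len \<Gamma> e) \<beta> (f e) (weak_deriv (len \<Gamma> e) (g e))))"
proof -
  have fin: "finite (edges \<Gamma>)" and len: "\<And>e. e \<in> edges \<Gamma> \<Longrightarrow> 0 < len \<Gamma> e"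
    using assms(1) by (auto simp: compact_metric_graph_def)
  let ?L = "\<Sum>e\<in>edges \<Gamma>. \<integral>x. f e x * weak_deriv (len \<Gamma> e) (weak_deriv (len \<Gamma> e) (g e)) x \<partial>edge_measure (len \<Gamma> e)"
  let ?D = "\<Sum>e\<in>edges \<Gamma>. weak_deriv_dual (len \<Gamma> e) \<beta> (f e) (weak_deriv (len \<Gamma> e) (g e))"
  let ?B = "\<lambda>a. end_value \<Gamma> f a * end_deriv \<Gamma> g a"
  have "?L = (\<Sum>e\<in>edges \<Gamma>. - (?B (Src e) + ?B (Tgt e)) - weak_deriv_dual (len \<Gamma> e) \<beta> (f e) (weak_deriv (len \<Gamma> e) (g e)))"
    by (rule sum.cong[OF refl edge_integration_by_parts[OF fin _ len assms(2-5)]])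
  also have "\<dots> = - (\<Sum>e\<in>edges \<Gamma>. ?B (Src e) + ?B (Tgt e)) - ?D"
    by (simp only: sum_subtractf sum_negf)
  also have "(\<Sum>e\<in>edges \<Gamma>. ?B (Src e) + ?B (Tgt e)) = (\<Sum>v\<in>verts \<Gamma>. \<Sum>a\<in>incident \<Gamma> v. ?B a)"
    by (rule sum_incident[OF assms(1), symmetric])
  finally have main: "?L = - (\<Sum>v\<in>verts \<Gamma>. \<Sum>a\<in>incident \<Gamma> v. ?B a) - ?D" .
  \<comment> \<open>Continuity gives f a common value at all ends meeting in v, which factors out of
    the sum and leaves the Kirchhoff sum; an isolated vertex contributes an empty sum.\<close>
  have vanish: "(\<Sum>a\<in>incident \<Gamma> v. ?B a) = 0" if "kirchhoff_at_vertex \<Gamma> g v" "continuous_at_vertex \<Gamma> f v" for v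
  proof (cases "incident \<Gamma> v = {}")
    case False
    then obtain a0 where a0: "a0 \<in> incident \<Gamma> v" by blast
    have "(\<Sum>a\<in>incident \<Gamma> v. ?B a) = (\<Sum>a\<in>incident \<Gamma> v. end_value \<Gamma> f a0 * end_deriv \<Gamma> g a)"
    proof (rule sum.cong[OF refl])
      fix a assume "a \<in> incident \<Gamma> v"
      then have "end_value \<Gamma> f a = end_value \<Gamma> f a0"
        using that(2) a0 unfolding continuous_at_vertex_def by blast
      then show "?B a = end_value \<Gamma> f a0 * end_deriv \<Gamma> g a" by (simp only:)
    qed
    also have "\<dots> = 0"
      using that(1) unfolding kirchhoff_at_vertex_def by (simp only: sum_distrib_left[symmetric] mult_zero_right)
    finally show ?thesis .
  qed simp
  show ?thesis
  proof (intro conjI impI)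
    show "?L = - (\<Sum>v\<in>verts \<Gamma>. \<Sum>a\<in>incident \<Gamma> v. ?B a) - ?D" by (rule main)
    assume K: "(\<forall>v\<in>verts \<Gamma>. kirchhoff_at_vertex \<Gamma> g v) \<and> (\<forall>v\<in>verts \<Gamma>. continuous_at_vertex \<Gamma> f v)"
    have "(\<Sum>v\<in>verts \<Gamma>. \<Sum>a\<in>incident \<Gamma> v. ?B a) = 0"
    proof (rule sum.neutral, rule ballI)
      fix v assume "v \<in> verts \<Gamma>"
      with K show "(\<Sum>a\<in>incident \<Gamma> v. ?B a) = 0" by (intro vanish) (drule conjunct1, erule (1) bspec, drule conjunct2, erule (1) bspec)
    qed
    with main show "?L = - ?D" by (simp only: minus_zero diff_0)
  qed
qed

end
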